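(* Let $X$ be an oriented compact $3$-manifold whose boundary is a torus $T$, with fixed meridian $\mu$ and longitude $\lambda$ on $T$ and collar coordinates $(x,y,r)$ as described in the context. Let $G$ be the universal covering group of $\mathrm{U}(2,1)$. Let $A_t$, $0\le t\le1$, be a path of normal form flat $G$-connections on $X$, with corresponding path of holonomy representations $\rho_t:\pi_1(X)\to G$. All parameters below are real functions of $t$, a dot denotes $d/dt$, and $\equiv$ denotes congruence modulo $\mathbf{Z}$. (I) Elliptic. If $\rho_t(\mu)$ and $\rho_t(\lambda)$ are elliptic and the normal form of $A_t$ near the boundary is $$\mathrm{diag}\big(2\pi i(\alpha_1(t)dx+\beta_1(t)dy),\ 2\pi i(\alpha_2(t)dx+\beta_2(t)dy),\ 2\pi i(\alpha_3(t)dx+\beta_3(t)dy)\big),$$ then $$cs(A_1)-cs(A_0)\equiv\frac12\int_0^1\big[(\alpha_1\dot\beta_1-\dot\alpha_1\beta_1)+(\alpha_2\dot\beta_2-\dot\alpha_2\beta_2)+(\alpha_3\dot\beta_3-\dot\alpha_3\beta_3)\big]dt.$$ (II) Loxodromic. If $\rho_t(\mu)$ and $\rho_t(\lambda)$ are loxodromic and the normal form of $A_t$ near the boundary is $$\begin{pmatrix}2\pi i(\theta_1(t)dx+\tau_1(t)dy)&0&0\\0&2\pi i(\theta_2(t)dx+\tau_2(t)dy)&u(t)dx+v(t)dy\\0&u(t)dx+v(t)dy&2\pi i(\theta_2(t)dx+\tau_2(t)dy)\end{pmatrix},$$ then $$cs(A_1)-cs(A_0)\equiv\frac12\int_0^1(\theta_1\dot\tau_1-\dot\theta_1\tau_1)dt+\int_0^1(\theta_2\dot\tau_2-\dot\theta_2\tau_2)dt+\frac{1}{4\pi^2}\int_0^1(\dot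 uv-u\dot v)dt.$$ (III) Parabolic, Case 1. If $\rho_t(\mu)$ and $\rho_t(\lambda)$ are parabolic with unipotent parts having minimal polynomial $(x-1)^3$, and, writing $\omega_t=p(t)dx+q(t)dy$, $\eta_t=a(t)dx+b(t)dy$, $\xi_t=2\pi i(\alpha(t)dx+\beta(t)dy)$, the normal form of $A_t$ near the boundary is $$\begin{pmatrix}-i\omega_t+\xi_t&\eta_t&i\omega_t\\-\eta_t&\xi_t&\eta_t\\-i\omega_t&\eta_t&i\omega_t+\xi_t\end{pmatrix},$$ then $$cs(A_1)-cs(A_0)\equiv\frac32\int_0^1(\alpha\dot\beta-\dot\alpha\beta)dt.$$ (III) Parabolic, Case 2. If $\rho_t(\mu)$ and $\rho_t(\lambda)$ are parabolic with unipotent parts having minimal polynomial $(x-1)^2$, and, writing $\omega_t=p(t)dx+q(t)dy$, $\xi_{j,t}=2\pi i(\theta_j(t)dx+\tau_j(t)dy)$ for $j=1,2$, the normal form of $A_t$ near the boundary is $$\begin{pmatrix}\xi_{1,t}-i\omega_t&0&i\omega_t\\0&\xi_{2,t}&0\\-i\omega_t&0&\xi_{1,t}+i\omega_t\end{pmatrix},$$ then $$cs(A_1)-cs(A_0)\equiv\int_0^1(\theta_1\dot\tau_1-\dot\theta_1\tau_1)dt+\frac12\int_0^1(\theta_2\dot\tau_2-\dot\theta_2\tau_2)dt.$$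
   Context: $\mathrm{U}(2,1)$ is the group of complex $3\times 3$ matrices $A$ with $JA^\dagger J=A^{-1}$, $J=\mathrm{diag}(1,1,-1)$, $A^\dagger$ the conjugate transpose; it acts on the open unit ball of $\mathbf{C}^2$, a model of the complex hyperbolic plane $H^2_{\mathbf{C}}$, by fractional linear transformations. $G$ is its universal covering group, with Lie algebra identified with $\mathfrak{u}(2,1)$. An element of $\mathrm{U}(2,1)$ is elliptic if it has a fixed point in $H^2_{\mathbf{C}}$; parabolic if it has a unique fixed point in $\overline{H^2_{\mathbf{C}}}$, lying on $\partial H^2_{\mathbf{C}}$; loxodromic if it has exactly two fixed points in $\overline{H^2_{\mathbf{C}}}$, both lying on $\partial H^2_{\mathbf{C}}$. An element of $G$ has the type of its image in $\mathrm{U}(2,1)$. A parabolic element $g\in\mathrm{U}(2,1)$ has a unique decomposition $g=pe=ep$ with $p$ unipotent (the unipotent part) and $e$ elliptic. Collar coordinates. The torus $T=\partial X$ carries coordinates $(e^{2\pi ix},e^{2\pi iy})$ such that $\mathbf{R}^2\to T$, $(x,y)\mapsto(e^{2\pi ix},e^{2\pi iy})$, sends the horizontal line to $\mu$ and the vertical line to $\lambda$. $T\times[0,1]$ is a collar of $T$ in $X$ with coordinate $r\in[0,1]$, $T\times\{1\}=\partial X$, and $\{dx,dy,dr\}$ is an oriented basis of $1$-forms on $X$ near $T$; $T$ is oriented by the "outward normal last" convention. Principal $G$-bundles over $X$ are trivial, so a flat $G$-connection is regarded as a $\mathfrak{u}(2,1)$-valued $1$-form $A$ on $X$ with $dA+A\wedge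 A=0$. It is in normal form if near $\partial X$ it equals one of the four matrices of $1$-forms displayed in cases (I), (II), (III) Case 1, (III) Case 2 of the claim (for constant real parameters). For a normal form flat connection $A$, $$cs(A):=\int_X\frac{1}{8\pi^2}\mathrm{Tr}\Big(A\wedge dA+\frac23A\wedge A\wedge A\Big)\mod\mathbf{Z}.$$ *)

theory Defs
  imports "HOL-Analysis.Analysis" "HOL-Computational_Algebra.Polynomial" "HOL-Algebra.Group"
begin

section \<open>Smooth functions on sets with boundary\<close>

text \<open>
  Only used for relatively open subsets of a half space, of a slab, or of the product of such a set
  with an interval. There Frechet derivatives within the set are unique, so this says
  that all iterated partial derivatives exist and are continuous up to the boundary
  (by Whitney and Seeley, equivalent to having local smooth extensions).
\<close>

primrec Ck_on ::
  "nat \<Rightarrow> 'a::real_normed_vector set \<Rightarrow> ('a \<Rightarrow> 'b::real_normed_vector) \<Rightarrow> bool" where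
  "Ck_on 0 S f \<longleftrightarrow> continuous_on S f"
| "Ck_on (Suc k) S f \<longleftrightarrow> f differentiable_on S \<and>
     (\<forall>v. Ck_on k S (\<lambda>x. frechet_derivative f (at x within S) v))"

definition smooth_on :: "'a::real_normed_vector set \<Rightarrow> ('a \<Rightarrow> 'b::real_normed_vector) \<Rightarrow> bool" where
  "smooth_on S f \<longleftrightarrow> (\<forall>k. Ck_on k S f)"

section \<open>Oriented compact 3-manifolds with boundary\<close>

text \<open>A chart is a pair of its domain and its coordinate map, which takes values in \<open>halfspace\<close>.\<close>

type_synonym 'a chart = "'a set \<times> ('a \<Rightarrow> real^3)"

definition halfspace :: "(real^3) set" where
  "halfspace = {z. z $ 3 \<le> 0}"

abbreviation cdom :: "'a chart \<Rightarrow> 'a set" where "cdom c \<equiv> fst c"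
abbreviation cmap :: "'a chart \<Rightarrow> 'a \<Rightarrow> real^3" where "cmap c \<equiv> snd c"
abbreviation cimg :: "'a chart \<Rightarrow> (real^3) set" where "cimg c \<equiv> cmap c ` cdom c"

definition cinv :: "'a chart \<Rightarrow> real^3 \<Rightarrow> 'a" where
  "cinv c = inv_into (cdom c) (cmap c)"

definition is_chart :: "'a topology \<Rightarrow> 'a chart \<Rightarrow> bool" where
  "is_chart X c \<longleftrightarrow> openin X (cdom c) \<and> openin (top_of_set halfspace) (cimg c) \<and>
     homeomorphic_map (subtopology X (cdom c)) (top_of_set (cimg c)) (cmap c)"

definition overlap :: "'a chart \<Rightarrow> 'a chart \<Rightarrow> (real^3) set" where
  "overlap c d = cmap c ` (cdom c \<inter> cdom d)"

definition transition :: "'a chart \<Rightarrow> 'a chart \<Rightarrow> real^3 \<Rightarrow> real^3" where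
  "transition c d = cmap d \<circ> cinv c"

definition D_transition :: "'a chart \<Rightarrow> 'a chart \<Rightarrow> real^3 \<Rightarrow> real^3 \<Rightarrow> real^3" where
  "D_transition c d z = frechet_derivative (transition c d) (at z within overlap c d)"

definition oriented_compact_3manifold :: "'a topology \<Rightarrow> 'a chart set \<Rightarrow> bool" where
  "oriented_compact_3manifold X \<A> \<longleftrightarrow>
     compact_space X \<and> Hausdorff_space X \<and>
     (\<forall>c\<in>\<A>. is_chart X c) \<and> (\<Union>c\<in>\<A>. cdom c) = topspace X \<and>
     (\<forall>c\<in>\<A>. \<forall>d\<in>\<A>. smooth_on (overlap c d) (transition c d) \<and>
        (\<forall>z\<in>overlap c d. 0 < det (matrix (D_transition c d z))))"

definition manifold_boundary :: "'a topology \<Rightarrow> 'a chart set \<Rightarrow> 'a set" where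
  "manifold_boundary X \<A> = {p \<in> topspace X. \<exists>c\<in>\<A>. p \<in> cdom c \<and> cmap c p $ 3 = 0}"

section \<open>Collar coordinates\<close>

text \<open>
  The collar \<open>T \<times> [0,1]\<close> is given through its lift \<open>\<kappa>\<close> to the slab of all \<open>(x,y,r)\<close> with
  \<open>0 \<le> r \<le> 1\<close>, which identifies two points iff they have equal \<open>r\<close> and the same
  \<open>(exp (2 \<pi> i x), exp (2 \<pi> i y))\<close>.
  It is a local diffeomorphism preserving the orientations, the slab being oriented by
  \<open>dx, dy, dr\<close>, and maps the plane \<open>r = 1\<close> onto the whole boundary of \<open>X\<close>, which is thus a torus.
\<close>

definition slab :: "(real^3) set" where
  "slab = {z. 0 \<le> z $ 3 \<and> z $ 3 \<le> 1}"

definition collar_part :: "(real^3 \<Rightarrow> 'a) \<Rightarrow> 'a chart \<Rightarrow> (real^3) set" where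
  "collar_part \<kappa> c = {z \<in> slab. \<kappa> z \<in> cdom c}"

definition D_collar :: "(real^3 \<Rightarrow> 'a) \<Rightarrow> 'a chart \<Rightarrow> real^3 \<Rightarrow> real^3 \<Rightarrow> real^3" where
  "D_collar \<kappa> c z = frechet_derivative (cmap c \<circ> \<kappa>) (at z within collar_part \<kappa> c)"

definition torus_collar :: "'a topology \<Rightarrow> 'a chart set \<Rightarrow> (real^3 \<Rightarrow> 'a) \<Rightarrow> bool" where
  "torus_collar X \<A> \<kappa> \<longleftrightarrow>
     continuous_map (top_of_set slab) X \<kappa> \<and>
     (\<forall>z\<in>slab. \<forall>w\<in>slab. \<kappa> z = \<kappa> w \<longleftrightarrow>
        cis (2 * pi * z $ 1) = cis (2 * pi * w $ 1) \<and>
        cis (2 * pi * z $ 2) = cis (2 * pi * w $ 2) \<and> z $ 3 = w $ 3) \<and>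
     \<kappa> ` {z. z $ 3 = 1} = manifold_boundary X \<A> \<and>
     openin X (\<kappa> ` {z. 0 < z $ 3 \<and> z $ 3 \<le> 1}) \<and>
     (\<forall>c\<in>\<A>. smooth_on (collar_part \<kappa> c) (cmap c \<circ> \<kappa>) \<and>
        (\<forall>z\<in>collar_part \<kappa> c. 0 < det (matrix (D_collar \<kappa> c z))))"

definition meridian :: "(real^3 \<Rightarrow> 'a) \<Rightarrow> real \<Rightarrow> 'a" where
  "meridian \<kappa> s = \<kappa> (vector [s, 0, 1])"

definition longitude :: "(real^3 \<Rightarrow> 'a) \<Rightarrow> real \<Rightarrow> 'a" where
  "longitude \<kappa> s = \<kappa> (vector [0, s, 1])"

section \<open>The group U(2,1), its Lie algebra and its action on the closed unit ball\<close>

type_synonym cmat = "complex^3^3"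

definition dagger :: "cmat \<Rightarrow> cmat" where
  "dagger M = (\<chi> i j. cnj (M $ j $ i))"

definition J21 :: cmat where
  "J21 = vector [vector [1, 0, 0], vector [0, 1, 0], vector [0, 0, -1]]"

definition U21 :: "cmat set" where
  "U21 = {M. invertible M \<and> J21 ** dagger M ** J21 = matrix_inv M}"

definition u21 :: "cmat set" where
  "u21 = {M. J21 ** dagger M ** J21 = - M}"

definition frac_lin :: "cmat \<Rightarrow> complex^2 \<Rightarrow> complex^2" where
  "frac_lin M z = (let w = M *v vector [z $ 1, z $ 2, 1] in vector [w $ 1 / w $ 3, w $ 2 / w $ 3])"

definition elliptic :: "cmat \<Rightarrow> bool" where
  "elliptic M \<longleftrightarrow> M \<in> U21 \<and> (\<exists>z\<in>ball 0 1. frac_lin M z = z)"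

definition parabolic :: "cmat \<Rightarrow> bool" where
  "parabolic M \<longleftrightarrow> M \<in> U21 \<and> (\<exists>z\<in>sphere 0 1. {w \<in> cball 0 1. frac_lin M w = w} = {z})"

definition loxodromic :: "cmat \<Rightarrow> bool" where
  "loxodromic M \<longleftrightarrow> M \<in> U21 \<and>
     card {w \<in> cball 0 1. frac_lin M w = w} = 2 \<and>
     {w \<in> cball 0 1. frac_lin M w = w} \<subseteq> sphere 0 1"

definition mat_pow :: "cmat \<Rightarrow> nat \<Rightarrow> cmat" where
  "mat_pow M n = (((**) M) ^^ n) (mat 1)"

definition mat_poly :: "complex poly \<Rightarrow> cmat \<Rightarrow> cmat" where
  "mat_poly q M = (\<Sum>i\<le>degree q. mat (coeff q i) ** mat_pow M i)"

definition is_minimal_poly :: "complex poly \<Rightarrow> cmat \<Rightarrow> bool" where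
  "is_minimal_poly q M \<longleftrightarrow> lead_coeff q = 1 \<and> mat_poly q M = 0 \<and>
     (\<forall>r. r \<noteq> 0 \<and> mat_poly r M = 0 \<longrightarrow> degree q \<le> degree r)"

definition unipotent :: "cmat \<Rightarrow> bool" where
  "unipotent M \<longleftrightarrow> (\<exists>n. mat_pow (M - mat 1) n = 0)"

definition unipotent_part :: "cmat \<Rightarrow> cmat" where
  "unipotent_part M = (THE p. p \<in> U21 \<and> unipotent p \<and>
     (\<exists>e. elliptic e \<and> M = p ** e \<and> M = e ** p))"

section \<open>The universal covering group of U(2,1)\<close>

text \<open>
  Standard model: homotopy classes (with fixed end points) of paths in U(2,1) that start at the
  identity, multiplied pointwise; the covering projection takes the end point.
\<close>

type_synonym cover_elt = "(real \<Rightarrow> cmat) set"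

definition path_class :: "(real \<Rightarrow> cmat) \<Rightarrow> cover_elt" where
  "path_class g = {h. homotopic_paths U21 g h}"

definition cover_group :: "cover_elt monoid" where
  "cover_group =
    \<lparr>carrier = path_class ` {g. path g \<and> path_image g \<subseteq> U21 \<and> pathstart g = mat 1},
     monoid.mult = (\<lambda>C D. \<Union>g\<in>C. \<Union>h\<in>D. path_class (\<lambda>s. g s ** h s)),
     one = path_class (\<lambda>s. mat 1)\<rparr>"

definition cover_proj :: "cover_elt \<Rightarrow> cmat" where
  "cover_proj C = (THE M. \<forall>g\<in>C. pathfinish g = M)"

definition has_type :: "(cmat \<Rightarrow> bool) \<Rightarrow> cover_elt \<Rightarrow> bool" where
  "has_type P C \<longleftrightarrow> C \<in> carrier cover_group \<and> P (cover_proj C)"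

definition parabolic_with :: "complex poly \<Rightarrow> cmat \<Rightarrow> bool" where
  "parabolic_with q M \<longleftrightarrow> parabolic M \<and> is_minimal_poly q (unipotent_part M)"

section \<open>Flat connections\<close>

text \<open>
  A matrix-valued 1-form is given by its local expressions: \<open>A c z v\<close> is the value, in the chart
  \<open>c\<close> and at the coordinate point \<open>z\<close>, on the tangent vector with coordinates \<open>v\<close>.
\<close>

type_synonym 'a mform1 = "'a chart \<Rightarrow> real^3 \<Rightarrow> real^3 \<Rightarrow> cmat"

definition u21_form :: "'a chart set \<Rightarrow> 'a mform1 \<Rightarrow> bool" where
  "u21_form \<A> A \<longleftrightarrow>
     (\<forall>c\<in>\<A>. (\<forall>z\<in>cimg c. linear (A c z) \<and> range (A c z) \<subseteq> u21) \<and>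
             (\<forall>v. smooth_on (cimg c) (\<lambda>z. A c z v))) \<and>
     (\<forall>c\<in>\<A>. \<forall>d\<in>\<A>. \<forall>z\<in>overlap c d. \<forall>v.
        A c z v = A d (transition c d z) (D_transition c d z v))"

text \<open>
  Exterior calculus of matrix-valued forms on a region \<open>S\<close> of coordinate space, with
  the normalisation in which \<open>dx \<and> dy \<and> dr\<close> takes the value 1 on the standard basis.
\<close>

definition ext_d ::
  "(real^3) set \<Rightarrow> (real^3 \<Rightarrow> real^3 \<Rightarrow> cmat) \<Rightarrow> real^3 \<Rightarrow> real^3 \<Rightarrow> real^3 \<Rightarrow> cmat" where
  "ext_d S a z v w = frechet_derivative (\<lambda>x. a x w) (at z within S) v -
                     frechet_derivative (\<lambda>x. a x v) (at z within S) w"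

definition wedge11 ::
  "(real^3 \<Rightarrow> cmat) \<Rightarrow> (real^3 \<Rightarrow> cmat) \<Rightarrow> real^3 \<Rightarrow> real^3 \<Rightarrow> cmat" where
  "wedge11 a b v w = a v ** b w - a w ** b v"

definition wedge12 ::
  "(real^3 \<Rightarrow> cmat) \<Rightarrow> (real^3 \<Rightarrow> real^3 \<Rightarrow> cmat) \<Rightarrow> real^3 \<Rightarrow> real^3 \<Rightarrow> real^3 \<Rightarrow> cmat" where
  "wedge12 a b u v w = a u ** b v w - a v ** b u w + a w ** b u v"

definition flat :: "'a chart set \<Rightarrow> 'a mform1 \<Rightarrow> bool" where
  "flat \<A> A \<longleftrightarrow> (\<forall>c\<in>\<A>. \<forall>z\<in>cimg c. \<forall>v w.
     ext_d (cimg c) (A c) z v w + wedge11 (A c z) (A c z) v w = 0)"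

definition flat_connection :: "'a chart set \<Rightarrow> 'a mform1 \<Rightarrow> bool" where
  "flat_connection \<A> A \<longleftrightarrow> u21_form \<A> A \<and> flat \<A> A"

definition smooth_path_of_flat_connections :: "'a chart set \<Rightarrow> (real \<Rightarrow> 'a mform1) \<Rightarrow> bool" where
  "smooth_path_of_flat_connections \<A> A \<longleftrightarrow>
     (\<forall>t\<in>{0..1}. flat_connection \<A> (A t)) \<and>
     (\<forall>c\<in>\<A>. \<forall>v. smooth_on ({0..1} \<times> cimg c) (\<lambda>(t, z). A t c z v))"

section \<open>The holonomy representation\<close>

definition loop_class :: "'a topology \<Rightarrow> (real \<Rightarrow> 'a) \<Rightarrow> (real \<Rightarrow> 'a) set" where
  "loop_class X \<gamma> =
     {\<delta>. homotopic_with (\<lambda>h. h 0 = \<gamma> 0 \<and> h 1 = \<gamma> 1) (top_of_set {0..1}) X \<gamma> \<delta>}"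

definition smooth_curve :: "'a chart set \<Rightarrow> (real \<Rightarrow> 'a) \<Rightarrow> bool" where
  "smooth_curve \<A> \<gamma> \<longleftrightarrow> (\<forall>c\<in>\<A>. smooth_on {s \<in> {0..1}. \<gamma> s \<in> cdom c} (cmap c \<circ> \<gamma>))"

text \<open>
  The convention \<open>h' = h A(\<gamma>')\<close> (rather than \<open>h' = - A(\<gamma>') h\<close>, whose solutions are the inverses)
  makes the holonomy multiplicative when the loop \<open>\<gamma>\<close> is traversed first in \<open>\<gamma> \<delta>\<close>; the
  compatibility condition of this equation is \<open>dA + A \<and> A = 0\<close>.
\<close>

definition parallel_transport ::
  "'a chart set \<Rightarrow> 'a mform1 \<Rightarrow> (real \<Rightarrow> 'a) \<Rightarrow> (real \<Rightarrow> cmat) \<Rightarrow> bool" where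
  "parallel_transport \<A> A \<gamma> h \<longleftrightarrow> h 0 = mat 1 \<and>
     (\<forall>s\<in>{0..1}. \<forall>c\<in>\<A>. \<gamma> s \<in> cdom c \<longrightarrow>
        (h has_vector_derivative
           h s ** A c (cmap c (\<gamma> s)) (vector_derivative (cmap c \<circ> \<gamma>) (at s within {0..1})))
        (at s within {0..1}))"

text \<open>
  The value on a homotopy class \<open>C\<close> of loops is the element of the covering group represented by
  the parallel transport along any smooth loop in \<open>C\<close>; for a flat connection all choices give the
  same class.
\<close>

definition holonomy_rep ::
  "'a chart set \<Rightarrow> 'a mform1 \<Rightarrow> (real \<Rightarrow> 'a) set \<Rightarrow> cover_elt" where
  "holonomy_rep \<A> A C =
     \<Union> {path_class h | \<gamma> h. \<gamma> \<in> C \<and> smooth_curve \<A> \<gamma> \<and> parallel_transport \<A> A \<gamma> h}"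

section \<open>Normal forms near the boundary\<close>

definition dx :: "real^3 \<Rightarrow> complex" where "dx v = of_real (v $ 1)"
definition dy :: "real^3 \<Rightarrow> complex" where "dy v = of_real (v $ 2)"

text \<open>The constant 1-form \<open>p dx + q dy\<close>, and \<open>2 \<pi> i\<close> times it.\<close>

definition lin :: "real \<Rightarrow> real \<Rightarrow> real^3 \<Rightarrow> complex" where
  "lin p q v = of_real p * dx v + of_real q * dy v"

definition tlin :: "real \<Rightarrow> real \<Rightarrow> real^3 \<Rightarrow> complex" where
  "tlin p q v = 2 * of_real pi * \<i> * lin p q v"

definition nf_elliptic ::
  "real \<Rightarrow> real \<Rightarrow> real \<Rightarrow> real \<Rightarrow> real \<Rightarrow> real \<Rightarrow> real^3 \<Rightarrow> cmat" where
  "nf_elliptic \<alpha>1 \<beta>1 \<alpha>2 \<beta>2 \<alpha>3 \<beta>3 v = vector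
     [vector [tlin \<alpha>1 \<beta>1 v, 0, 0],
      vector [0, tlin \<alpha>2 \<beta>2 v, 0],
      vector [0, 0, tlin \<alpha>3 \<beta>3 v]]"

definition nf_loxodromic ::
  "real \<Rightarrow> real \<Rightarrow> real \<Rightarrow> real \<Rightarrow> real \<Rightarrow> real \<Rightarrow> real^3 \<Rightarrow> cmat" where
  "nf_loxodromic \<theta>1 \<tau>1 \<theta>2 \<tau>2 a b v = vector
     [vector [tlin \<theta>1 \<tau>1 v, 0, 0],
      vector [0, tlin \<theta>2 \<tau>2 v, lin a b v],
      vector [0, lin a b v, tlin \<theta>2 \<tau>2 v]]"

definition nf_parabolic1 ::
  "real \<Rightarrow> real \<Rightarrow> real \<Rightarrow> real \<Rightarrow> real \<Rightarrow> real \<Rightarrow> real^3 \<Rightarrow> cmat" where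
  "nf_parabolic1 p q a b \<alpha> \<beta> v =
     (let \<omega> = lin p q v; \<eta> = lin a b v; \<xi> = tlin \<alpha> \<beta> v in vector
     [vector [- \<i> * \<omega> + \<xi>, \<eta>, \<i> * \<omega>],
      vector [- \<eta>, \<xi>, \<eta>],
      vector [- \<i> * \<omega>, \<eta>, \<i> * \<omega> + \<xi>]])"

definition nf_parabolic2 ::
  "real \<Rightarrow> real \<Rightarrow> real \<Rightarrow> real \<Rightarrow> real \<Rightarrow> real \<Rightarrow> real^3 \<Rightarrow> cmat" where
  "nf_parabolic2 p q \<theta>1 \<tau>1 \<theta>2 \<tau>2 v =
     (let \<omega> = lin p q v; \<xi>1 = tlin \<theta>1 \<tau>1 v; \<xi>2 = tlin \<theta>2 \<tau>2 v in vector
     [vector [\<xi>1 - \<i> * \<omega>, 0, \<i> * \<omega>],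
      vector [0, \<xi>2, 0],
      vector [- \<i> * \<omega>, 0, \<xi>1 + \<i> * \<omega>]])"

text \<open>\<open>A\<close>, pulled back by the collar coordinates, equals the constant form \<open>N\<close> for \<open>r\<close> close to 1.\<close>

definition equals_near_boundary ::
  "'a chart set \<Rightarrow> (real^3 \<Rightarrow> 'a) \<Rightarrow> 'a mform1 \<Rightarrow> (real^3 \<Rightarrow> cmat) \<Rightarrow> bool" where
  "equals_near_boundary \<A> \<kappa> A N \<longleftrightarrow> (\<exists>\<epsilon>>0. \<forall>c\<in>\<A>. \<forall>z\<in>collar_part \<kappa> c. 1 - \<epsilon> < z $ 3 \<longrightarrow>
     (\<forall>v. A c (cmap c (\<kappa> z)) (D_collar \<kappa> c z v) = N v))"

definition normal_form :: "'a chart set \<Rightarrow> (real^3 \<Rightarrow> 'a) \<Rightarrow> 'a mform1 \<Rightarrow> bool" where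
  "normal_form \<A> \<kappa> A \<longleftrightarrow> (\<exists>a1 a2 a3 a4 a5 a6.
     equals_near_boundary \<A> \<kappa> A (nf_elliptic a1 a2 a3 a4 a5 a6) \<or>
     equals_near_boundary \<A> \<kappa> A (nf_loxodromic a1 a2 a3 a4 a5 a6) \<or>
     equals_near_boundary \<A> \<kappa> A (nf_parabolic1 a1 a2 a3 a4 a5 a6) \<or>
     equals_near_boundary \<A> \<kappa> A (nf_parabolic2 a1 a2 a3 a4 a5 a6))"

section \<open>Integration and the Chern-Simons invariant\<close>

definition partition_of_unity ::
  "'a topology \<Rightarrow> 'a chart set \<Rightarrow> ('a chart \<Rightarrow> 'a \<Rightarrow> real) \<Rightarrow> bool" where
  "partition_of_unity X \<A> \<rho> \<longleftrightarrow>
     finite {c\<in>\<A>. \<exists>p\<in>topspace X. \<rho> c p \<noteq> 0} \<and>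
     (\<forall>c\<in>\<A>. (\<forall>p\<in>topspace X. 0 \<le> \<rho> c p) \<and>
        X closure_of {p\<in>topspace X. \<rho> c p \<noteq> 0} \<subseteq> cdom c \<and>
        (\<forall>d\<in>\<A>. smooth_on (cimg d) (\<rho> c \<circ> cinv d))) \<and>
     (\<forall>p\<in>topspace X. (\<Sum>c | c \<in> \<A> \<and> (\<exists>q\<in>topspace X. \<rho> c q \<noteq> 0). \<rho> c p) = 1)"

text \<open>
  The integral of a 3-form over an oriented compact manifold. As usual it is computed with some
  partition of unity subordinate to the oriented atlas, on the choice of which it does not depend.
\<close>

definition form_integral ::
  "'a topology \<Rightarrow> 'a chart set \<Rightarrow>
   ('a chart \<Rightarrow> real^3 \<Rightarrow> real^3 \<Rightarrow> real^3 \<Rightarrow> real^3 \<Rightarrow> complex) \<Rightarrow> complex" where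
  "form_integral X \<A> \<Omega> =
     (let \<rho> = (SOME \<rho>. partition_of_unity X \<A> \<rho>) in
      \<Sum>c | c \<in> \<A> \<and> (\<exists>p\<in>topspace X. \<rho> c p \<noteq> 0).
        integral (cimg c) (\<lambda>z. \<rho> c (cinv c z) *\<^sub>R \<Omega> c z (axis 1 1) (axis 2 1) (axis 3 1)))"

definition cs_form ::
  "'a mform1 \<Rightarrow> 'a chart \<Rightarrow> real^3 \<Rightarrow> real^3 \<Rightarrow> real^3 \<Rightarrow> real^3 \<Rightarrow> complex" where
  "cs_form A c z u v w = of_real (1 / (8 * pi\<^sup>2)) *
     trace (wedge12 (A c z) (ext_d (cimg c) (A c) z) u v w +
            (2/3) *\<^sub>R wedge12 (A c z) (wedge11 (A c z) (A c z)) u v w)"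

text \<open>A representative of the Chern-Simons invariant, which is the class of this number mod \<open>\<int>\<close>.\<close>

definition cs :: "'a topology \<Rightarrow> 'a chart set \<Rightarrow> 'a mform1 \<Rightarrow> complex" where
  "cs X \<A> A = form_integral X \<A> (cs_form A)"

definition cong_mod_Z :: "complex \<Rightarrow> real \<Rightarrow> bool" where
  "cong_mod_Z a b \<longleftrightarrow> a - of_real b \<in> \<int>"

definition dot :: "(real \<Rightarrow> real) \<Rightarrow> real \<Rightarrow> real" where
  "dot f t = vector_derivative f (at t within {0..1})"

end

theory Submission
  imports Defs
begin

text \<open>
  For flat connections the Chern-Simons form is a multiple of \<open>tr (A \<and> A \<and> A)\<close>, and for two flat
  connections \<open>a\<close>, \<open>b\<close> one has exactly
  \<open>tr (b^3) - tr (a^3) = 3 d tr (a \<and> b) + tr ((b - a)^3)\<close>.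
  For \<open>a = A s\<close> and \<open>b = A t\<close> the last term is cubic in \<open>t - s\<close>, so by Stokes' theorem the
  derivative of \<open>cs (A t)\<close> is read off from the boundary term \<open>tr (a \<and> b)\<close>, which is constant in the
  collar coordinates; no derivative in \<open>t\<close> under the integral is needed. The congruence
  holds as an equality of numbers.

  In Stokes' theorem boundary integrals are avoided with a cutoff \<open>\<chi>\<close> that depends only on the collar
  coordinate \<open>r\<close> and equals 1 near the boundary: \<open>(1 - \<chi>) tr (a \<and> b)\<close> contributes 0, and
  \<open>d \<chi> \<and> tr (a \<and> b)\<close> is integrated over the collar by a change of variables.
\<close>

text \<open>The identity comes from d tr (a \<and> b) = tr (da \<and> b) - tr (a \<and> db), which
  for flat forms is tr (a \<and> b^2) - tr (a^2 \<and> b): up to the factor -3, the mixed terms of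
  tr ((b - a)^3). The boundary term tr (A s \<and> A t) vanishes at t = s, and its t-derivative
  there yields the integrand of the theorem; the constants come from (2 \<pi> i)^2 = -4 \<pi>^2 and
  the flat Chern-Simons form -1/(24 \<pi>^2) tr (A^3). The main obstacle is that a global integral
  is a sum of chart integrals over one chosen partition of unity. Integration by parts in each chart
  c leaves a term with d\<rho>_c, and these terms cancel only after all of them are expressed in the
  same charts; hence the transfer of integrals between charts. The second obstacle is regularity:
  the differential of the cutoff is only shown to be bounded, so integrals of derivatives are proved
  to vanish for bounded, not necessarily continuous, derivatives. Differentiability of the boundary
  parameters is no assumption either; it is read off from the smooth path.\<close>

section \<open>Calculus of \<open>Ck_on\<close>\<close>

text \<open>The condition under which a derivative within \<open>S\<close> is unique:
  \<open>S\<close> accumulates at each of its points along every coordinate axis. One sign of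
  \<open>d\<close> is enough, so boundary points of the half space qualify and
  \<open>frechet_derivative\<close> within \<open>S\<close> can be computed there.\<close>

definition axis_dense :: "'a::euclidean_space set \<Rightarrow> bool" where
  "axis_dense S \<longleftrightarrow>
     (\<forall>x\<in>S. \<forall>i\<in>Basis. \<forall>e>0. \<exists>d. 0 < \<bar>d\<bar> \<and> \<bar>d\<bar> < e \<and> x + d *\<^sub>R i \<in> S)"

lemma axis_dense_Int_open:
  assumes "axis_dense S" "open U"
  shows "axis_dense (S \<inter> U)"
  unfolding axis_dense_def
proof (intro ballI allI impI)
  fix x i :: 'a and e :: real
  assume x: "x \<in> S \<inter> U" and i: "i \<in> Basis" and e: "e > 0"
  obtain r where r: "r > 0" "ball x r \<subseteq> U"
    using x assms(2) open_contains_ball by blast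
  obtain d where "0 < \<bar>d\<bar>" "\<bar>d\<bar> < min e r" "x + d *\<^sub>R i \<in> S"
    using assms(1) x i e r unfolding axis_dense_def by (metis IntD1 min_less_iff_conj)
  moreover from this have "x + d *\<^sub>R i \<in> ball x r"
    using i by (simp add: dist_norm)
  ultimately show "\<exists>d. 0 < \<bar>d\<bar> \<and> \<bar>d\<bar> < e \<and> x + d *\<^sub>R i \<in> S \<inter> U"
    using r by auto
qed

lemma axis_dense_openin:
  assumes "axis_dense T" "openin (top_of_set T) S"
  shows "axis_dense S"
  using assms(2) axis_dense_Int_open[OF assms(1)] by (auto simp: openin_open)

lemma axis_dense_UNIV: "axis_dense UNIV"
  unfolding axis_dense_def
proof (intro ballI allI impI)
  fix x i :: 'a and e :: real assume "e > 0"
  then show "\<exists>d. 0 < \<bar>d\<bar> \<and> \<bar>d\<bar> < e \<and> x + d *\<^sub>R i \<in> UNIV"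
    by (intro exI[of _ "e/2"]) simp
qed

lemma axis_dense_halfspace: "axis_dense halfspace"
  unfolding axis_dense_def halfspace_def
proof (intro ballI allI impI)
  fix x i :: "real^3" and e :: real
  assume x: "x \<in> {z. z $ 3 \<le> 0}" and i: "i \<in> Basis" and e: "e > 0"
  from i have "0 \<le> i $ 3"
    by (auto simp: Basis_vec_def axis_def)
  with x e show "\<exists>d. 0 < \<bar>d\<bar> \<and> \<bar>d\<bar> < e \<and> x + d *\<^sub>R i \<in> {z. z $ 3 \<le> 0}"
    by (intro exI[of _ "-(e/2)"]) (auto simp: mult_nonneg_nonneg intro: order_trans[of _ "0::real"])
qed

lemma axis_dense_openin_halfspace:
  "openin (top_of_set halfspace) S \<Longrightarrow> axis_dense S"
  using axis_dense_openin axis_dense_halfspace by blast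

lemma frechet_derivative_within_eq:
  assumes "axis_dense S" "x \<in> S" "(f has_derivative f') (at x within S)"
  shows "frechet_derivative f (at x within S) = f'"
proof -
  have "(f has_derivative frechet_derivative f (at x within S)) (at x within S)"
    using assms(3) frechet_derivative_works differentiable_def by blast
  then show ?thesis
    using frechet_derivative_unique_within[OF _ assms(3)] assms(1,2)
    unfolding axis_dense_def by blast
qed

text \<open>\<open>frechet_derivative\<close> is a choice from the set of derivatives. That set
  depends on the values on \<open>S\<close> only, so the choices agree whether or not derivatives
  exist or are unique.\<close>

lemma frechet_derivative_within_cong:
  assumes "\<And>x. x \<in> S \<Longrightarrow> f x = g x" "x \<in> S"
  shows "frechet_derivative f (at x within S) = frechet_derivative g (at x within S)"
proof -
  have "(f has_derivative f') (at x within S) \<longleftrightarrow> (g has_derivative f') (at x within S)" for f'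
    using has_derivative_transform[OF assms(2), of f g f'] has_derivative_transform[OF assms(2), of g f f'] assms(1)
    by auto
  then show ?thesis unfolding frechet_derivative_def by simp
qed

lemma Ck_on_cong:
  assumes "\<And>x. x \<in> S \<Longrightarrow> f x = g x"
  shows "Ck_on k S f \<longleftrightarrow> Ck_on k S g"
proof -
  have "Ck_on k S g" if "Ck_on k S f" "\<And>x. x \<in> S \<Longrightarrow> f x = g x" for f g :: "'a \<Rightarrow> 'b"
    using that
  proof (induction k arbitrary: f g)
    case 0
    then show ?case using continuous_on_eq by (metis Ck_on.simps(1))
  next
    case (Suc k)
    have "g differentiable_on S"
      unfolding differentiable_on_def
    proof
      fix x assume x: "x \<in> S"
      with Suc.prems(1) have "f differentiable (at x within S)"
        by (simp add: differentiable_on_def)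
      then show "g differentiable (at x within S)"
        using x Suc.prems(2) by (rule differentiable_transform_within[OF _ zero_less_one]) auto
    qed
    moreover have "Ck_on k S (\<lambda>x. frechet_derivative g (at x within S) v)" for v
    proof (rule Suc.IH)
      show "Ck_on k S (\<lambda>x. frechet_derivative f (at x within S) v)"
        using Suc.prems(1) by simp
      show "frechet_derivative f (at x within S) v = frechet_derivative g (at x within S) v"
        if "x \<in> S" for x
        by (rule arg_cong[where f = "\<lambda>F. F v"], rule frechet_derivative_within_cong)
           (use Suc.prems that in auto)
    qed
    ultimately show ?case by simp
  qed
  from this[of f g] this[of g f] show ?thesis using assms by auto
qed

text \<open>\<open>Ck_on\<close> tests the derivative picked by \<open>frechet_derivative\<close>;
  density identifies it with the derivative \<open>f'\<close> at hand. Most closure properties below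
  go through this rule.\<close>

lemma Ck_on_SucI:
  fixes f :: "'a::euclidean_space \<Rightarrow> 'b::real_normed_vector"
  assumes "axis_dense S" "\<And>x. x \<in> S \<Longrightarrow> (f has_derivative f' x) (at x within S)"
    "\<And>v. Ck_on k S (\<lambda>x. f' x v)"
  shows "Ck_on (Suc k) S f"
proof -
  have "Ck_on k S (\<lambda>x. frechet_derivative f (at x within S) v)" for v
    using assms(3)[of v] by (subst Ck_on_cong[where g = "\<lambda>x. f' x v"])
      (simp_all add: frechet_derivative_within_eq[OF assms(1) _ assms(2)])
  then show ?thesis using assms(2) by (auto simp: differentiable_on_def differentiable_def)
qed

lemma Ck_on_SucD:
  assumes "Ck_on (Suc k) S f" "x \<in> S"
  shows "(f has_derivative frechet_derivative f (at x within S)) (at x within S)"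
  using assms by (simp add: differentiable_on_def frechet_derivative_works)

lemma Ck_on_Suc_imp: "Ck_on (Suc k) S f \<Longrightarrow> Ck_on k S f"
proof (induction k arbitrary: f)
  case 0
  then show ?case by (simp add: differentiable_imp_continuous_on)
qed (metis Ck_on.simps(2))

lemma Ck_on_imp_continuous_on: "Ck_on k S f \<Longrightarrow> continuous_on S f"
  by (cases k) (auto simp: differentiable_imp_continuous_on)

lemma Ck_on_const: "axis_dense S \<Longrightarrow> Ck_on k S (\<lambda>x::'a::euclidean_space. c)"
proof (induction k arbitrary: c)
  case (Suc k)
  then show ?case by (intro Ck_on_SucI[where f' = "\<lambda>x v. 0"]) auto
qed simp

lemma Ck_on_bounded_linear:
  fixes f :: "'a::euclidean_space \<Rightarrow> 'b::real_normed_vector"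
  assumes "bounded_linear L" "axis_dense S" "Ck_on k S f"
  shows "Ck_on k S (\<lambda>x. L (f x))"
  using assms(3)
proof (induction k arbitrary: f)
  case 0
  then show ?case
    using bounded_linear.continuous_on[OF assms(1)] by simp
next
  case (Suc k)
  show ?case
    by (rule Ck_on_SucI[where f' = "\<lambda>x v. L (frechet_derivative f (at x within S) v)"])
       (use assms Suc in \<open>auto intro: bounded_linear.has_derivative[OF assms(1) Ck_on_SucD[OF Suc.prems]]\<close>)
qed

lemma Ck_on_ident: "axis_dense S \<Longrightarrow> Ck_on k S (\<lambda>x::'a::euclidean_space. x)"
  by (cases k) (auto simp del: Ck_on.simps(2) intro: Ck_on_SucI[where f' = "\<lambda>x v. v"] Ck_on_const)

lemma Ck_on_add:
  fixes f g :: "'a::euclidean_space \<Rightarrow> 'b::real_normed_vector"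
  assumes "axis_dense S" "Ck_on k S f" "Ck_on k S g"
  shows "Ck_on k S (\<lambda>x. f x + g x)"
  using assms(2,3)
proof (induction k arbitrary: f g)
  case (Suc k)
  show ?case
    by (rule Ck_on_SucI[where f' = "\<lambda>x v. frechet_derivative f (at x within S) v +
          frechet_derivative g (at x within S) v"])
       (use assms Suc in \<open>auto intro: has_derivative_add Ck_on_SucD[OF Suc.prems(1)] Ck_on_SucD[OF Suc.prems(2)]\<close>)
qed (simp add: continuous_on_add)

lemma Ck_on_sum:
  fixes f :: "'i \<Rightarrow> 'a::euclidean_space \<Rightarrow> 'b::real_normed_vector"
  assumes "axis_dense S" "\<And>i. i \<in> I \<Longrightarrow> Ck_on k S (f i)"
  shows "Ck_on k S (\<lambda>x. \<Sum>i\<in>I. f i x)"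
  using assms(2)
proof (induction I rule: infinite_finite_induct)
  case (insert i I)
  then show ?case by (simp add: Ck_on_add assms(1))
qed (simp_all add: Ck_on_const assms(1))

lemma Ck_on_bounded_bilinear:
  fixes f :: "'a::euclidean_space \<Rightarrow> 'b::real_normed_vector"
    and g :: "'a \<Rightarrow> 'c::real_normed_vector"
  assumes "bounded_bilinear B" "axis_dense S" "Ck_on k S f" "Ck_on k S g"
  shows "Ck_on k S (\<lambda>x. B (f x) (g x))"
  using assms(3,4)
proof (induction k arbitrary: f g)
  case 0
  then show ?case using bounded_bilinear.continuous_on[OF assms(1)] by simp
next
  case (Suc k)
  show ?case
  proof (rule Ck_on_SucI[where f' = "\<lambda>x v. B (f x) (frechet_derivative g (at x within S) v) +
          B (frechet_derivative f (at x within S) v) (g x)"])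
    show "Ck_on k S (\<lambda>x. B (f x) (frechet_derivative g (at x within S) v) +
          B (frechet_derivative f (at x within S) v) (g x))" for v
      using Suc.prems Ck_on_Suc_imp[OF Suc.prems(1)] Ck_on_Suc_imp[OF Suc.prems(2)]
      by (intro Ck_on_add assms Suc.IH) auto
  next
    fix x assume "x \<in> S"
    then show "((\<lambda>x. B (f x) (g x)) has_derivative
        (\<lambda>v. B (f x) (frechet_derivative g (at x within S) v) +
          B (frechet_derivative f (at x within S) v) (g x))) (at x within S)"
      by (intro bounded_bilinear.FDERIV[OF assms(1)] Ck_on_SucD[OF Suc.prems(1)]
          Ck_on_SucD[OF Suc.prems(2)])
  qed (rule assms)
qed

lemmas Ck_on_scaleR = Ck_on_bounded_bilinear[OF bounded_bilinear_scaleR]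
lemmas Ck_on_mult = Ck_on_bounded_bilinear[OF bounded_bilinear_mult]

lemma Ck_on_inverse:
  fixes f :: "'a::euclidean_space \<Rightarrow> real"
  assumes "axis_dense S" "Ck_on k S f" "\<And>x. x \<in> S \<Longrightarrow> f x \<noteq> 0"
  shows "Ck_on k S (\<lambda>x. inverse (f x))"
  using assms(2)
proof (induction k)
  case 0
  then show ?case using assms(3) by (simp add: continuous_on_inverse)
next
  case (Suc k)
  have IH: "Ck_on k S (\<lambda>x. inverse (f x))"
    using Suc.IH Ck_on_Suc_imp[OF Suc.prems] by blast
  show ?case
  \<comment> \<open>The derivative is a product of \<open>inverse f\<close>, \<open>f'\<close> and
    constants, so the induction on \<open>k\<close> closes.\<close>
  proof (rule Ck_on_SucI[where f' = "\<lambda>x v. (-1) * (inverse (f x) * (frechet_derivative f (at x within S) v * inverse (f x)))"])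
    show "((\<lambda>x. inverse (f x)) has_derivative
        (\<lambda>v. (-1) * (inverse (f x) * (frechet_derivative f (at x within S) v * inverse (f x))))) (at x within S)"
      if "x \<in> S" for x
      using Deriv.has_derivative_inverse[OF assms(3)[OF that] Ck_on_SucD[OF Suc.prems that]]
      by (simp only: mult.assoc mult_minus1)
    show "Ck_on k S (\<lambda>x. (-1) * (inverse (f x) * (frechet_derivative f (at x within S) v * inverse (f x))))" for v
      using Suc.prems by (intro Ck_on_mult Ck_on_const IH assms(1)) auto
  qed (rule assms)
qed

text \<open>In the chain rule the direction \<open>f' x v\<close> varies with \<open>x\<close>,
  whereas \<open>Ck_on\<close> speaks of derivatives in a fixed direction. Expanding it in the basis
  leaves only \<open>g'\<close> in fixed directions \<open>b\<close> composed with \<open>f\<close>,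
  to which the induction hypothesis applies because it is general in \<open>g\<close>.\<close>

lemma Ck_on_compose:
  fixes f :: "'a::euclidean_space \<Rightarrow> 'b::euclidean_space" and g :: "'b \<Rightarrow> 'c::real_normed_vector"
  assumes S: "axis_dense S" and f: "Ck_on k S f" and g: "Ck_on k T g" and ST: "f ` S \<subseteq> T"
  shows "Ck_on k S (\<lambda>x. g (f x))"
  using f g
proof (induction k arbitrary: g)
  case 0
  then show ?case using ST by (auto intro: continuous_on_compose2)
next
  case (Suc k)
  have k: "Ck_on k S f" using Suc.prems(1) Ck_on_Suc_imp by blast
  let ?f' = "\<lambda>x. frechet_derivative f (at x within S)"
  let ?g' = "\<lambda>y. frechet_derivative g (at y within T)"
  show ?case
  proof (rule Ck_on_SucI[where f' = "\<lambda>x v. \<Sum>b\<in>Basis. (?f' x v \<bullet> b) *\<^sub>R ?g' (f x) b", OF S])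
    fix x assume x: "x \<in> S"
    have g: "(g has_derivative ?g' (f x)) (at (f x) within f ` S)"
      using Ck_on_SucD[OF Suc.prems(2)] x ST has_derivative_subset by blast
    have "((\<lambda>x. g (f x)) has_derivative (\<lambda>v. ?g' (f x) (?f' x v))) (at x within S)"
      using has_derivative_in_compose[OF Ck_on_SucD[OF Suc.prems(1) x] g] .
    moreover have "(\<lambda>v. ?g' (f x) (?f' x v)) = (\<lambda>v. \<Sum>b\<in>Basis. (?f' x v \<bullet> b) *\<^sub>R ?g' (f x) b)"
    proof
      fix v
      have "linear (?g' (f x))"
        using g has_derivative_linear by blast
      then have "?g' (f x) (\<Sum>b\<in>Basis. (?f' x v \<bullet> b) *\<^sub>R b) = (\<Sum>b\<in>Basis. (?f' x v \<bullet> b) *\<^sub>R ?g' (f x) b)"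
        by (simp add: linear_sum linear_scale)
      then show "?g' (f x) (?f' x v) = (\<Sum>b\<in>Basis. (?f' x v \<bullet> b) *\<^sub>R ?g' (f x) b)"
        by (simp only: euclidean_representation)
    qed
    ultimately show "((\<lambda>x. g (f x)) has_derivative (\<lambda>v. \<Sum>b\<in>Basis. (?f' x v \<bullet> b) *\<^sub>R ?g' (f x) b)) (at x within S)"
      by (simp only:)
  next
    fix v
    show "Ck_on k S (\<lambda>x. \<Sum>b\<in>Basis. (?f' x v \<bullet> b) *\<^sub>R ?g' (f x) b)"
    proof (intro Ck_on_sum S Ck_on_scaleR)
      fix b :: 'b
      show "Ck_on k S (\<lambda>x. ?f' x v \<bullet> b)"
        using Suc.prems(1) by (intro Ck_on_bounded_linear[OF bounded_linear_inner_left S]) auto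
      show "Ck_on k S (\<lambda>x. ?g' (f x) b)"
        using Suc.prems(2) k by (intro Suc.IH) auto
    qed
  qed
qed

lemma at_within_Int_open: "open U \<Longrightarrow> x \<in> U \<Longrightarrow> at x within S \<inter> U = at x within S"
  by (rule at_within_nhd[of x U]) auto

text \<open>Needed for functions given by different formulas in different regions. At a point of the
  open set \<open>U\<close> the filters within \<open>S\<close> and within
  \<open>S \<inter> U\<close> agree, and so do the derivatives.\<close>

lemma Ck_on_local:
  assumes "\<And>x. x \<in> S \<Longrightarrow> \<exists>U. open U \<and> x \<in> U \<and> Ck_on k (S \<inter> U) f"
  shows "Ck_on k S f"
  using assms
proof (induction k arbitrary: f)
  case 0
  have "\<forall>x\<in>S. continuous (at x within S) f"
  proof
    fix x assume x: "x \<in> S"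
    with 0 obtain U where U: "open U" "x \<in> U" "continuous_on (S \<inter> U) f" by auto
    then show "continuous (at x within S) f"
      using x at_within_Int_open[OF U(1,2), of S] by (metis IntI continuous_on_eq_continuous_within)
  qed
  then show ?case by (simp add: continuous_on_eq_continuous_within)
next
  case (Suc k)
  have "f differentiable_on S"
    unfolding differentiable_on_def
  proof
    fix x assume x: "x \<in> S"
    with Suc.prems obtain U where U: "open U" "x \<in> U" "Ck_on (Suc k) (S \<inter> U) f" by blast
    then show "f differentiable (at x within S)"
      using x unfolding at_within_Int_open[OF U(1,2), of S, symmetric]
      by (simp add: differentiable_on_def)
  qed
  moreover have "Ck_on k S (\<lambda>x. frechet_derivative f (at x within S) v)" for v
  proof (rule Suc.IH)
    fix x assume x: "x \<in> S"
    with Suc.prems obtain U where U: "open U" "x \<in> U" "Ck_on (Suc k) (S \<inter> U) f" by blast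
    have "Ck_on k (S \<inter> U) (\<lambda>x. frechet_derivative f (at x within S) v)"
      using U(3) by (subst Ck_on_cong[where g = "\<lambda>x. frechet_derivative f (at x within S \<inter> U) v"])
         (auto simp: at_within_Int_open[OF U(1)])
    with U show "\<exists>U. open U \<and> x \<in> U \<and> Ck_on k (S \<inter> U) (\<lambda>x. frechet_derivative f (at x within S) v)"
      by blast
  qed
  ultimately show ?case by simp
qed

subsection \<open>A smooth bump function\<close>

text \<open>The functions t^(-n) exp (-1/t) form a family closed under differentiation up to linear
  combinations: the derivative involves the members n + 1 and n + 2. Smoothness thus follows by one
  induction for all n at once.\<close>

definition bump_aux :: "nat \<Rightarrow> real \<Rightarrow> real" where
  "bump_aux n t = (if t \<le> 0 then 0 else inverse t ^ n * exp (- inverse t))"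

lemma bump_aux_nonneg: "0 \<le> bump_aux n t"
  by (simp add: bump_aux_def)

lemma power_times_exp_minus_tendsto_0: "((\<lambda>u::real. u ^ n * exp (- u)) \<longlongrightarrow> 0) at_top"
  using tendsto_power_div_exp_0[of n] by (simp add: exp_minus divide_inverse)

lemma bump_aux_tendsto_0: "(bump_aux n \<longlongrightarrow> 0) (at 0)"
  unfolding at_eq_sup_left_right
proof (rule filterlim_sup)
  show "(bump_aux n \<longlongrightarrow> 0) (at_left 0)"
    by (rule Lim_transform_eventually[OF tendsto_const[of 0]])
       (auto simp: bump_aux_def eventually_at_left_field intro: exI[of _ "-1"])
  have "((\<lambda>t. inverse t ^ n * exp (- inverse t)) \<longlongrightarrow> (0::real)) (at_right 0)"
    by (rule filterlim_compose[OF power_times_exp_minus_tendsto_0 filterlim_inverse_at_top_right])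
  then show "(bump_aux n \<longlongrightarrow> 0) (at_right 0)"
    by (rule Lim_transform_eventually)
       (auto simp: bump_aux_def eventually_at_right_field intro: exI[of _ "1"])
qed

lemma bump_aux_has_field_derivative:
  "(bump_aux n has_field_derivative bump_aux (n + 2) t - real n * bump_aux (n + 1) t) (at t)"
proof (cases "t = 0")
  case True
  \<comment> \<open>Dividing by \<open>h\<close> raises the exponent \<open>n\<close> by one, so the
    difference quotient at 0 is itself a member of the family.\<close>
  have "((\<lambda>h. bump_aux n h / h) \<longlongrightarrow> 0) (at 0)"
  proof (rule Lim_transform_eventually[OF bump_aux_tendsto_0[of "Suc n"]])
    show "\<forall>\<^sub>F h in at 0. bump_aux (Suc n) h = bump_aux n h / h"
      by (rule always_eventually) (auto simp: bump_aux_def divide_inverse)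
  qed
  then show ?thesis using True by (simp add: DERIV_def bump_aux_def)
next
  case False
  show ?thesis
  proof (cases "t < 0")
    case True
    have "(bump_aux n has_field_derivative 0) (at t)"
      by (rule DERIV_cong_ev[THEN iffD1, OF refl _ refl, where f1 = "\<lambda>_. 0"])
         (use True eventually_nhds_in_open[of "{..<0}" t] in \<open>auto simp: bump_aux_def elim!: eventually_mono\<close>)
    with True show ?thesis by (simp add: bump_aux_def)
  next
    case False
    with \<open>t \<noteq> 0\<close> have t: "t > 0" by simp
    have "((\<lambda>t. inverse t ^ n * exp (- inverse t)) has_field_derivative
        bump_aux (n + 2) t - real n * bump_aux (n + 1) t) (at t)"
      using t by (auto intro!: derivative_eq_intros simp: bump_aux_def divide_simps)
        (cases n; simp add: field_simps power2_eq_square)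
    then show ?thesis
      by (rule DERIV_cong_ev[THEN iffD1, OF refl _ refl, rotated])
         (use t eventually_nhds_in_open[of "{0<..}" t] in \<open>auto simp: bump_aux_def elim!: eventually_mono\<close>)
  qed
qed

lemma Ck_on_bump_aux: "Ck_on k UNIV (bump_aux n)"
proof (induction k arbitrary: n)
  case 0
  then show ?case
    using DERIV_isCont[OF bump_aux_has_field_derivative] by (simp add: continuous_at_imp_continuous_on)
next
  case (Suc k)
  show ?case
  proof (rule Ck_on_SucI[OF axis_dense_UNIV])
    show "(bump_aux n has_derivative (\<lambda>v. (bump_aux (n + 2) t + (- real n) * bump_aux (n + 1) t) * v)) (at t)" for t
      using bump_aux_has_field_derivative[of n t] by (simp add: has_field_derivative_def)
    show "Ck_on k UNIV (\<lambda>t. (bump_aux (n + 2) t + (- real n) * bump_aux (n + 1) t) * v)" for v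
      by (intro Ck_on_mult Ck_on_add Ck_on_const Suc axis_dense_UNIV)
  qed
qed

section \<open>Charts and smooth partitions of unity\<close>

locale atlas =
  fixes X :: "'a topology" and \<A> :: "'a chart set"
  assumes manifold: "oriented_compact_3manifold X \<A>"
begin

lemma compact_space: "compact_space X"
  and Hausdorff: "Hausdorff_space X"
  and is_chart: "c \<in> \<A> \<Longrightarrow> is_chart X c"
  and cdom_cover: "(\<Union>c\<in>\<A>. cdom c) = topspace X"
  and smooth_transition: "c \<in> \<A> \<Longrightarrow> d \<in> \<A> \<Longrightarrow> smooth_on (overlap c d) (transition c d)"
  and det_transition: "c \<in> \<A> \<Longrightarrow> d \<in> \<A> \<Longrightarrow> z \<in> overlap c d \<Longrightarrow> 0 < det (matrix (D_transition c d z))"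
  using manifold unfolding oriented_compact_3manifold_def by blast+

lemma cdom_open: "c \<in> \<A> \<Longrightarrow> openin X (cdom c)"
  and cimg_open: "c \<in> \<A> \<Longrightarrow> openin (top_of_set halfspace) (cimg c)"
  and cmap_homeo: "c \<in> \<A> \<Longrightarrow> homeomorphic_map (subtopology X (cdom c)) (top_of_set (cimg c)) (cmap c)"
  using is_chart unfolding is_chart_def by blast+

lemma cdom_subset: "c \<in> \<A> \<Longrightarrow> cdom c \<subseteq> topspace X"
  using cdom_open openin_subset by blast

lemma cimg_subset: "c \<in> \<A> \<Longrightarrow> cimg c \<subseteq> halfspace"
  using cimg_open openin_imp_subset by blast

lemma topspace_cdom: "c \<in> \<A> \<Longrightarrow> topspace (subtopology X (cdom c)) = cdom c"
  by (simp add: cdom_subset Int_absorb1)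

lemma inj_cmap: "c \<in> \<A> \<Longrightarrow> inj_on (cmap c) (cdom c)"
  using cmap_homeo[of c] topspace_cdom[of c] homeomorphic_imp_injective_map by metis

lemma cinv_cmap: "c \<in> \<A> \<Longrightarrow> p \<in> cdom c \<Longrightarrow> cinv c (cmap c p) = p"
  unfolding cinv_def using inj_cmap by (simp add: inv_into_f_f)

lemma cmap_cinv: "z \<in> cimg c \<Longrightarrow> cmap c (cinv c z) = z"
  unfolding cinv_def by (simp add: f_inv_into_f)

lemma cinv_in: "z \<in> cimg c \<Longrightarrow> cinv c z \<in> cdom c"
  unfolding cinv_def by (rule inv_into_into)

lemma cmap_continuous: "c \<in> \<A> \<Longrightarrow> continuous_map (subtopology X (cdom c)) (top_of_set (cimg c)) (cmap c)"
  using cmap_homeo homeomorphic_imp_continuous_map by blast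

lemma cinv_continuous:
  assumes c: "c \<in> \<A>"
  shows "continuous_map (top_of_set (cimg c)) (subtopology X (cdom c)) (cinv c)"
proof -
  obtain g where g: "homeomorphic_maps (subtopology X (cdom c)) (top_of_set (cimg c)) (cmap c) g"
    using cmap_homeo[OF c] homeomorphic_map_maps by blast
  have "g z = cinv c z" if "z \<in> topspace (top_of_set (cimg c))" for z
  proof -
    from that obtain p where p: "p \<in> cdom c" "z = cmap c p" by auto
    with g have "g z = p"
      using topspace_cdom[OF c] by (auto simp: homeomorphic_maps_def)
    with p show ?thesis using cinv_cmap[OF c] by simp
  qed
  moreover have "continuous_map (top_of_set (cimg c)) (subtopology X (cdom c)) g"
    using g by (simp add: homeomorphic_maps_def)
  ultimately show ?thesis by (rule continuous_map_eq[rotated])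
qed

lemma open_cmap_image:
  assumes c: "c \<in> \<A>" and U: "openin X U"
  shows "openin (top_of_set halfspace) (cmap c ` (cdom c \<inter> U))"
proof -
  have "openin (subtopology X (cdom c)) (cdom c \<inter> U)"
    using U by (simp add: openin_subtopology_Int2)
  then have "openin (top_of_set (cimg c)) (cmap c ` (cdom c \<inter> U))"
    using cmap_homeo[OF c] homeomorphic_imp_open_map open_map_def by blast
  then show ?thesis using cimg_open[OF c] openin_trans by blast
qed

lemma overlap_open: "c \<in> \<A> \<Longrightarrow> d \<in> \<A> \<Longrightarrow> openin (top_of_set halfspace) (overlap c d)"
  unfolding overlap_def using open_cmap_image cdom_open by blast

lemma axis_dense_cimg: "c \<in> \<A> \<Longrightarrow> axis_dense (cimg c)"
  using cimg_open axis_dense_openin_halfspace by blast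

lemma axis_dense_overlap: "c \<in> \<A> \<Longrightarrow> d \<in> \<A> \<Longrightarrow> axis_dense (overlap c d)"
  using overlap_open axis_dense_openin_halfspace by blast

lemma compact_cmap_image:
  assumes c: "c \<in> \<A>" and K: "closedin X K" "K \<subseteq> cdom c"
  shows "compact (cmap c ` K)"
proof -
  have "compactin X K" using compact_space K closedin_compact_space by blast
  then have "compactin (subtopology X (cdom c)) K" using K by (simp add: compactin_subtopology)
  from image_compactin[OF this cmap_continuous[OF c]]
  show ?thesis by (auto simp: compactin_subtopology)
qed

lemma open_cinv_image:
  assumes c: "c \<in> \<A>" and W: "openin (top_of_set halfspace) W" "W \<subseteq> cimg c"
  shows "openin X (cinv c ` W)"
proof -
  have "openin (top_of_set (cimg c)) W"
    using W cimg_open[OF c] by (metis openin_subset_trans cimg_subset[OF c])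
  from openin_continuous_map_preimage[OF cmap_continuous[OF c] this]
  have "openin (subtopology X (cdom c)) {p \<in> cdom c. cmap c p \<in> W}"
    unfolding topspace_cdom[OF c] .
  moreover have "{p \<in> cdom c. cmap c p \<in> W} = cinv c ` W"
    using W(2) by (auto simp: cmap_cinv cinv_in subset_iff image_iff) (metis c cinv_cmap)
  ultimately show ?thesis
    using openin_trans_full[OF _ cdom_open[OF c]] by simp
qed

lemma closed_cinv_image:
  assumes c: "c \<in> \<A>" and K: "compact K" "K \<subseteq> cimg c"
  shows "closedin X (cinv c ` K)"
proof -
  have "compactin (top_of_set (cimg c)) K" using K by (simp add: compactin_subtopology)
  from image_compactin[OF this cinv_continuous[OF c]]
  have "compactin X (cinv c ` K)" by (simp add: compactin_subtopology)
  then show ?thesis using Hausdorff compactin_imp_closedin by blast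
qed

lemma transition_in: "c \<in> \<A> \<Longrightarrow> d \<in> \<A> \<Longrightarrow> z \<in> overlap c d \<Longrightarrow> transition c d z \<in> overlap d c"
  unfolding overlap_def transition_def by (auto simp: cinv_cmap)

lemma cinv_transition:
  "c \<in> \<A> \<Longrightarrow> d \<in> \<A> \<Longrightarrow> z \<in> overlap c d \<Longrightarrow> cinv d (transition c d z) = cinv c z"
  unfolding overlap_def transition_def by (auto simp: cinv_cmap)

lemma overlap_subset: "overlap c d \<subseteq> cimg c"
  unfolding overlap_def by auto

lemma overlap_iff:
  assumes "c \<in> \<A>"
  shows "z \<in> overlap c d \<longleftrightarrow> z \<in> cimg c \<and> cinv c z \<in> cdom d"
  unfolding overlap_def using assms by (auto simp: cinv_cmap cmap_cinv cinv_in intro!: rev_image_eqI)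

text \<open>A function of r^2 - |z - z0|^2 in a chart around \<open>p\<close>, extended by 0. Its
  support lies in the image \<open>K\<close> of a compact set, which is closed because
  \<open>X\<close> is Hausdorff. In another chart each point lies either in \<open>cdom c\<close>,
  where the function is a composite with a transition map, or off \<open>K\<close>, where it
  vanishes locally; these two open sets cover since \<open>K \<subseteq> cdom c\<close>.\<close>

lemma exists_bump:
  assumes p: "p \<in> topspace X"
  shows "\<exists>c\<in>\<A>. \<exists>b::'a \<Rightarrow> real. 0 < b p \<and> (\<forall>q\<in>topspace X. 0 \<le> b q) \<and>
    openin X {q \<in> topspace X. 0 < b q} \<and>
    X closure_of {q \<in> topspace X. b q \<noteq> 0} \<subseteq> cdom c \<and>
    (\<forall>d\<in>\<A>. smooth_on (cimg d) (b \<circ> cinv d))"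
proof -
  obtain c where c: "c \<in> \<A>" and pc: "p \<in> cdom c" using p cdom_cover by blast
  define z0 where "z0 = cmap c p"
  have z0: "z0 \<in> cimg c" using pc by (simp add: z0_def)
  obtain r where r: "r > 0" and rc: "cball z0 r \<inter> halfspace \<subseteq> cimg c"
    using cimg_open[OF c] z0 unfolding openin_contains_cball by blast
  define f where "f z = bump_aux 0 (r\<^sup>2 - (z - z0) \<bullet> (z - z0))" for z
  have f_pos: "0 < f z \<longleftrightarrow> z \<in> ball z0 r" for z
  proof -
    have "0 < f z \<longleftrightarrow> (norm (z - z0))\<^sup>2 < r\<^sup>2"
      by (simp add: f_def bump_aux_def power2_norm_eq_inner)
    also have "\<dots> \<longleftrightarrow> norm (z - z0) < r"
      using r by (metis norm_ge_zero less_imp_le power_strict_mono power_less_imp_less_base zero_less_numeral)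
    finally show ?thesis by (simp add: dist_norm norm_minus_commute)
  qed
  have f_ge: "0 \<le> f z" for z by (simp add: f_def bump_aux_nonneg)
  have f_smooth: "Ck_on k UNIV f" for k
  proof -
    have "Ck_on k UNIV (\<lambda>z. z + (- z0))"
      by (intro Ck_on_add Ck_on_ident Ck_on_const axis_dense_UNIV)
    then have "Ck_on k UNIV (\<lambda>z. (z + (- z0)) \<bullet> (z + (- z0)))"
      by (intro Ck_on_bounded_bilinear[OF bounded_bilinear_inner] axis_dense_UNIV)
    then have "Ck_on k UNIV (\<lambda>z. r\<^sup>2 + (-1) * ((z + (- z0)) \<bullet> (z + (- z0))))"
      by (intro Ck_on_add Ck_on_mult Ck_on_const axis_dense_UNIV)
    from Ck_on_compose[OF axis_dense_UNIV this Ck_on_bump_aux[of k 0]]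
    show ?thesis by (simp add: f_def[abs_def])
  qed
  define b where "b q = (if q \<in> cdom c then f (cmap c q) else 0)" for q
  define K where "K = cinv c ` (cball z0 r \<inter> halfspace)"
  have "compact (cball z0 r \<inter> halfspace)"
    unfolding halfspace_def by (intro compact_Int_closed compact_cball closed_halfspace_component_le_cart)
  then have K_closed: "closedin X K"
    unfolding K_def using closed_cinv_image[OF c _ rc] by blast
  have K_cdom: "K \<subseteq> cdom c"
    unfolding K_def
  proof (rule image_subsetI)
    fix z assume "z \<in> cball z0 r \<inter> halfspace"
    then show "cinv c z \<in> cdom c" using rc by (intro cinv_in) (rule subsetD)
  qed
  have b_pos: "{q \<in> topspace X. 0 < b q} = cinv c ` (ball z0 r \<inter> halfspace)" (is "?L = ?R")
  proof
    show "?L \<subseteq> ?R"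
    proof
      fix q assume "q \<in> ?L"
      then have q: "q \<in> cdom c" "cmap c q \<in> ball z0 r" by (auto simp: b_def f_pos split: if_splits)
      then have "cmap c q \<in> halfspace" using cimg_subset[OF c] by blast
      with q show "q \<in> ?R" by (intro rev_image_eqI[of "cmap c q"]) (auto simp: cinv_cmap[OF c])
    qed
    show "?R \<subseteq> ?L"
    proof
      fix q assume "q \<in> ?R"
      then obtain z where z: "z \<in> ball z0 r" "z \<in> cimg c" "q = cinv c z"
        using rc ball_subset_cball by blast
      then show "q \<in> ?L"
        using cinv_in[of z c] cmap_cinv[of z c] cdom_subset[OF c] f_pos[of z] by (auto simp: b_def)
    qed
  qed
  have nz: "{q \<in> topspace X. b q \<noteq> 0} = {q \<in> topspace X. 0 < b q}"
    using f_ge by (force simp: b_def order_less_le)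
  have nzK: "{q \<in> topspace X. b q \<noteq> 0} \<subseteq> K"
    unfolding nz b_pos K_def using ball_subset_cball by blast
  have "smooth_on (cimg d) (b \<circ> cinv d)" if d: "d \<in> \<A>" for d
    unfolding smooth_on_def
  proof (intro allI Ck_on_local)
    fix k x assume x: "x \<in> cimg d"
    show "\<exists>U. open U \<and> x \<in> U \<and> Ck_on k (cimg d \<inter> U) (b \<circ> cinv d)"
    proof (cases "cinv d x \<in> cdom c")
      case True
      obtain U where U: "open U" "overlap d c = halfspace \<inter> U"
        using overlap_open[OF d c] by (auto simp: openin_open)
      have eq: "cimg d \<inter> U = overlap d c"
        using U(2) cimg_subset[OF d] overlap_subset[of d c] by blast
      have "Ck_on k (overlap d c) (\<lambda>z. f (transition d c z))"
        using Ck_on_compose[OF axis_dense_overlap[OF d c] _ f_smooth subset_UNIV]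
          smooth_transition[OF d c] unfolding smooth_on_def by blast
      then have "Ck_on k (overlap d c) (b \<circ> cinv d)"
        by (subst Ck_on_cong[where g = "\<lambda>z. f (transition d c z)"])
           (simp_all add: b_def transition_def overlap_iff[OF d])
      moreover have "x \<in> U" using True x U overlap_iff[OF d] by blast
      ultimately show ?thesis using U(1) eq by metis
    next
      case False
      obtain U where U: "open U" "cmap d ` (cdom d \<inter> (topspace X - K)) = halfspace \<inter> U"
        using open_cmap_image[OF d, of "topspace X - K"] K_closed by (auto simp: openin_open closedin_def)
      have eq: "cimg d \<inter> U = cmap d ` (cdom d \<inter> (topspace X - K))"
        using U(2) cimg_subset[OF d] by blast
      have "Ck_on k (cimg d \<inter> U) (\<lambda>z. 0::real)"
        by (intro Ck_on_const axis_dense_Int_open axis_dense_cimg d U)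
      moreover have "(b \<circ> cinv d) z = 0" if "z \<in> cimg d \<inter> U" for z
        using that nzK unfolding eq by (auto simp: cinv_cmap[OF d])
      ultimately have "Ck_on k (cimg d \<inter> U) (b \<circ> cinv d)"
        by (subst Ck_on_cong[where g = "\<lambda>z. 0"]) auto
      moreover have "x \<in> U"
      proof -
        have "cinv d x \<in> cdom d \<inter> (topspace X - K)"
          using False K_cdom cinv_in[OF x] cdom_subset[OF d] by blast
        then have "cmap d (cinv d x) \<in> cmap d ` (cdom d \<inter> (topspace X - K))" by blast
        then show ?thesis using cmap_cinv[OF x] U(2) by simp
      qed
      ultimately show ?thesis using U(1) by blast
    qed
  qed
  moreover have "0 < b p" using pc r by (simp add: b_def f_pos flip: z0_def)
  moreover have "\<forall>q\<in>topspace X. 0 \<le> b q" by (simp add: b_def f_ge)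
  moreover have "openin X {q \<in> topspace X. 0 < b q}"
    unfolding b_pos
  proof (rule open_cinv_image[OF c])
    show "openin (top_of_set halfspace) (ball z0 r \<inter> halfspace)"
      by (metis inf_commute open_ball openin_open_Int)
    show "ball z0 r \<inter> halfspace \<subseteq> cimg c" using rc ball_subset_cball by blast
  qed
  moreover have "X closure_of {q \<in> topspace X. b q \<noteq> 0} \<subseteq> cdom c"
    using closure_of_minimal[OF nzK K_closed] K_cdom by blast
  ultimately show ?thesis using c by blast
qed

text \<open>Makes the choice of a partition in \<open>form_integral\<close> meaningful. By
  compactness finitely many bumps have a positive sum everywhere; dividing by that sum normalises
  them.\<close>

lemma exists_partition_of_unity: "\<exists>\<rho>. partition_of_unity X \<A> \<rho>"
proof -
  define P where "P p c b \<longleftrightarrow> c \<in> \<A> \<and> 0 < b p \<and> (\<forall>q\<in>topspace X. 0 \<le> b q) \<and>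
    openin X {q \<in> topspace X. 0 < b q} \<and>
    X closure_of {q \<in> topspace X. b q \<noteq> 0} \<subseteq> cdom c \<and>
    (\<forall>d\<in>\<A>. smooth_on (cimg d) (b \<circ> cinv d))" for p c and b :: "'a \<Rightarrow> real"
  have "\<forall>p\<in>topspace X. \<exists>c b. P p c b"
    using exists_bump unfolding P_def by blast
  then obtain C B where CB: "\<And>p. p \<in> topspace X \<Longrightarrow> P p (C p) (B p)" by metis
  define U where "U p = {q \<in> topspace X. 0 < B p q}" for p
  have "\<exists>F. finite F \<and> F \<subseteq> U ` topspace X \<and> topspace X \<subseteq> \<Union>F"
    using compact_space unfolding compact_space_alt
  proof (elim allE impE)
    show "(\<forall>V\<in>U ` topspace X. openin X V) \<and> topspace X \<subseteq> \<Union> (U ` topspace X)"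
      using CB by (auto simp: P_def U_def)
  qed
  then obtain I where I: "finite I" "I \<subseteq> topspace X" "topspace X \<subseteq> (\<Union>i\<in>I. U i)"
    by (metis finite_subset_image)
  have PI: "P i (C i) (B i)" if "i \<in> I" for i using I that CB by blast
  define S where "S q = (\<Sum>i\<in>I. B i q)" for q
  have S_pos: "0 < S q" if q: "q \<in> topspace X" for q
  proof -
    obtain i where i: "i \<in> I" "0 < B i q" using I(3) q by (auto simp: U_def)
    show ?thesis unfolding S_def
      using I(1) i q PI by (intro sum_pos2[of I i]) (auto simp: P_def)
  qed
  \<comment> \<open>Several bumps may belong to the same chart, so they are collected by
    chart.\<close>
  define \<rho> where "\<rho> c q = (\<Sum>i | i \<in> I \<and> C i = c. B i q) / S q" for c q
  have nz: "{q \<in> topspace X. \<rho> c q \<noteq> 0} \<subseteq> (\<Union>i\<in>{i\<in>I. C i = c}. {q \<in> topspace X. B i q \<noteq> 0})" for c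
  proof
    fix q assume q: "q \<in> {q \<in> topspace X. \<rho> c q \<noteq> 0}"
    then have "(\<Sum>i | i \<in> I \<and> C i = c. B i q) \<noteq> 0" by (auto simp: \<rho>_def)
    then obtain i where "i \<in> I" "C i = c" "B i q \<noteq> 0"
      using sum.not_neutral_contains_not_neutral by blast
    with q show "q \<in> (\<Union>i\<in>{i\<in>I. C i = c}. {q \<in> topspace X. B i q \<noteq> 0})" by blast
  qed
  have fin: "finite {c\<in>\<A>. \<exists>p\<in>topspace X. \<rho> c p \<noteq> 0}"
  proof (rule finite_subset)
    show "{c\<in>\<A>. \<exists>p\<in>topspace X. \<rho> c p \<noteq> 0} \<subseteq> C ` I" using nz by blast
  qed (simp add: I)
  have supp: "X closure_of {q \<in> topspace X. \<rho> c q \<noteq> 0} \<subseteq> cdom c" for c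
  proof -
    have "X closure_of {q \<in> topspace X. \<rho> c q \<noteq> 0} \<subseteq>
        X closure_of (\<Union>i\<in>{i\<in>I. C i = c}. {q \<in> topspace X. B i q \<noteq> 0})"
      using nz by (rule closure_of_mono)
    also have "\<dots> = (\<Union>i\<in>{i\<in>I. C i = c}. X closure_of {q \<in> topspace X. B i q \<noteq> 0})"
      using I(1) by (subst closure_of_Union) auto
    also have "\<dots> \<subseteq> cdom c" using PI by (auto simp: P_def)
    finally show ?thesis .
  qed
  have smooth: "smooth_on (cimg d) (\<rho> c \<circ> cinv d)" if d: "d \<in> \<A>" for c d
    unfolding smooth_on_def
  proof
    fix k
    have B: "Ck_on k (cimg d) (\<lambda>z. B i (cinv d z))" if "i \<in> I" for i
      using PI[OF that] d by (simp add: P_def smooth_on_def comp_def)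
    have "Ck_on k (cimg d) (\<lambda>z. (\<Sum>i | i \<in> I \<and> C i = c. B i (cinv d z)) * inverse (\<Sum>i\<in>I. B i (cinv d z)))"
    proof (intro Ck_on_mult Ck_on_inverse Ck_on_sum axis_dense_cimg d B)
      fix z assume "z \<in> cimg d"
      then show "(\<Sum>i\<in>I. B i (cinv d z)) \<noteq> 0"
        using S_pos[OF subsetD[OF cdom_subset[OF d] cinv_in]] by (simp add: S_def less_imp_neq[symmetric])
    qed auto
    then show "Ck_on k (cimg d) (\<rho> c \<circ> cinv d)"
      by (simp add: \<rho>_def S_def comp_def divide_inverse)
  qed
  have ge: "0 \<le> \<rho> c p" if p: "p \<in> topspace X" for c p
    unfolding \<rho>_def using S_pos[OF p] PI p by (intro divide_nonneg_pos sum_nonneg) (auto simp: P_def)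
  have one: "(\<Sum>c | c \<in> \<A> \<and> (\<exists>q\<in>topspace X. \<rho> c q \<noteq> 0). \<rho> c p) = 1" if p: "p \<in> topspace X" for p
  proof -
    have "(\<Sum>c | c \<in> \<A> \<and> (\<exists>q\<in>topspace X. \<rho> c q \<noteq> 0). \<rho> c p) = (\<Sum>c\<in>C ` I. \<rho> c p)"
    proof (rule sum.mono_neutral_left)
      show "{c \<in> \<A>. \<exists>q\<in>topspace X. \<rho> c q \<noteq> 0} \<subseteq> C ` I" using nz by blast
      show "\<forall>c\<in>C ` I - {c \<in> \<A>. \<exists>q\<in>topspace X. \<rho> c q \<noteq> 0}. \<rho> c p = 0"
        using PI p unfolding P_def by blast
    qed (simp add: I)
    also have "\<dots> = (\<Sum>c\<in>C ` I. \<Sum>i | i \<in> I \<and> C i = c. B i p) / S p"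
      by (simp add: \<rho>_def sum_divide_distrib)
    also have "(\<Sum>c\<in>C ` I. \<Sum>i | i \<in> I \<and> C i = c. B i p) = S p"
      unfolding S_def using sum.image_gen[OF I(1), of "\<lambda>i. B i p" C] by simp
    finally show ?thesis using S_pos[OF p] by simp
  qed
  show ?thesis
    unfolding partition_of_unity_def using fin supp smooth ge one by blast
qed

end

section \<open>Integration lemmas\<close>

lemma vector_derivative_bound:
  fixes f :: "real \<Rightarrow> 'b::real_normed_vector"
  assumes "\<And>t. t \<in> {a..b} \<Longrightarrow> (f has_vector_derivative f' t) (at t within {a..b})"
    and "\<And>t. t \<in> {a..b} \<Longrightarrow> norm (f' t) \<le> B"
    and "s \<in> {a..b}" "t \<in> {a..b}"
  shows "norm (f t - f s) \<le> B * \<bar>t - s\<bar>"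
proof -
  have "norm (f t - f s) \<le> B * norm (t - s)"
  proof (rule differentiable_bound[of "{a..b}" f "\<lambda>t h. h *\<^sub>R f' t" B])
    show "(f has_derivative (\<lambda>h. h *\<^sub>R f' x)) (at x within {a..b})" if "x \<in> {a..b}" for x
      using assms(1)[OF that] by (simp add: has_vector_derivative_def)
    show "onorm (\<lambda>h. h *\<^sub>R f' x) \<le> B" if "x \<in> {a..b}" for x
    proof (rule onorm_le)
      fix h :: real
      show "norm (h *\<^sub>R f' x) \<le> B * norm h"
        using mult_right_mono[OF assms(2)[OF that], of "\<bar>h\<bar>"] by (simp add: mult.commute)
    qed
  qed (use assms in auto)
  then show ?thesis by simp
qed

lemma has_vector_derivative_along_line:
  assumes "(f has_derivative D) (at (x + t *\<^sub>R e))"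
  shows "((\<lambda>t. f (x + t *\<^sub>R e)) has_vector_derivative D e) (at t within T)"
proof -
  have "((\<lambda>t. f (x + t *\<^sub>R e)) has_derivative (\<lambda>u. D (u *\<^sub>R e))) (at t within T)"
    by (rule has_derivative_compose[where f = "\<lambda>t. x + t *\<^sub>R e" and g = f and g' = D])
       (auto intro!: derivative_eq_intros assms)
  then show ?thesis
    using linear_scale[OF has_derivative_linear[OF assms]] by (simp add: has_vector_derivative_def)
qed

lemma absolutely_integrable_compact_support:
  fixes f :: "'a::euclidean_space \<Rightarrow> 'b::euclidean_space"
  assumes "compact K" "K \<subseteq> S" "continuous_on K f" "\<And>x. x \<in> S - K \<Longrightarrow> f x = 0"
  shows "f absolutely_integrable_on S"
proof -
  have "integrable lborel (\<lambda>x. indicator K x *\<^sub>R f x)"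
    using borel_integrable_compact assms by blast
  then have "f absolutely_integrable_on K"
    unfolding set_integrable_def by (simp add: integrable_completion)
  moreover have "{x \<in> K - S. f x \<noteq> 0} = {}" "{x \<in> S - K. f x \<noteq> 0} = {}"
    using assms by auto
  ultimately show ?thesis
    using absolutely_integrable_spike_set_eq[of K S f] by (metis negligible_empty)
qed

text \<open>The change of variables theorem is stated for values in \<open>real^'n\<close>, so
  complex integrands are carried over to \<open>real^2\<close> and back.\<close>

definition complex_to_vec :: "complex \<Rightarrow> real^2" where
  "complex_to_vec z = (\<chi> i. if i = 1 then Re z else Im z)"

definition vec_to_complex :: "real^2 \<Rightarrow> complex" where
  "vec_to_complex v = Complex (v $ 1) (v $ 2)"

lemma complex_to_vec_inverse [simp]: "vec_to_complex (complex_to_vec z) = z"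
  by (simp add: complex_to_vec_def vec_to_complex_def)

lemma bounded_linear_complex_to_vec: "bounded_linear complex_to_vec"
  by (intro linear_conv_bounded_linear[THEN iffD1] linearI)
     (auto simp: complex_to_vec_def vec_eq_iff)

lemma bounded_linear_vec_to_complex: "bounded_linear vec_to_complex"
  by (intro linear_conv_bounded_linear[THEN iffD1] linearI)
     (auto simp: vec_to_complex_def complex_eq_iff)

lemma integral_change_of_variables_complex:
  fixes f :: "real^'m::{finite,wellorder} \<Rightarrow> complex" and g :: "real^'m::_ \<Rightarrow> real^'m::_"
  assumes S: "S \<in> sets lebesgue"
    and der_g: "\<And>x. x \<in> S \<Longrightarrow> (g has_derivative g' x) (at x within S)"
    and inj: "inj_on g S"
    and f: "f absolutely_integrable_on g ` S"
  shows "(\<lambda>x. \<bar>det (matrix (g' x))\<bar> *\<^sub>R f (g x)) absolutely_integrable_on S"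
    and "integral (g ` S) f = integral S (\<lambda>x. \<bar>det (matrix (g' x))\<bar> *\<^sub>R f (g x))"
proof -
  let ?L = complex_to_vec and ?M = vec_to_complex
  let ?h = "\<lambda>x. \<bar>det (matrix (g' x))\<bar> *\<^sub>R (?L \<circ> f) (g x)"
  have "(?L \<circ> f) absolutely_integrable_on g ` S"
    using absolutely_integrable_linear[OF f bounded_linear_complex_to_vec] .
  then have h: "?h absolutely_integrable_on S" "integral S ?h = integral (g ` S) (?L \<circ> f)"
    using has_absolute_integral_change_of_variables[OF S der_g inj, of "?L \<circ> f" "integral (g ` S) (?L \<circ> f)"]
    by auto
  have eq: "?M \<circ> ?h = (\<lambda>x. \<bar>det (matrix (g' x))\<bar> *\<^sub>R f (g x))"
    by (rule ext) (simp add: linear_simps[OF bounded_linear_vec_to_complex])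
  show "(\<lambda>x. \<bar>det (matrix (g' x))\<bar> *\<^sub>R f (g x)) absolutely_integrable_on S"
    using absolutely_integrable_linear[OF h(1) bounded_linear_vec_to_complex] unfolding eq .
  have "?M (integral S ?h) = integral S (?M \<circ> ?h)"
    using integral_linear[OF set_lebesgue_integral_eq_integral(1)[OF h(1)] bounded_linear_vec_to_complex] by simp
  moreover have "?M (integral (g ` S) (?L \<circ> f)) = integral (g ` S) f"
    using integral_linear[OF set_lebesgue_integral_eq_integral(1)[OF f] bounded_linear_complex_to_vec] by simp
  ultimately show "integral (g ` S) f = integral S (\<lambda>x. \<bar>det (matrix (g' x))\<bar> *\<^sub>R f (g x))"
    using h(2) unfolding eq by simp
qed

text \<open>Difference quotients of \<open>f\<close> have integral 0 by translation invariance.\<close>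

lemma integral_directional_derivative:
  fixes f :: "'a::euclidean_space \<Rightarrow> 'b::euclidean_space"
  assumes der: "\<And>x. (f has_derivative f' x) (at x)"
    and bd: "\<And>x. norm (f' x e) \<le> B"
    and K: "bounded K" "\<And>x. x \<notin> K \<Longrightarrow> f x = 0"
  shows "(\<lambda>x. f' x e) absolutely_integrable_on UNIV" "integral UNIV (\<lambda>x. f' x e) = 0"
proof -
  obtain R where R: "R > 0" "\<And>x. x \<in> K \<Longrightarrow> norm x \<le> R"
    using K(1) bounded_pos by metis
  \<comment> \<open>Dominates all difference quotients: the steps have length at most
    \<open>norm e\<close>, so the quotients vanish outside radius \<open>R + norm e\<close>, and the
    mean value inequality bounds them by \<open>B\<close>.\<close>
  define w where "w x = indicator (cball 0 (R + norm e)) x *\<^sub>R B" for x :: 'a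
  define s where "s n x = real (Suc n) *\<^sub>R (f (x + (1 / real (Suc n)) *\<^sub>R e) - f x)" for n x
  have contf: "continuous_on S f" for S
    using der has_derivative_continuous continuous_at_imp_continuous_on by blast
  have f_meas [measurable]: "f \<in> borel_measurable borel"
    using contf by (rule borel_measurable_continuous_onI)
  have f_int: "integrable lborel f"
  proof -
    have "integrable lborel (\<lambda>x. indicator (cball 0 R) x *\<^sub>R f x)"
      by (rule borel_integrable_compact) (auto intro: contf)
    also have "(\<lambda>x. indicator (cball 0 R) x *\<^sub>R f x) = f"
      using K(2) R(2) by (force simp: indicator_def dist_norm)
    finally show ?thesis .
  qed
  have shift: "integrable lborel (\<lambda>x. f (x + h)) \<and> integral\<^sup>L lborel (\<lambda>x. f (x + h)) = integral\<^sup>L lborel f" for h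
  proof -
    have "integrable (distr lborel borel ((+) h)) f"
      using f_int by (simp add: lborel_distr_plus)
    moreover have "integral\<^sup>L (distr lborel borel ((+) h)) f = integral\<^sup>L lborel f"
      by (simp add: lborel_distr_plus)
    ultimately show ?thesis
      by (simp add: integrable_distr_eq integral_distr add.commute)
  qed
  have s_meas: "s n \<in> borel_measurable lborel" for n
    unfolding s_def by measurable
  have line: "norm (f (x + h *\<^sub>R e) - f x) \<le> B * h" if "0 \<le> h" for x h
  proof -
    have "norm (f (x + h *\<^sub>R e) - f (x + 0 *\<^sub>R e)) \<le> B * \<bar>h - 0\<bar>"
    proof (rule vector_derivative_bound[of 0 h _ "\<lambda>t. f' (x + t *\<^sub>R e) e"])
      fix t assume "t \<in> {0..h}"
      show "((\<lambda>t. f (x + t *\<^sub>R e)) has_vector_derivative f' (x + t *\<^sub>R e) e) (at t within {0..h})"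
        using der by (rule has_vector_derivative_along_line)
    qed (use that bd in auto)
    with that show ?thesis by simp
  qed
  have B0: "0 \<le> B" using bd[of 0] norm_ge_zero order_trans by blast
  have s_bd: "norm (s n x) \<le> w x" for n x
  proof (cases "x \<in> cball 0 (R + norm e)")
    case True
    have "norm (s n x) \<le> real (Suc n) * (B * (1 / real (Suc n)))"
      unfolding s_def norm_scaleR using line[of "1 / real (Suc n)" x]
      by (intro mult_mono) auto
    with True show ?thesis by (simp add: w_def)
  next
    case False
    then have x: "R + norm e < norm x" by simp
    have "norm ((1 / real (Suc n)) *\<^sub>R e) \<le> norm e"
      using mult_right_mono[of "1 / real (Suc n)" 1 "norm e"] by simp
    then have "R < norm (x + (1 / real (Suc n)) *\<^sub>R e)"
      using x norm_diff_ineq[of x "(1 / real (Suc n)) *\<^sub>R e"] by linarith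
    then have "f (x + (1 / real (Suc n)) *\<^sub>R e) = 0" using K(2) R(2) by force
    moreover have "f x = 0" using K(2) R(2) x by (smt (verit) norm_ge_zero)
    ultimately show ?thesis using False by (simp add: s_def w_def)
  qed
  have lim: "(\<lambda>n. s n x) \<longlonglongrightarrow> f' x e" for x
  proof -
    have "((\<lambda>t. f (x + t *\<^sub>R e)) has_vector_derivative f' x e) (at 0)"
      using has_vector_derivative_along_line[of f "f' x" x 0 e] der[of x] by simp
    then have "((\<lambda>t. (1 / norm (t - 0)) *\<^sub>R (f (x + t *\<^sub>R e) - (f (x + 0 *\<^sub>R e) + (t - 0) *\<^sub>R f' x e))) \<longlongrightarrow> 0) (at 0)"
      unfolding has_vector_derivative_def has_derivative_within by blast
    moreover have "filterlim (\<lambda>n. 1 / real (Suc n)) (at 0) sequentially"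
      unfolding filterlim_at using LIMSEQ_Suc[OF lim_1_over_n] by auto
    ultimately have "(\<lambda>n. (1 / norm (1 / real (Suc n) - 0)) *\<^sub>R (f (x + (1 / real (Suc n)) *\<^sub>R e) -
        (f (x + 0 *\<^sub>R e) + (1 / real (Suc n) - 0) *\<^sub>R f' x e))) \<longlonglongrightarrow> 0"
      by (rule filterlim_compose)
    also have "(\<lambda>n. (1 / norm (1 / real (Suc n) - 0)) *\<^sub>R (f (x + (1 / real (Suc n)) *\<^sub>R e) -
        (f (x + 0 *\<^sub>R e) + (1 / real (Suc n) - 0) *\<^sub>R f' x e))) = (\<lambda>n. s n x - f' x e)"
      by (rule ext) (simp add: s_def algebra_simps del: of_nat_Suc)
    finally show ?thesis by (simp add: LIM_zero_iff)
  qed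
  have w_int: "integrable lborel w"
    unfolding w_def by (rule borel_integrable_compact) auto
  \<comment> \<open>Continuity of the derivative is not assumed; it is measurable as a limit of
    difference quotients.\<close>
  have f'_meas: "(\<lambda>x. f' x e) \<in> borel_measurable lborel"
    by (rule borel_measurable_LIMSEQ_metric[OF s_meas lim])
  note dct = f'_meas s_meas w_int AE_I2[of lborel "\<lambda>x. (\<lambda>n. s n x) \<longlonglongrightarrow> f' x e", OF lim] AE_I2[of lborel, OF s_bd]
  have int: "integrable lborel (\<lambda>x. f' x e)"
    by (rule integrable_dominated_convergence[OF dct])
  have "(\<lambda>n. integral\<^sup>L lborel (s n)) \<longlonglongrightarrow> integral\<^sup>L lborel (\<lambda>x. f' x e)"
    by (rule integral_dominated_convergence[OF dct])
  moreover have "integral\<^sup>L lborel (s n) = 0" for n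
    unfolding s_def using shift f_int by simp
  ultimately have 0: "integral\<^sup>L lborel (\<lambda>x. f' x e) = 0"
    using LIMSEQ_unique[OF _ tendsto_const[of 0]] by simp
  show "(\<lambda>x. f' x e) absolutely_integrable_on UNIV"
    using int f'_meas by (simp add: set_integrable_def integrable_completion)
  show "integral UNIV (\<lambda>x. f' x e) = 0"
    using has_integral_integral_lborel[OF int] 0 by (simp add: integral_unique)
qed


subsection \<open>A cutoff function\<close>

lemma max_square_has_field_derivative:
  "((\<lambda>t::real. (max 0 t)\<^sup>2) has_field_derivative 2 * max 0 t) (at t)"
proof -
  consider "t < 0" | "t = 0" | "t > 0" by linarith
  then show ?thesis
  proof cases
    case 1
    have "((\<lambda>t::real. 0) has_field_derivative 0) (at t)" by simp
    then have "((\<lambda>t::real. (max 0 t)\<^sup>2) has_field_derivative 0) (at t)"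
      by (rule has_field_derivative_transform_within_open[where S = "{..<0}"]) (use 1 in auto)
    then show ?thesis using 1 by simp
  next
    case 2
    have "(\<lambda>h::real. max 0 h) \<midarrow>0\<rightarrow> max 0 0" by (intro tendsto_intros)
    then have "(\<lambda>h::real. max 0 h) \<midarrow>0\<rightarrow> 0" by simp
    then have "(\<lambda>h::real. (max 0 h)\<^sup>2 / h) \<midarrow>0\<rightarrow> 0"
      by (rule Lim_transform_eventually)
         (auto simp: eventually_at power2_eq_square max_def intro!: exI[of _ 1])
    then show ?thesis using 2 by (simp add: DERIV_def)
  next
    case 3
    have "((\<lambda>t::real. t\<^sup>2) has_field_derivative 2 * t) (at t)"
      by (auto intro!: derivative_eq_intros)
    then have "((\<lambda>t::real. (max 0 t)\<^sup>2) has_field_derivative 2 * t) (at t)"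
      by (rule has_field_derivative_transform_within_open[where S = "{0<..}"]) (use 3 in auto)
    then show ?thesis using 3 by simp
  qed
qed

text \<open>C^1 is enough, since Stokes' theorem differentiates the cutoff once. The denominator is
  positive because \<open>a < b\<close> leaves no point where both squares vanish. Strict positivity
  of \<open>h'\<close> turns \<open>h\<close> into a change of variable in
  \<open>integral_unit_cell_cutoff\<close>.\<close>

lemma exists_cutoff:
  fixes a b :: real
  assumes "a < b"
  obtains h h' :: "real \<Rightarrow> real" where
    "\<And>r. (h has_field_derivative h' r) (at r)" "continuous_on UNIV h'"
    "\<And>r. r \<le> a \<Longrightarrow> h r = 0" "\<And>r. b \<le> r \<Longrightarrow> h r = 1"
    "\<And>r. a < r \<Longrightarrow> r < b \<Longrightarrow> 0 < h' r" "\<And>r. r \<le> a \<or> b \<le> r \<Longrightarrow> h' r = 0"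
proof -
  define u where "u t = (max 0 t)\<^sup>2" for t :: real
  define h where "h r = u (r - a) / (u (r - a) + u (b - r))" for r
  define h' where "h' r = (2 * max 0 (r - a) * u (b - r) + u (r - a) * (2 * max 0 (b - r))) /
    (u (r - a) + u (b - r))\<^sup>2" for r
  have pos: "0 < u (r - a) + u (b - r)" for r
    using assms by (cases "r \<le> a") (auto simp: u_def add_nonneg_pos add_pos_nonneg)
  have du: "(u has_field_derivative 2 * max 0 t) (at t)" for t
    unfolding u_def by (rule max_square_has_field_derivative)
  have "(h has_field_derivative h' r) (at r)" for r
  proof -
    have 1: "((\<lambda>r. u (r - a)) has_field_derivative 2 * max 0 (r - a)) (at r)"
      by (rule DERIV_chain2[where f = u and g = "\<lambda>r. r - a" and Db = 1, simplified])
         (auto intro!: derivative_eq_intros du)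
    have 2: "((\<lambda>r. u (b - r)) has_field_derivative - (2 * max 0 (b - r))) (at r)"
      by (rule DERIV_chain2[where f = u and g = "\<lambda>r. b - r" and Db = "-1", simplified])
         (auto intro!: derivative_eq_intros du)
    show ?thesis
      unfolding h_def
      by (rule DERIV_cong[OF DERIV_divide[OF 1 DERIV_add[OF 1 2]]])
         (use pos[of r] in \<open>auto simp: h'_def power2_eq_square algebra_simps\<close>)
  qed
  moreover have "continuous_on UNIV h'"
  proof -
    have "((max 0 (r - a))\<^sup>2 + (max 0 (b - r))\<^sup>2)\<^sup>2 \<noteq> 0" for r
      using pos[of r] unfolding u_def by (metis less_irrefl power_not_zero)
    then show ?thesis unfolding h'_def u_def by (intro continuous_intros) blast
  qed
  moreover have "h r = 0" if "r \<le> a" for r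
    using that by (simp add: h_def u_def)
  moreover have "h r = 1" if "b \<le> r" for r
    using that pos[of r] by (simp add: h_def u_def)
  moreover have "0 < h' r" if "a < r" "r < b" for r
    unfolding h'_def using that pos[of r]
    by (intro divide_pos_pos add_pos_pos) (auto simp: u_def)
  moreover have "h' r = 0" if "r \<le> a \<or> b \<le> r" for r
    using that by (auto simp: h'_def u_def)
  ultimately show ?thesis using that by blast
qed

text \<open>A fundamental domain of the lattice of integer translations in x and y: half-open in the
  two periodic directions, so every collar point with r > 0 has exactly one representative.\<close>

definition unit_cell :: "(real^3) set" where
  "unit_cell = {z. 0 \<le> z $ 1 \<and> z $ 1 < 1 \<and> 0 \<le> z $ 2 \<and> z $ 2 < 1 \<and> 0 < z $ 3 \<and> z $ 3 \<le> 1}"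

lemma measurable_component [measurable]: "(\<lambda>z::real^'n. z $ i) \<in> borel_measurable borel"
  by (intro borel_measurable_continuous_onI continuous_intros)

lemma unit_cell_measurable: "unit_cell \<in> sets lebesgue"
proof -
  have "unit_cell \<in> sets borel" unfolding unit_cell_def by measurable
  then show ?thesis by (simp add: sets_completionI_sets)
qed

text \<open>\<open>h'\<close> integrates to \<open>h b - h a\<close> in the third variable. Instead
  of an iterated integral, the substitution that replaces r by h(r) is used: its Jacobian is
  \<open>h'\<close>, and its image lies between the open and the closed unit cube, which differ by a
  negligible set.\<close>

lemma integral_unit_cell_cutoff:
  fixes h h' :: "real \<Rightarrow> real"
  assumes ab: "0 \<le> a" "a < b" "b \<le> 1"
    and h: "\<And>r. (h has_field_derivative h' r) (at r)" "h a = 0" "h b = 1"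
    and h': "\<And>r. a < r \<Longrightarrow> r < b \<Longrightarrow> 0 < h' r" "\<And>r. r \<le> a \<or> b \<le> r \<Longrightarrow> h' r = 0"
  shows "integral unit_cell (\<lambda>z. complex_of_real (h' (z $ 3))) = 1"
proof -
  define S where "S = {z::real^3. 0 \<le> z $ 1 \<and> z $ 1 < 1 \<and> 0 \<le> z $ 2 \<and> z $ 2 < 1 \<and> a < z $ 3 \<and> z $ 3 < b}"
  define g where "g z = (\<chi> i. if i = 3 then h (z $ 3) else z $ i)" for z :: "real^3"
  define g' where "g' z v = (\<chi> i. if i = 3 then h' (z $ 3) * v $ 3 else v $ i)" for z v :: "real^3"
  have "S \<in> sets borel" unfolding S_def by measurable
  then have S: "S \<in> sets lebesgue" by (simp add: sets_completionI_sets)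
  have mono: "h r < h s" if "a \<le> r" "r < s" "s \<le> b" for r s
  proof -
    have "\<exists>z>r. z < s \<and> h s - h r = (s - r) * h' z"
      using that h(1) by (intro MVT2) auto
    then obtain z where z: "r < z" "z < s" "h s - h r = (s - r) * h' z" by blast
    moreover have "0 < h' z" using z that h' by auto
    ultimately show ?thesis using that by (metis diff_gt_0_iff_gt mult_pos_pos)
  qed
  have der: "(g has_derivative g' z) (at z within S)" for z
  proof (rule has_derivative_componentwise_within[THEN iffD2])
    have "((\<lambda>z. g z \<bullet> axis i 1) has_derivative (\<lambda>v. g' z v \<bullet> axis i 1)) (at z within S)" for i
    proof (cases "i = 3")
      case True
      have "((\<lambda>z::real^3. z $ 3) has_derivative (\<lambda>v. v $ 3)) (at z within S)"
        by (rule bounded_linear_imp_has_derivative[OF bounded_linear_vec_nth])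
      then have "((\<lambda>z::real^3. h (z $ 3)) has_derivative (\<lambda>v. h' (z $ 3) * v $ 3)) (at z within S)"
        using has_derivative_compose[of "\<lambda>z. z $ 3" "\<lambda>v. v $ 3" z S h "(*) (h' (z $ 3))"] h(1)[of "z $ 3"]
        by (simp add: has_field_derivative_def)
      then show ?thesis using True by (simp add: g_def g'_def inner_axis)
    next
      case False
      then show ?thesis
        by (simp add: g_def g'_def inner_axis bounded_linear_imp_has_derivative[OF bounded_linear_vec_nth])
    qed
    then show "\<forall>i\<in>Basis. ((\<lambda>z. g z \<bullet> i) has_derivative (\<lambda>v. g' z v \<bullet> i)) (at z within S)"
      by (auto simp: Basis_vec_def)
  qed
  have det: "det (matrix (g' z)) = h' (z $ 3)" for z
    by (simp add: det_3 matrix_def g'_def axis_def)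
  have inj: "inj_on g S"
  proof (rule inj_onI)
    fix z w assume zw: "z \<in> S" "w \<in> S" "g z = g w"
    have g: "g z $ i = g w $ i" for i using zw(3) by simp
    have *: "z $ i = w $ i" if "i \<noteq> 3" for i
      using g[of i] that by (simp add: g_def)
    have "h (z $ 3) = h (w $ 3)"
      using g[of 3] by (simp add: g_def)
    then have "z $ 3 = w $ 3"
      using mono[of "z $ 3" "w $ 3"] mono[of "w $ 3" "z $ 3"] zw(1,2) by (force simp: S_def)
    with * show "z = w" by (metis vec_eq_iff)
  qed
  have img: "box 0 1 \<subseteq> g ` S" "g ` S \<subseteq> cbox 0 1"
  proof -
    show "g ` S \<subseteq> cbox 0 1"
      using mono[of a] mono[of _ b] h(2,3)
      by (auto simp: mem_box_cart forall_3 g_def S_def less_imp_le)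
    show "box 0 1 \<subseteq> g ` S"
    proof
      fix w :: "real^3" assume "w \<in> box 0 1"
      then have w: "0 < w $ i" "w $ i < 1" for i by (auto simp: mem_box_cart)
      have "\<exists>r\<ge>a. r \<le> b \<and> h r = w $ 3"
        using ab w[of 3] h DERIV_isCont[OF h(1)] by (intro IVT) (auto simp: less_imp_le)
      then obtain r where r: "a \<le> r" "r \<le> b" "h r = w $ 3" by blast
      then have "a < r" "r < b" using w[of 3] h(2,3) by (auto simp: order_less_le)
      then have A: "(\<chi> i. if i = 3 then r else w $ i) \<in> S"
        using w by (simp add: S_def less_imp_le)
      have B: "g (\<chi> i. if i = 3 then r else w $ i) = w"
        using r by (simp add: g_def vec_eq_iff)
      show "w \<in> g ` S" using imageI[OF A, of g] unfolding B .
    qed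
  qed
  have neg: "negligible (cbox 0 1 - g ` S)"
    by (rule negligible_subset[OF negligible_frontier_interval[of 0 "1::real^3"]]) (use img in auto)
  have const: "(\<lambda>z::real^3. 1::complex) absolutely_integrable_on cbox 0 1"
    by (rule absolutely_integrable_compact_support[of "cbox 0 1"]) auto
  have e1: "{z \<in> cbox 0 1 - g ` S. (1::complex) \<noteq> 0} = cbox 0 1 - g ` S"
    "{z \<in> g ` S - cbox 0 1. (1::complex) \<noteq> 0} = {}" using img by auto
  have int: "(\<lambda>z. 1::complex) absolutely_integrable_on g ` S"
    using const absolutely_integrable_spike_set_eq[of "cbox 0 1" "g ` S" "\<lambda>z. 1::complex"] neg
    unfolding e1 by simp
  have "((\<lambda>z::real^3. 1::complex) has_integral measure lborel (cbox 0 (1::real^3)) *\<^sub>R 1) (cbox 0 1)"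
    by (rule has_integral_const)
  then have "((\<lambda>z::real^3. 1::complex) has_integral 1) (cbox 0 1)"
    by (simp add: content_cbox_cart interval_eq_empty_cart)
  then have "integral (g ` S) (\<lambda>z. 1::complex) = 1"
    using has_integral_spike_set_eq[of "cbox 0 1" "g ` S" "\<lambda>z. 1::complex"] neg
    unfolding e1 by (simp add: integral_unique)
  then have "integral S (\<lambda>z. \<bar>det (matrix (g' z))\<bar> *\<^sub>R (1::complex)) = 1"
    using integral_change_of_variables_complex(2)[OF S der inj int] by simp
  also have "integral S (\<lambda>z. \<bar>det (matrix (g' z))\<bar> *\<^sub>R (1::complex)) =
      integral S (\<lambda>z. complex_of_real (h' (z $ 3)))"
    by (rule integral_cong) (use h'(1) in \<open>auto simp: S_def det scaleR_conv_of_real less_imp_le\<close>)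
  also have "\<dots> = integral unit_cell (\<lambda>z. complex_of_real (h' (z $ 3)))"
  proof (rule integral_spike_set)
    have "{z \<in> S - unit_cell. complex_of_real (h' (z $ 3)) \<noteq> 0} = {}"
      using ab by (auto simp: S_def unit_cell_def)
    moreover have "{z \<in> unit_cell - S. complex_of_real (h' (z $ 3)) \<noteq> 0} = {}"
      using h'(2) by (auto simp: S_def unit_cell_def) (meson not_le)+
    ultimately show "negligible {z \<in> S - unit_cell. complex_of_real (h' (z $ 3)) \<noteq> 0}"
      "negligible {z \<in> unit_cell - S. complex_of_real (h' (z $ 3)) \<noteq> 0}"
      by (simp_all only: negligible_empty)
  qed
  finally show ?thesis .
qed

section \<open>Matrix-valued forms at a point\<close>

lemma bounded_bilinear_matrix_mult: "bounded_bilinear ((**) :: cmat \<Rightarrow> cmat \<Rightarrow> cmat)"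
  unfolding bilinear_conv_bounded_bilinear[symmetric] bilinear_def
  by (intro conjI allI linearI)
     (simp_all add: matrix_add_ldistrib matrix_matrix_mult_def vec_eq_iff sum_3 algebra_simps)

lemma bounded_linear_trace: "bounded_linear (trace :: cmat \<Rightarrow> complex)"
  by (intro linear_conv_bounded_linear[THEN iffD1] linearI)
     (simp_all add: trace_def sum_3 algebra_simps)

lemma bounded_bilinear_trace_mult: "bounded_bilinear (\<lambda>x y :: cmat. trace (x ** y))"
  unfolding bilinear_conv_bounded_bilinear[symmetric] bilinear_def
  by (intro conjI allI linearI)
     (simp_all add: bounded_bilinear.add_left[OF bounded_bilinear_matrix_mult]
       bounded_bilinear.add_right[OF bounded_bilinear_matrix_mult]
       bounded_bilinear.scaleR_left[OF bounded_bilinear_matrix_mult]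
       bounded_bilinear.scaleR_right[OF bounded_bilinear_matrix_mult]
       linear_simps[OF bounded_linear_trace])

lemma trace_cyclic:
  fixes x y z :: cmat
  shows "trace (x ** y ** z) = trace (y ** z ** x)"
  by (metis matrix_mul_assoc trace_mul_sym)

text \<open>Expanding each value of \<open>L\<close> in the basis leaves only the six permutations
  of the basis vectors, whose signs follow by polarising the alternation. All transformation rules
  for densities below come from here.\<close>

lemma alternating_det:
  fixes T :: "real^3 \<Rightarrow> real^3 \<Rightarrow> real^3 \<Rightarrow> complex"
  assumes lin: "\<And>v w. linear (\<lambda>u. T u v w)" "\<And>u w. linear (\<lambda>v. T u v w)" "\<And>u v. linear (\<lambda>w. T u v w)"
    and alt: "\<And>u w. T u u w = 0" "\<And>u v. T u v v = 0" "\<And>u v. T u v u = 0"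
    and L: "linear L"
  shows "T (L (axis 1 1)) (L (axis 2 1)) (L (axis 3 1)) =
    complex_of_real (det (matrix L)) * T (axis 1 1) (axis 2 1) (axis 3 1)"
proof -
  let ?e1 = "axis 1 1 :: real^3" and ?e2 = "axis 2 1 :: real^3" and ?e3 = "axis 3 1 :: real^3"
  define m where "m = matrix L"
  have L: "L (axis j 1) = m $ 1 $ j *\<^sub>R ?e1 + m $ 2 $ j *\<^sub>R ?e2 + m $ 3 $ j *\<^sub>R ?e3" for j
    by (simp add: m_def matrix_def vec_eq_iff forall_3 axis_def)
  note add = linear_add[OF lin(1)] linear_add[OF lin(2)] linear_add[OF lin(3)]
  note scale = linear_scale[OF lin(1)] linear_scale[OF lin(2)] linear_scale[OF lin(3)]
  have s12: "T u v w = - T v u w" for u v w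
    using alt(1)[of "u + v" w] unfolding add by (simp add: alt eq_neg_iff_add_eq_0 add.commute)
  have s23: "T u v w = - T u w v" for u v w
    using alt(2)[of u "v + w"] unfolding add by (simp add: alt eq_neg_iff_add_eq_0 add.commute)
  have p: "T ?e2 ?e1 ?e3 = - T ?e1 ?e2 ?e3" "T ?e1 ?e3 ?e2 = - T ?e1 ?e2 ?e3"
    "T ?e3 ?e1 ?e2 = T ?e1 ?e2 ?e3" "T ?e2 ?e3 ?e1 = T ?e1 ?e2 ?e3" "T ?e3 ?e2 ?e1 = - T ?e1 ?e2 ?e3"
    using s12[of ?e2 ?e1 ?e3] s23[of ?e1 ?e3 ?e2] s12[of ?e3 ?e1 ?e2] s23[of ?e2 ?e3 ?e1]
      s12[of ?e3 ?e2 ?e1] by simp_all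
  show ?thesis
    unfolding L det_3 m_def[symmetric] add scale alt p
    by (simp add: scaleR_conv_of_real algebra_simps)
qed

text \<open>
  The Chern-Simons density of a flat connection is, up to a constant, the value of
  \<open>tr (A \<and> A \<and> A) / 3\<close> on the standard basis, because \<open>dA = - A \<and> A\<close>.
\<close>

definition cubic :: "(real^3 \<Rightarrow> cmat) \<Rightarrow> complex" where
  "cubic a = trace (a (axis 1 1) ** a (axis 2 1) ** a (axis 3 1)) -
             trace (a (axis 1 1) ** a (axis 3 1) ** a (axis 2 1))"

text \<open>The 2-form tr (a \<and> b).\<close>

definition wtrace :: "(real^3 \<Rightarrow> cmat) \<Rightarrow> (real^3 \<Rightarrow> cmat) \<Rightarrow> real^3 \<Rightarrow> real^3 \<Rightarrow> complex" where
  "wtrace a b v w = trace (a v ** b w) - trace (a w ** b v)"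

text \<open>The value of the 3-form l \<and> w on the standard basis, for a 1-form \<open>l\<close>
  and a 2-form \<open>w\<close>.\<close>

definition wedge_density :: "(real^3 \<Rightarrow> real) \<Rightarrow> (real^3 \<Rightarrow> real^3 \<Rightarrow> complex) \<Rightarrow> complex" where
  "wedge_density l w = l (axis 1 1) *\<^sub>R w (axis 2 1) (axis 3 1) -
     l (axis 2 1) *\<^sub>R w (axis 1 1) (axis 3 1) + l (axis 3 1) *\<^sub>R w (axis 1 1) (axis 2 1)"

lemma linear_trace_mult:
  "linear a \<Longrightarrow> linear (\<lambda>u. trace (a u ** y))" "linear a \<Longrightarrow> linear (\<lambda>u. trace (y ** a u))"
  for a :: "real^3 \<Rightarrow> cmat"
  by (auto intro!: linearI simp: linear_add linear_scale
      bounded_bilinear.add_left[OF bounded_bilinear_trace_mult]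
      bounded_bilinear.add_right[OF bounded_bilinear_trace_mult]
      bounded_bilinear.scaleR_left[OF bounded_bilinear_trace_mult]
      bounded_bilinear.scaleR_right[OF bounded_bilinear_trace_mult])

lemma linear_trace_mult_mid: "linear a \<Longrightarrow> linear (\<lambda>u. trace (x ** a u ** y))"
  for a :: "real^3 \<Rightarrow> cmat" and x y :: cmat
proof -
  assume "linear a"
  then have "linear (\<lambda>u. trace (a u ** (y ** x)))" by (rule linear_trace_mult)
  then show ?thesis by (simp add: trace_cyclic[of x] matrix_mul_assoc)
qed

text \<open>By cyclicity of the trace, tr (uvw) - tr (uwv) is alternating, so \<open>cubic\<close>
  transforms with the determinant like the coefficient of any 3-form.\<close>

lemma cubic_pullback:
  assumes a: "linear a" and L: "linear L"
  shows "cubic (\<lambda>v. a (L v)) = complex_of_real (det (matrix L)) * cubic a"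
proof -
  define T where "T u v w = trace (a u ** a v ** a w) - trace (a u ** a w ** a v)" for u v w
  have "T (L (axis 1 1)) (L (axis 2 1)) (L (axis 3 1)) =
      complex_of_real (det (matrix L)) * T (axis 1 1) (axis 2 1) (axis 3 1)"
  proof (rule alternating_det[OF _ _ _ _ _ _ L])
    show "linear (\<lambda>u. T u v w)" for v w
      unfolding T_def matrix_mul_assoc[symmetric] by (intro linear_compose_sub linear_trace_mult a)
    show "linear (\<lambda>v. T u v w)" for u w
      unfolding T_def by (intro linear_compose_sub linear_trace_mult linear_trace_mult_mid a)
    show "linear (\<lambda>w. T u v w)" for u v
      unfolding T_def by (intro linear_compose_sub linear_trace_mult linear_trace_mult_mid a)
    show "T u u w = 0" "T u v v = 0" "T u v u = 0" for u v w
      unfolding T_def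
      using trace_cyclic[of "a u" "a u" "a w"] trace_cyclic[of "a u" "a w" "a u"]
        trace_cyclic[of "a u" "a u" "a v"] trace_cyclic[of "a u" "a v" "a u"] by simp_all
  qed
  then show ?thesis by (simp add: T_def cubic_def)
qed

lemma wedge_density_pullback:
  assumes l: "linear l" and a: "linear a" and b: "linear b" and L: "linear L"
  shows "wedge_density (\<lambda>v. l (L v)) (\<lambda>v w. wtrace a b (L v) (L w)) =
    complex_of_real (det (matrix L)) * wedge_density l (wtrace a b)"
proof -
  define T where "T u v w = l u *\<^sub>R wtrace a b v w - l v *\<^sub>R wtrace a b u w + l w *\<^sub>R wtrace a b u v"
    for u v w
  have lin1: "linear (\<lambda>v. wtrace a b v w)" for w
    unfolding wtrace_def by (intro linear_compose_sub linear_trace_mult a b)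
  have lin2: "linear (\<lambda>w. wtrace a b v w)" for v
    unfolding wtrace_def by (intro linear_compose_sub linear_trace_mult a b)
  have lin3: "linear (\<lambda>v. l v *\<^sub>R c)" for c :: complex
    by (intro linearI) (simp_all add: linear_add[OF l] linear_scale[OF l] algebra_simps)
  have "T (L (axis 1 1)) (L (axis 2 1)) (L (axis 3 1)) =
      complex_of_real (det (matrix L)) * T (axis 1 1) (axis 2 1) (axis 3 1)"
  proof (rule alternating_det[OF _ _ _ _ _ _ L])
    show "linear (\<lambda>u. T u v w)" for v w
      unfolding T_def by (intro linear_compose_sub linear_compose_add linear_compose_scale_right lin1 lin2 lin3)
    show "linear (\<lambda>v. T u v w)" for u w
      unfolding T_def by (intro linear_compose_sub linear_compose_add linear_compose_scale_right lin1 lin2 lin3)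
    show "linear (\<lambda>w. T u v w)" for u v
      unfolding T_def by (intro linear_compose_sub linear_compose_add linear_compose_scale_right lin1 lin2 lin3)
    show "T u u w = 0" "T u v v = 0" "T u v u = 0" for u v w
      unfolding T_def wtrace_def by (simp_all add: algebra_simps)
  qed
  then show ?thesis by (simp add: T_def wedge_density_def)
qed

text \<open>
  With \<open>aij\<close> for the derivative of \<open>aj\<close> in direction \<open>i\<close>, this is
  \<open>tr (b^3 - a^3 - (b - a)^3) / 3 = d tr (a \<and> b)\<close> for flat \<open>a\<close> and \<open>b\<close>.
\<close>

lemma flat_cubic_difference:
  fixes a1 a2 a3 b1 b2 b3 :: cmat
  assumes a: "a12 - a21 + (a1 ** a2 - a2 ** a1) = 0" "a13 - a31 + (a1 ** a3 - a3 ** a1) = 0"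
      "a23 - a32 + (a2 ** a3 - a3 ** a2) = 0"
    and b: "b12 - b21 + (b1 ** b2 - b2 ** b1) = 0" "b13 - b31 + (b1 ** b3 - b3 ** b1) = 0"
      "b23 - b32 + (b2 ** b3 - b3 ** b2) = 0"
  shows "(trace (a2 ** b13) + trace (a12 ** b3) - (trace (a3 ** b12) + trace (a13 ** b2))) -
      (trace (a1 ** b23) + trace (a21 ** b3) - (trace (a3 ** b21) + trace (a23 ** b1))) +
      (trace (a1 ** b32) + trace (a31 ** b2) - (trace (a2 ** b31) + trace (a32 ** b1))) =
    (trace (b1 ** b2 ** b3) - trace (b1 ** b3 ** b2)) - (trace (a1 ** a2 ** a3) - trace (a1 ** a3 ** a2)) -
    (trace ((b1 - a1) ** (b2 - a2) ** (b3 - a3)) - trace ((b1 - a1) ** (b3 - a3) ** (b2 - a2)))"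
proof -
  have s: "a12 = a21 - (a1 ** a2 - a2 ** a1)" "a13 = a31 - (a1 ** a3 - a3 ** a1)"
      "a23 = a32 - (a2 ** a3 - a3 ** a2)" "b12 = b21 - (b1 ** b2 - b2 ** b1)"
      "b13 = b31 - (b1 ** b3 - b3 ** b1)" "b23 = b32 - (b2 ** b3 - b3 ** b2)"
    using a b by (simp_all add: algebra_simps)
  have tsub: "trace (x - y) = trace x - trace y" for x y :: cmat
    by (rule trace_sub)
  have d: "(x - y) ** z = x ** z - y ** z" "z ** (x - y) = z ** x - z ** y" for x y z :: cmat
    by (rule bounded_bilinear.diff_left[OF bounded_bilinear_matrix_mult]
        bounded_bilinear.diff_right[OF bounded_bilinear_matrix_mult])+
  show ?thesis
    \<comment> \<open>The flatness equations eliminate one derivative of each antisymmetric pair,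
      and the others cancel. Every remaining product has exactly one factor with index 1; rotating
      it to the front is a normal form under cyclicity.\<close>
    unfolding s d tsub matrix_mul_assoc
    by (simp add: trace_cyclic[of _ a1] trace_cyclic[of _ b1] trace_cyclic[of a1, symmetric]
        trace_cyclic[of b1, symmetric])
qed

section \<open>Integration of densities\<close>

lemma closed_halfspace: "closed halfspace"
  unfolding halfspace_def by (rule closed_halfspace_component_le_cart)

lemma lebesgue_openin_halfspace:
  assumes "openin (top_of_set halfspace) S"
  shows "S \<in> sets lebesgue"
proof -
  obtain U where "open U" "S = halfspace \<inter> U" using assms by (auto simp: openin_open)
  then have "S \<in> sets borel" using closed_halfspace by auto
  then show ?thesis by (simp add: sets_completionI_sets)
qed

context atlas
begin

text \<open>The coefficients of a 3-form in the charts: they transform with the Jacobian determinant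
  itself, not with its absolute value.\<close>

definition natural_density :: "('a chart \<Rightarrow> real^3 \<Rightarrow> complex) \<Rightarrow> bool" where
  "natural_density \<psi> \<longleftrightarrow> (\<forall>c\<in>\<A>. \<forall>d\<in>\<A>. \<forall>z\<in>overlap c d.
     \<psi> c z = of_real (det (matrix (D_transition c d z))) * \<psi> d (transition c d z))"

lemma D_transition_works:
  assumes "c \<in> \<A>" "d \<in> \<A>" "z \<in> overlap c d"
  shows "(transition c d has_derivative D_transition c d z) (at z within overlap c d)"
  using smooth_transition[OF assms(1,2)] assms(3) Ck_on_SucD[of 0 "overlap c d" "transition c d" z]
  unfolding D_transition_def smooth_on_def by blast

lemma linear_D_transition:
  "c \<in> \<A> \<Longrightarrow> d \<in> \<A> \<Longrightarrow> z \<in> overlap c d \<Longrightarrow> linear (D_transition c d z)"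
  using D_transition_works has_derivative_linear by blast

lemma transition_inverse:
  assumes "c \<in> \<A>" "d \<in> \<A>" "z \<in> overlap c d"
  shows "transition d c (transition c d z) = z"
proof -
  have "transition d c (transition c d z) = cmap c (cinv d (transition c d z))"
    by (simp add: transition_def)
  also have "\<dots> = cmap c (cinv c z)" using cinv_transition assms by simp
  also have "\<dots> = z" using assms(3) overlap_subset cmap_cinv by (meson subsetD)
  finally show ?thesis .
qed

lemma transition_image:
  assumes "c \<in> \<A>" "d \<in> \<A>"
  shows "transition c d ` overlap c d = overlap d c"
proof
  show "transition c d ` overlap c d \<subseteq> overlap d c"
    by (rule image_subsetI) (rule transition_in[OF assms])
  show "overlap d c \<subseteq> transition c d ` overlap c d"
  proof
    fix z assume z: "z \<in> overlap d c"
    show "z \<in> transition c d ` overlap c d"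
      using imageI[OF transition_in[OF assms(2,1) z], of "transition c d"]
      unfolding transition_inverse[OF assms(2,1) z] .
  qed
qed

text \<open>Positive transition determinants make the oriented and the absolute Jacobian agree, so
  the change of variables formula applies to coefficients of 3-forms. Both integrands vanish off the
  overlap, so integrals over it are integrals over the full charts.\<close>

lemma integral_transfer:
  assumes c: "c \<in> \<A>" and d: "d \<in> \<A>"
    and nat: "\<And>z. z \<in> overlap c d \<Longrightarrow>
      \<psi> z = of_real (det (matrix (D_transition c d z))) * \<phi> (transition c d z)"
    and zero: "\<And>z. z \<in> cimg c \<Longrightarrow> z \<notin> overlap c d \<Longrightarrow> \<psi> z = (0::complex)"
      "\<And>z. z \<in> cimg d \<Longrightarrow> z \<notin> overlap d c \<Longrightarrow> \<phi> z = (0::complex)"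
    and int: "\<phi> absolutely_integrable_on cimg d"
  shows "integral (cimg c) \<psi> = integral (cimg d) \<phi>"
proof -
  have e1: "{z \<in> cimg d - overlap d c. \<phi> z \<noteq> 0} = {}" "{z \<in> overlap d c - cimg d. \<phi> z \<noteq> 0} = {}"
    using zero(2) overlap_subset[of d c] by blast+
  have e2: "{z \<in> cimg c - overlap c d. \<psi> z \<noteq> 0} = {}" "{z \<in> overlap c d - cimg c. \<psi> z \<noteq> 0} = {}"
    using zero(1) overlap_subset[of c d] by blast+
  have "\<phi> absolutely_integrable_on overlap d c"
    using int absolutely_integrable_spike_set_eq[of "cimg d" "overlap d c" \<phi>]
    unfolding e1 by (simp only: negligible_empty)
  then have "integral (overlap d c) \<phi> =
      integral (overlap c d) (\<lambda>z. \<bar>det (matrix (D_transition c d z))\<bar> *\<^sub>R \<phi> (transition c d z))"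
    unfolding transition_image[OF c d, symmetric]
    using lebesgue_openin_halfspace[OF overlap_open[OF c d]] D_transition_works[OF c d]
    by (intro integral_change_of_variables_complex(2) inj_on_inverseI[of _ "transition d c"] transition_inverse c d)
  also have "\<dots> = integral (overlap c d) \<psi>"
    by (rule integral_cong)
       (simp add: nat abs_of_pos[OF det_transition[OF c d]] scaleR_conv_of_real)
  also have "\<dots> = integral (cimg c) \<psi>"
    by (rule integral_spike_set) (simp_all only: e2 negligible_empty)
  finally have "integral (overlap d c) \<phi> = integral (cimg c) \<psi>" .
  moreover have "integral (overlap d c) \<phi> = integral (cimg d) \<phi>"
    by (rule integral_spike_set) (simp_all only: e1 negligible_empty)
  ultimately show ?thesis by simp
qed

end

locale atlas_partition = atlas X \<A> for X :: "'a topology" and \<A> +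
  fixes \<rho> :: "'a chart \<Rightarrow> 'a \<Rightarrow> real"
  assumes partition: "partition_of_unity X \<A> \<rho>"
begin

definition active :: "'a chart set" where
  "active = {c \<in> \<A>. \<exists>p\<in>topspace X. \<rho> c p \<noteq> 0}"

definition supp :: "'a chart \<Rightarrow> 'a set" where
  "supp c = X closure_of {p \<in> topspace X. \<rho> c p \<noteq> 0}"

lemma finite_active: "finite active"
  using partition unfolding partition_of_unity_def active_def by blast

lemma active_subset: "c \<in> active \<Longrightarrow> c \<in> \<A>"
  unfolding active_def by blast

lemma supp_subset: "c \<in> \<A> \<Longrightarrow> supp c \<subseteq> cdom c"
  using partition unfolding partition_of_unity_def supp_def by blast

lemma smooth_partition: "c \<in> \<A> \<Longrightarrow> d \<in> \<A> \<Longrightarrow> smooth_on (cimg d) (\<rho> c \<circ> cinv d)"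
  using partition unfolding partition_of_unity_def by blast

lemma sum_partition: "p \<in> topspace X \<Longrightarrow> (\<Sum>c\<in>active. \<rho> c p) = 1"
  using partition unfolding partition_of_unity_def active_def by blast

lemma closed_supp: "closedin X (supp c)"
  unfolding supp_def by (rule closedin_closure_of)

lemma partition_zero: "p \<in> topspace X \<Longrightarrow> p \<notin> supp c \<Longrightarrow> \<rho> c p = 0"
  using closure_of_subset[of "{p \<in> topspace X. \<rho> c p \<noteq> 0}" X] unfolding supp_def by blast

lemma cinv_topspace: "d \<in> \<A> \<Longrightarrow> z \<in> cimg d \<Longrightarrow> cinv d z \<in> topspace X"
  using cinv_in cdom_subset by (meson subsetD)

definition csupp :: "'a chart \<Rightarrow> (real^3) set" where
  "csupp c = cmap c ` supp c"

lemma compact_csupp: "c \<in> \<A> \<Longrightarrow> compact (csupp c)"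
  unfolding csupp_def using compact_cmap_image closed_supp supp_subset by blast

lemma csupp_subset: "c \<in> \<A> \<Longrightarrow> csupp c \<subseteq> cimg c"
  unfolding csupp_def using supp_subset by blast

lemma csupp_iff:
  assumes "c \<in> \<A>" "z \<in> cimg c"
  shows "z \<in> csupp c \<longleftrightarrow> cinv c z \<in> supp c"
proof
  assume "z \<in> csupp c"
  then obtain p where p: "p \<in> supp c" "z = cmap c p" unfolding csupp_def by blast
  then have "cinv c z = p" using supp_subset[OF assms(1)] cinv_cmap[OF assms(1)] by blast
  with p show "cinv c z \<in> supp c" by simp
next
  assume "cinv c z \<in> supp c"
  from imageI[OF this, of "cmap c"] show "z \<in> csupp c"
    unfolding csupp_def cmap_cinv[OF assms(2)] .
qed

lemma continuous_partition: "c \<in> \<A> \<Longrightarrow> d \<in> \<A> \<Longrightarrow> continuous_on (cimg d) (\<lambda>z. \<rho> c (cinv d z))"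
  using smooth_partition Ck_on_imp_continuous_on[of 0] unfolding smooth_on_def comp_def by blast

lemma absolutely_integrable_supp:
  fixes f :: "real^3 \<Rightarrow> complex"
  assumes c: "c \<in> \<A>" and f: "continuous_on (cimg c) f"
    and zero: "\<And>z. z \<in> cimg c \<Longrightarrow> cinv c z \<notin> supp c \<Longrightarrow> f z = 0"
  shows "f absolutely_integrable_on cimg c"
proof (rule absolutely_integrable_compact_support[OF compact_csupp[OF c] csupp_subset[OF c]])
  show "continuous_on (csupp c) f"
    using f csupp_subset[OF c] by (rule continuous_on_subset)
  show "f z = 0" if "z \<in> cimg c - csupp c" for z
    using that csupp_iff[OF c, of z] zero[of z] by (meson DiffD1 DiffD2)
qed

lemma absolutely_integrable_partition:
  fixes f :: "real^3 \<Rightarrow> complex"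
  assumes c: "c \<in> \<A>" and f: "continuous_on (cimg c) f"
  shows "(\<lambda>z. \<rho> c (cinv c z) *\<^sub>R f z) absolutely_integrable_on cimg c"
proof (rule absolutely_integrable_supp[OF c])
  show "continuous_on (cimg c) (\<lambda>z. \<rho> c (cinv c z) *\<^sub>R f z)"
    by (intro continuous_on_scaleR continuous_partition c f)
  show "\<rho> c (cinv c z) *\<^sub>R f z = 0" if "z \<in> cimg c" "cinv c z \<notin> supp c" for z
    using partition_zero[OF cinv_topspace[OF c that(1)] that(2)] by simp
qed

abbreviation weighted :: "'a chart \<Rightarrow> (real^3 \<Rightarrow> complex) \<Rightarrow> complex" where
  "weighted c f \<equiv> integral (cimg c) (\<lambda>z. \<rho> c (cinv c z) *\<^sub>R f z)"

definition pou_integral :: "('a chart \<Rightarrow> real^3 \<Rightarrow> complex) \<Rightarrow> complex" where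
  "pou_integral \<psi> = (\<Sum>c\<in>active. weighted c (\<lambda>z. \<psi> c z))"

text \<open>Each \<open>\<Psi> c\<close> is a 3-form supported in the chart \<open>c\<close> and so
  far integrated there. Inserting the sum of all \<open>\<rho> d\<close>, which is 1, and
  transferring the d-th term to chart \<open>d\<close> spreads it over all charts, as in the usual
  proof that the integral does not depend on the partition. Afterwards terms with different
  \<open>c\<close> can be added pointwise.\<close>

lemma pou_integral_reorganise:
  fixes \<Psi> :: "'a chart \<Rightarrow> 'a chart \<Rightarrow> real^3 \<Rightarrow> complex"
  assumes nat: "\<And>c. c \<in> active \<Longrightarrow> natural_density (\<Psi> c)"
    and cont: "\<And>c d. c \<in> active \<Longrightarrow> d \<in> \<A> \<Longrightarrow> continuous_on (cimg d) (\<Psi> c d)"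
    and zero: "\<And>c d z. c \<in> active \<Longrightarrow> d \<in> \<A> \<Longrightarrow> z \<in> cimg d \<Longrightarrow> cinv d z \<notin> supp c \<Longrightarrow> \<Psi> c d z = 0"
  shows "(\<Sum>c\<in>active. integral (cimg c) (\<Psi> c c)) = pou_integral (\<lambda>d z. \<Sum>c\<in>active. \<Psi> c d z)"
proof -
  have "integral (cimg c) (\<Psi> c c) =
      (\<Sum>d\<in>active. weighted d (\<lambda>z. \<Psi> c d z))" if c: "c \<in> active" for c
  proof -
    note cA = active_subset[OF c]
    have int: "(\<lambda>z. \<rho> d (cinv c z) *\<^sub>R \<Psi> c c z) absolutely_integrable_on cimg c" if d: "d \<in> active" for d
    proof (rule absolutely_integrable_supp[OF cA])
      show "continuous_on (cimg c) (\<lambda>z. \<rho> d (cinv c z) *\<^sub>R \<Psi> c c z)"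
        by (intro continuous_on_scaleR continuous_partition cA active_subset[OF d] cont c)
      show "\<rho> d (cinv c z) *\<^sub>R \<Psi> c c z = 0" if "z \<in> cimg c" "cinv c z \<notin> supp c" for z
        using zero[OF c cA that] by simp
    qed
    have "integral (cimg c) (\<Psi> c c) = integral (cimg c) (\<lambda>z. \<Sum>d\<in>active. \<rho> d (cinv c z) *\<^sub>R \<Psi> c c z)"
      by (rule integral_cong)
         (simp only: scaleR_left.sum[symmetric] sum_partition[OF cinv_topspace[OF cA]] scaleR_one)
    also have "\<dots> = (\<Sum>d\<in>active. integral (cimg c) (\<lambda>z. \<rho> d (cinv c z) *\<^sub>R \<Psi> c c z))"
      by (rule integral_sum[OF finite_active]) (rule set_lebesgue_integral_eq_integral(1)[OF int])
    also have "\<dots> = (\<Sum>d\<in>active. weighted d (\<lambda>z. \<Psi> c d z))"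
    proof (rule sum.cong[OF refl], rule integral_transfer)
      fix d assume d: "d \<in> active"
      note dA = active_subset[OF d]
      show "c \<in> \<A>" "d \<in> \<A>" by (fact cA dA)+
      show "(\<lambda>z. \<rho> d (cinv d z) *\<^sub>R \<Psi> c d z) absolutely_integrable_on cimg d"
        by (intro absolutely_integrable_partition dA cont c)
      show "\<rho> d (cinv c z) *\<^sub>R \<Psi> c c z =
          of_real (det (matrix (D_transition c d z))) *
          (\<rho> d (cinv d (transition c d z)) *\<^sub>R \<Psi> c d (transition c d z))" if "z \<in> overlap c d" for z
        using nat[OF c] cA dA that cinv_transition[OF cA dA that] unfolding natural_density_def by simp
      show "\<rho> d (cinv c z) *\<^sub>R \<Psi> c c z = 0" if "z \<in> cimg c" "z \<notin> overlap c d" for z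
      proof -
        have "cinv c z \<notin> supp d"
          using that overlap_iff[OF cA, of z d] supp_subset[OF dA] by (meson subsetD)
        then show ?thesis using partition_zero[OF cinv_topspace[OF cA that(1)]] by simp
      qed
      show "\<rho> d (cinv d z) *\<^sub>R \<Psi> c d z = 0" if "z \<in> cimg d" "z \<notin> overlap d c" for z
      proof -
        have "cinv d z \<notin> supp c"
          using that overlap_iff[OF dA, of z c] supp_subset[OF cA] by (meson subsetD)
        then show ?thesis using zero[OF c dA that(1)] by simp
      qed
    qed
    finally show ?thesis .
  qed
  then have "(\<Sum>c\<in>active. integral (cimg c) (\<Psi> c c)) =
      (\<Sum>c\<in>active. \<Sum>d\<in>active. weighted d (\<lambda>z. \<Psi> c d z))"
    by (rule sum.cong[OF refl])
  also have "\<dots> = (\<Sum>d\<in>active. \<Sum>c\<in>active. weighted d (\<lambda>z. \<Psi> c d z))"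
    by (rule sum.swap)
  also have "\<dots> = (\<Sum>d\<in>active. integral (cimg d) (\<lambda>z. \<Sum>c\<in>active. \<rho> d (cinv d z) *\<^sub>R \<Psi> c d z))"
  proof (rule sum.cong[OF refl], rule integral_sum[OF finite_active, symmetric])
    fix d c assume "d \<in> active" "c \<in> active"
    then show "(\<lambda>z. \<rho> d (cinv d z) *\<^sub>R \<Psi> c d z) integrable_on cimg d"
      by (intro set_lebesgue_integral_eq_integral(1) absolutely_integrable_partition cont active_subset)
  qed
  finally show ?thesis by (simp only: pou_integral_def scaleR_right.sum)
qed

section \<open>Differentials of the partition functions\<close>

definition dpart :: "'a chart \<Rightarrow> 'a chart \<Rightarrow> real^3 \<Rightarrow> real^3 \<Rightarrow> real" where
  "dpart c d z = frechet_derivative (\<rho> c \<circ> cinv d) (at z within cimg d)"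

lemma dpart_works:
  assumes "c \<in> \<A>" "d \<in> \<A>" "z \<in> cimg d"
  shows "((\<lambda>z. \<rho> c (cinv d z)) has_derivative dpart c d z) (at z within cimg d)"
proof -
  have "Ck_on (Suc 0) (cimg d) (\<rho> c \<circ> cinv d)"
    using smooth_partition[OF assms(1,2)] unfolding smooth_on_def by blast
  from Ck_on_SucD[OF this assms(3)] show ?thesis unfolding dpart_def comp_def .
qed

lemma continuous_dpart:
  assumes "c \<in> \<A>" "d \<in> \<A>"
  shows "continuous_on (cimg d) (\<lambda>z. dpart c d z v)"
proof -
  have "Ck_on (Suc 0) (cimg d) (\<rho> c \<circ> cinv d)"
    using smooth_partition[OF assms] unfolding smooth_on_def by blast
  then show ?thesis unfolding dpart_def Ck_on.simps by blast
qed

lemma dpart_natural: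
  assumes c: "c \<in> \<A>" and d: "d \<in> \<A>" and e: "e \<in> \<A>" and z: "z \<in> overlap d e"
  shows "dpart c d z = (\<lambda>v. dpart c e (transition d e z) (D_transition d e z v))"
proof -
  have zd: "z \<in> cimg d" and te: "transition d e z \<in> cimg e"
    using z overlap_subset transition_in[OF d e z] by (meson subsetD)+
  have 1: "((\<lambda>z. \<rho> c (cinv d z)) has_derivative dpart c d z) (at z within overlap d e)"
    by (rule has_derivative_subset[OF dpart_works[OF c d zd] overlap_subset])
  have "((\<lambda>y. \<rho> c (cinv e y)) has_derivative dpart c e (transition d e z))
      (at (transition d e z) within transition d e ` overlap d e)"
    using has_derivative_subset[OF dpart_works[OF c e te]] overlap_subset[of e d]
    unfolding transition_image[OF d e] by blast
  from has_derivative_in_compose[OF D_transition_works[OF d e z] this]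
  have "((\<lambda>y. \<rho> c (cinv e (transition d e y))) has_derivative
      (\<lambda>v. dpart c e (transition d e z) (D_transition d e z v))) (at z within overlap d e)" .
  then have 2: "((\<lambda>z. \<rho> c (cinv d z)) has_derivative
      (\<lambda>v. dpart c e (transition d e z) (D_transition d e z v))) (at z within overlap d e)"
    by (rule has_derivative_transform[OF z, rotated]) (simp add: cinv_transition[OF d e])
  show ?thesis
    using frechet_derivative_within_eq[OF axis_dense_overlap[OF d e] z 1]
      frechet_derivative_within_eq[OF axis_dense_overlap[OF d e] z 2] by simp
qed

lemma dpart_zero:
  assumes c: "c \<in> \<A>" and d: "d \<in> \<A>" and z: "z \<in> cimg d" "cinv d z \<notin> supp c"
  shows "dpart c d z v = 0"
proof -
  obtain U where U: "open U" "cmap d ` (cdom d \<inter> (topspace X - supp c)) = halfspace \<inter> U"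
    using open_cmap_image[OF d, of "topspace X - supp c"] closed_supp
    by (auto simp: openin_open closedin_def)
  have "cmap d (cinv d z) \<in> cmap d ` (cdom d \<inter> (topspace X - supp c))"
    using cinv_in[OF z(1)] cinv_topspace[OF d z(1)] z(2) by (intro imageI) simp
  then have zU: "z \<in> U" using U(2) cmap_cinv[OF z(1)] by simp
  have eq: "\<rho> c (cinv d y) = 0" if y: "y \<in> cimg d \<inter> U" for y
  proof -
    have "y \<in> cmap d ` (cdom d \<inter> (topspace X - supp c))"
      using y U(2) cimg_subset[OF d] by blast
    then obtain p where "p \<in> cdom d" "p \<in> topspace X" "p \<notin> supp c" "y = cmap d p" by blast
    then show ?thesis using cinv_cmap[OF d] partition_zero by simp
  qed
  have "((\<lambda>z. \<rho> c (cinv d z)) has_derivative (\<lambda>v. 0)) (at z within cimg d \<inter> U)"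
    by (rule has_derivative_transform[OF _ _ has_derivative_const[of 0]]) (use z zU eq in auto)
  then have "((\<lambda>z. \<rho> c (cinv d z)) has_derivative (\<lambda>v. 0)) (at z within cimg d)"
    unfolding at_within_Int_open[OF U(1) zU] .
  from frechet_derivative_within_eq[OF axis_dense_cimg[OF d] z(1) this]
  show ?thesis unfolding dpart_def comp_def by simp
qed

lemma sum_dpart:
  assumes d: "d \<in> \<A>" and z: "z \<in> cimg d"
  shows "(\<Sum>c\<in>active. dpart c d z v) = 0"
proof -
  have "((\<lambda>z. \<Sum>c\<in>active. \<rho> c (cinv d z)) has_derivative (\<lambda>v. \<Sum>c\<in>active. dpart c d z v)) (at z within cimg d)"
    by (rule has_derivative_sum) (rule dpart_works[OF active_subset d z])
  then have 1: "((\<lambda>z. 1) has_derivative (\<lambda>v. \<Sum>c\<in>active. dpart c d z v)) (at z within cimg d)"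
    by (rule has_derivative_transform[OF z, rotated]) (simp add: sum_partition[OF cinv_topspace[OF d]])
  have 2: "((\<lambda>z. 1::real) has_derivative (\<lambda>v. 0)) (at z within cimg d)" by simp
  have "(\<lambda>v. \<Sum>c\<in>active. dpart c d z v) = (\<lambda>v. 0)"
    using frechet_derivative_within_eq[OF axis_dense_cimg[OF d] z 1]
      frechet_derivative_within_eq[OF axis_dense_cimg[OF d] z 2] by simp
  then show ?thesis by (rule fun_cong)
qed

end

section \<open>The cutoff on the collar\<close>

lemma cis_2pi_eq_iff: "cis (2 * pi * s) = cis (2 * pi * t) \<longleftrightarrow> s - t \<in> \<int>"
proof
  assume "cis (2 * pi * s) = cis (2 * pi * t)"
  then obtain n :: int where "\<i> * of_real (2 * pi * s) = \<i> * of_real (2 * pi * t) + (of_int (2 * n) * pi) * \<i>"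
    unfolding cis_conv_exp exp_eq by blast
  then have "complex_of_real (2 * pi * s) = complex_of_real (2 * pi * t + 2 * pi * of_int n)"
    by (simp add: algebra_simps complex_eq_iff)
  then have "2 * pi * s = 2 * pi * t + 2 * pi * of_int n" by (simp only: of_real_eq_iff)
  then have "2 * pi * (s - t) = 2 * pi * of_int n" by (simp add: algebra_simps)
  then have "s - t = of_int n" by simp
  then show "s - t \<in> \<int>" by simp
next
  assume "s - t \<in> \<int>"
  then have "cis (2 * pi * (s - t)) = 1" by simp
  moreover have "cis (2 * pi * s) = cis (2 * pi * (s - t)) * cis (2 * pi * t)"
    by (simp add: cis_mult algebra_simps)
  ultimately show "cis (2 * pi * s) = cis (2 * pi * t)" by simp
qed

lemma closed_slab: "closed slab"
proof -
  have eq: "slab = {z. 0 \<le> z $ 3} \<inter> {z. z $ 3 \<le> 1}" by (auto simp: slab_def)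
  show ?thesis
    unfolding eq
    by (intro closed_Int closed_halfspace_component_le_cart closed_halfspace_component_ge_cart)
qed

text \<open>The third coordinate of the inverse of \<open>M\<close> applied to \<open>w\<close>,
  written with cofactors. The explicit formula makes continuity in the entries of \<open>M\<close>
  evident, which \<open>bounded_dcut\<close> needs.\<close>

definition third_row :: "real^3^3 \<Rightarrow> real^3 \<Rightarrow> real" where
  "third_row M w = ((M$2$1 * M$3$2 - M$2$2 * M$3$1) * w $ 1 + (M$1$2 * M$3$1 - M$1$1 * M$3$2) * w $ 2 +
     (M$1$1 * M$2$2 - M$1$2 * M$2$1) * w $ 3) / det M"

lemma third_row_mult:
  assumes "det M \<noteq> 0"
  shows "third_row M (M *v x) = x $ 3"
  using assms unfolding third_row_def
  by (simp add: field_simps) (simp add: det_3 matrix_vector_mult_def sum_3 algebra_simps)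

locale collar = atlas_partition +
  fixes \<kappa> :: "real^3 \<Rightarrow> 'a"
  assumes collar: "torus_collar X \<A> \<kappa>"
begin

lemma collar_continuous: "continuous_map (top_of_set slab) X \<kappa>"
  and collar_boundary: "\<kappa> ` {z. z $ 3 = 1} = manifold_boundary X \<A>"
  and collar_open: "openin X (\<kappa> ` {z. 0 < z $ 3 \<and> z $ 3 \<le> 1})"
  and smooth_collar: "c \<in> \<A> \<Longrightarrow> smooth_on (collar_part \<kappa> c) (cmap c \<circ> \<kappa>)"
  and det_collar: "c \<in> \<A> \<Longrightarrow> z \<in> collar_part \<kappa> c \<Longrightarrow> 0 < det (matrix (D_collar \<kappa> c z))"
  using collar unfolding torus_collar_def by blast+

lemma collar_eq_iff:
  assumes "z \<in> slab" "w \<in> slab"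
  shows "\<kappa> z = \<kappa> w \<longleftrightarrow> z $ 1 - w $ 1 \<in> \<int> \<and> z $ 2 - w $ 2 \<in> \<int> \<and> z $ 3 = w $ 3"
proof -
  have "\<kappa> z = \<kappa> w \<longleftrightarrow> cis (2 * pi * z $ 1) = cis (2 * pi * w $ 1) \<and>
        cis (2 * pi * z $ 2) = cis (2 * pi * w $ 2) \<and> z $ 3 = w $ 3"
    using collar assms unfolding torus_collar_def by blast
  then show ?thesis unfolding cis_2pi_eq_iff .
qed

lemma collar_topspace: "z \<in> slab \<Longrightarrow> \<kappa> z \<in> topspace X"
  using collar_continuous by (auto simp: continuous_map_def)

lemma collar_part_slab: "z \<in> collar_part \<kappa> c \<Longrightarrow> z \<in> slab"
  and collar_part_cdom: "z \<in> collar_part \<kappa> c \<Longrightarrow> \<kappa> z \<in> cdom c"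
  by (simp_all add: collar_part_def)

lemma collar_part_open: "c \<in> \<A> \<Longrightarrow> openin (top_of_set slab) (collar_part \<kappa> c)"
  using openin_continuous_map_preimage[OF collar_continuous cdom_open]
  by (simp add: collar_part_def)

lemma D_collar_works:
  assumes "c \<in> \<A>" "z \<in> collar_part \<kappa> c"
  shows "(cmap c \<circ> \<kappa> has_derivative D_collar \<kappa> c z) (at z within collar_part \<kappa> c)"
  using Ck_on_SucD[of 0 "collar_part \<kappa> c" "cmap c \<circ> \<kappa>" z] smooth_collar[OF assms(1)] assms(2)
  unfolding D_collar_def smooth_on_def by blast

lemma linear_D_collar: "c \<in> \<A> \<Longrightarrow> z \<in> collar_part \<kappa> c \<Longrightarrow> linear (D_collar \<kappa> c z)"
  using D_collar_works has_derivative_linear by blast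

lemma continuous_D_collar:
  assumes "c \<in> \<A>"
  shows "continuous_on (collar_part \<kappa> c) (\<lambda>z. D_collar \<kappa> c z v)"
proof -
  have "Ck_on (Suc 0) (collar_part \<kappa> c) (cmap c \<circ> \<kappa>)"
    using smooth_collar[OF assms] unfolding smooth_on_def by blast
  then show ?thesis unfolding D_collar_def Ck_on.simps by blast
qed

section \<open>Lattice representatives, closed layers and the radial coordinate of the
  collar\<close>

definition reduce :: "real^3 \<Rightarrow> real^3" where
  "reduce y = (\<chi> i. if i = 3 then y $ 3 else frac (y $ i))"

lemma reduce_nth: "reduce y $ 1 = frac (y $ 1)" "reduce y $ 2 = frac (y $ 2)" "reduce y $ 3 = y $ 3"
  by (simp_all add: reduce_def)

lemma reduce_slab: "y \<in> slab \<Longrightarrow> reduce y \<in> slab"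
  by (simp add: slab_def reduce_nth)

lemma collar_reduce: "y \<in> slab \<Longrightarrow> \<kappa> (reduce y) = \<kappa> y"
  by (subst collar_eq_iff[OF reduce_slab]) (simp_all add: reduce_nth frac_def)

definition layer :: "real \<Rightarrow> real \<Rightarrow> 'a set" where
  "layer l u = \<kappa> ` {y. l \<le> y $ 3 \<and> y $ 3 \<le> u}"

definition block :: "real \<Rightarrow> real \<Rightarrow> (real^3) set" where
  "block l u = {y. 0 \<le> y $ 1 \<and> y $ 1 \<le> 1 \<and> 0 \<le> y $ 2 \<and> y $ 2 \<le> 1 \<and> l \<le> y $ 3 \<and> y $ 3 \<le> u}"

lemma compact_block: "compact (block l u)"
proof -
  have "block l u = cbox (vector [0, 0, l]) (vector [1, 1, u])"
    by (auto simp: block_def mem_box_cart forall_3)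
  then show ?thesis by simp
qed

lemma block_slab: "0 \<le> l \<Longrightarrow> u \<le> 1 \<Longrightarrow> block l u \<subseteq> slab"
  by (auto simp: block_def slab_def)

lemma reduce_block:
  assumes "l \<le> y $ 3" "y $ 3 \<le> u"
  shows "reduce y \<in> block l u"
  using assms frac_lt_1[of "y $ 1"] frac_lt_1[of "y $ 2"] by (simp add: block_def reduce_nth less_imp_le)

text \<open>Reduction modulo the lattice shows that the layer is already the image of a compact
  block, and compact sets are closed in a Hausdorff space.\<close>

lemma closed_layer:
  assumes "0 \<le> l" "u \<le> 1"
  shows "closedin X (layer l u)"
proof -
  have "layer l u = \<kappa> ` block l u"
  proof
    show "layer l u \<subseteq> \<kappa> ` block l u"
    proof
      fix p assume "p \<in> layer l u"
      then obtain y where y: "l \<le> y $ 3" "y $ 3 \<le> u" "p = \<kappa> y" unfolding layer_def by blast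
      then have "y \<in> slab" using assms by (simp add: slab_def)
      then show "p \<in> \<kappa> ` block l u"
        using imageI[OF reduce_block[OF y(1,2)], of \<kappa>] collar_reduce y(3) by simp
    qed
    show "\<kappa> ` block l u \<subseteq> layer l u" unfolding layer_def block_def by blast
  qed
  moreover have "compactin (top_of_set slab) (block l u)"
    using compact_block block_slab[OF assms] by (simp add: compactin_subtopology)
  ultimately have "compactin X (layer l u)"
    using image_compactin[OF _ collar_continuous] by simp
  then show ?thesis by (rule compactin_imp_closedin[OF Hausdorff])
qed

text \<open>The collar coordinate r. The choice is harmless, since points of the slab with the same
  image under \<open>\<kappa>\<close> have equal third coordinate.\<close>

definition level :: "'a \<Rightarrow> real" where
  "level p = (SOME r. \<exists>y\<in>slab. \<kappa> y = p \<and> y $ 3 = r)"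

lemma level_collar:
  assumes y: "y \<in> slab"
  shows "level (\<kappa> y) = y $ 3"
  unfolding level_def
proof (rule some_equality)
  show "\<exists>w\<in>slab. \<kappa> w = \<kappa> y \<and> w $ 3 = y $ 3" using y by blast
  show "r = y $ 3" if "\<exists>w\<in>slab. \<kappa> w = \<kappa> y \<and> w $ 3 = r" for r
    using that collar_eq_iff[OF _ y] by blast
qed

text \<open>Otherwise a transition map would violate invariance of domain.\<close>

lemma not_boundary:
  assumes c: "c \<in> \<A>" and z: "z \<in> cimg c" "z $ 3 < 0"
  shows "cinv c z \<notin> manifold_boundary X \<A>"
proof
  assume "cinv c z \<in> manifold_boundary X \<A>"
  then obtain d where d: "d \<in> \<A>" "cinv c z \<in> cdom d" "cmap d (cinv c z) $ 3 = 0"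
    unfolding manifold_boundary_def by blast
  obtain U where U: "open U" "overlap c d = halfspace \<inter> U"
    using overlap_open[OF c d(1)] by (auto simp: openin_open)
  define S where "S = overlap c d \<inter> {z. z $ 3 < 0}"
  have "S = U \<inter> {z. z $ 3 < 0}" unfolding S_def U(2) by (auto simp: halfspace_def)
  then have "open S"
    using U(1) by (simp add: open_Int open_halfspace_component_lt_cart)
  have "Ck_on 0 (overlap c d) (transition c d)"
    using smooth_transition[OF c d(1)] unfolding smooth_on_def by blast
  then have "continuous_on S (transition c d)"
    unfolding S_def Ck_on.simps by (rule continuous_on_subset) blast
  moreover have "inj_on (transition c d) S"
    by (rule inj_on_inverseI[of _ "transition d c"]) (simp add: S_def transition_inverse[OF c d(1)])
  ultimately have "open (transition c d ` S)"
    using invariance_of_domain \<open>open S\<close> by blast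
  moreover have "z \<in> S" using z d(2) overlap_iff[OF c] by (simp add: S_def)
  ultimately obtain e where e: "e > 0" "ball (transition c d z) e \<subseteq> transition c d ` S"
    using open_contains_ball by blast
  \<comment> \<open>A point on the outer side of the boundary plane, yet so close to it that it
    stays in the open image.\<close>
  define w where "w = transition c d z + (e/2) *\<^sub>R axis 3 1"
  have "w \<in> ball (transition c d z) e"
    using e by (simp add: w_def dist_norm)
  then have "w \<in> overlap d c"
    using e(2) transition_image[OF c d(1)] unfolding S_def by blast
  then have "w \<in> halfspace" using overlap_subset cimg_subset[OF d(1)] by blast
  moreover have "w $ 3 = e/2"
    using d(3) by (simp add: w_def transition_def)
  ultimately show False using e(1) by (simp add: halfspace_def)
qed

end

section \<open>The cutoff on the manifold and its differential in charts\<close>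

locale collar_cutoff = collar +
  fixes lo hi :: real and h h' :: "real \<Rightarrow> real"
  assumes lo_hi: "0 < lo" "lo < hi" "hi < 1"
    and h_deriv: "\<And>r. (h has_field_derivative h' r) (at r)" and h'_cont: "continuous_on UNIV h'"
    and h_0: "\<And>r. r \<le> lo \<Longrightarrow> h r = 0" and h_1: "\<And>r. hi \<le> r \<Longrightarrow> h r = 1"
    and h'_pos: "\<And>r. lo < r \<Longrightarrow> r < hi \<Longrightarrow> 0 < h' r"
    and h'_0: "\<And>r. r \<le> lo \<or> hi \<le> r \<Longrightarrow> h' r = 0"
begin

text \<open>Extension by 0 beyond the collar does no harm because \<open>h\<close> vanishes up to
  \<open>lo > 0\<close>; \<open>hi < 1\<close> makes the cutoff constant in a neighbourhood of the
  boundary.\<close>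

definition cutoff :: "'a \<Rightarrow> real" where
  "cutoff p = (if p \<in> \<kappa> ` slab then h (level p) else 0)"

lemma cutoff_collar: "y \<in> slab \<Longrightarrow> cutoff (\<kappa> y) = h (y $ 3)"
  by (simp add: cutoff_def level_collar)

lemma cutoff_nonzero:
  assumes "cutoff p \<noteq> 0"
  obtains y where "y \<in> slab" "p = \<kappa> y" "lo < y $ 3"
proof -
  obtain y where y: "y \<in> slab" "p = \<kappa> y" using assms by (auto simp: cutoff_def split: if_splits)
  then have "lo < y $ 3" using assms h_0[of "y $ 3"] by (force simp: cutoff_collar)
  then show ?thesis using that y by blast
qed

lemma interior_open:
  assumes "c \<in> \<A>"
  shows "open (cimg c \<inter> {z. z $ 3 < 0})"
proof -
  obtain U where U: "open U" "cimg c = halfspace \<inter> U"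
    using cimg_open[OF assms] by (auto simp: openin_open)
  have "cimg c \<inter> {z. z $ 3 < 0} = U \<inter> {z. z $ 3 < 0}"
    unfolding U(2) by (auto simp: halfspace_def)
  then show ?thesis using U(1) by (simp add: open_Int open_halfspace_component_lt_cart)
qed

lemma collar_interior:
  assumes c: "c \<in> \<A>" and y: "y \<in> collar_part \<kappa> c" "y $ 3 < 1"
  shows "cmap c (\<kappa> y) $ 3 < 0"
proof -
  have "cmap c (\<kappa> y) \<in> halfspace"
    using cimg_subset[OF c] collar_part_cdom[OF y(1)] by blast
  moreover have "cmap c (\<kappa> y) $ 3 \<noteq> 0"
  proof
    assume "cmap c (\<kappa> y) $ 3 = 0"
    then have "\<kappa> y \<in> manifold_boundary X \<A>"
      using c collar_part_cdom[OF y(1)] cdom_subset[OF c] unfolding manifold_boundary_def by blast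
    then obtain w where w: "w $ 3 = 1" "\<kappa> y = \<kappa> w" using collar_boundary by blast
    then have "y $ 3 = w $ 3"
      using collar_eq_iff[OF collar_part_slab[OF y(1)], of w] by (simp add: slab_def)
    then show False using y(2) w(1) by simp
  qed
  ultimately show ?thesis by (simp add: halfspace_def)
qed

text \<open>On a small ball \<open>\<kappa>\<close> is injective, so the collar coordinates in the
  chart have a differentiable local inverse, and the cutoff is \<open>h\<close> of its third
  component. Its differential is therefore \<open>h'\<close> times the third row of the inverse
  Jacobian.\<close>

lemma cutoff_derivative:
  assumes c: "c \<in> \<A>" and y: "y \<in> collar_part \<kappa> c" "0 < y $ 3" "y $ 3 < 1"
  shows "((\<lambda>z. cutoff (cinv c z)) has_derivative
    (\<lambda>v. h' (y $ 3) * third_row (matrix (D_collar \<kappa> c y)) v)) (at (cmap c (\<kappa> y)))"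
proof -
  define f where "f = cmap c \<circ> \<kappa>"
  obtain V where V: "open V" "collar_part \<kappa> c = slab \<inter> V"
    using collar_part_open[OF c] by (auto simp: openin_open)
  \<comment> \<open>Coordinates of two points in a ball of radius 1/2 differ by less than 1, so
    differences that are integers vanish. The strict bounds on the third coordinate make
    \<open>S\<close> open.\<close>
  define S where "S = ball y (1/2) \<inter> V \<inter> {w. 0 < w $ 3} \<inter> {w. w $ 3 < 1}"
  have S: "open S"
    unfolding S_def using V(1)
    by (intro open_Int open_ball open_halfspace_component_lt_cart open_halfspace_component_gt_cart)
  have S_slab: "S \<subseteq> slab" by (auto simp: S_def slab_def)
  then have S_part: "S \<subseteq> collar_part \<kappa> c" unfolding V(2) S_def by blast
  have yS: "y \<in> S" using y V(2) by (simp add: S_def)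
  have inj: "inj_on f S"
  proof (rule inj_onI)
    fix v w assume vw: "v \<in> S" "w \<in> S" "f v = f w"
    have "\<kappa> v \<in> cdom c" "\<kappa> w \<in> cdom c" using S_part vw(1,2) collar_part_cdom by blast+
    then have "\<kappa> v = \<kappa> w"
      using vw(3) inj_onD[OF inj_cmap[OF c]] unfolding f_def comp_def by blast
    then have vw': "v $ 1 - w $ 1 \<in> \<int>" "v $ 2 - w $ 2 \<in> \<int>" "v $ 3 = w $ 3"
      using collar_eq_iff[of v w] S_slab vw(1,2) by blast+
    have small: "\<bar>v $ i - w $ i\<bar> < 1" for i
    proof -
      have "dist v w < 1"
        using vw(1,2) dist_triangle_half_l[of v y 1 w] by (simp add: S_def dist_commute)
      then show ?thesis
        using component_le_norm_cart[of "v - w" i] by (simp add: dist_norm)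
    qed
    have "v $ 1 - w $ 1 = 0" "v $ 2 - w $ 2 = 0"
      using vw'(1,2) small[of 1] small[of 2] Ints_nonzero_abs_less1 by blast+
    then show "v = w" using vw'(3) by (simp add: vec_eq_iff forall_3)
  qed
  have cont: "continuous_on S f"
    using has_derivative_continuous_on[OF D_collar_works[OF c]] S_part
    unfolding f_def by (rule continuous_on_subset)
  have fS: "open (f ` S)" by (rule invariance_of_domain[OF cont S inj])
  define M where "M = matrix (D_collar \<kappa> c y)"
  have M: "D_collar \<kappa> c y = (*v) M"
    unfolding M_def using matrix_vector_mul(2)[OF linear_D_collar[OF c y(1)]] by simp
  have det: "det M \<noteq> 0" using det_collar[OF c y(1)] by (simp add: M_def)
  then obtain N where inv: "M ** N = mat 1"
    using invertible_det_nz[of M] unfolding invertible_def by blast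
  have derM: "(f has_derivative (*v) M) (at y)"
    using has_derivative_subset[OF D_collar_works[OF c y(1)] S_part] at_within_open[OF yS S]
    unfolding M f_def by simp
  have "(inv_into S f has_derivative (*v) N) (at (f y))"
  proof (rule has_derivative_inverse_strong[OF S yS cont inv_into_f_f[OF inj] derM])
    show "(*v) M \<circ> (*v) N = id"
      by (rule ext) (simp add: matrix_vector_mul_assoc inv)
  qed
  then have "((\<lambda>z. inv_into S f z $ 3) has_derivative (\<lambda>v. (N *v v) $ 3)) (at (f y))"
    by (rule bounded_linear.has_derivative[OF bounded_linear_vec_nth])
  moreover have "(h has_derivative (*) (h' (y $ 3))) (at (inv_into S f (f y) $ 3))"
    using h_deriv[of "y $ 3"] inv_into_f_f[OF inj yS] by (simp add: has_field_derivative_def)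
  ultimately have "((\<lambda>z. h (inv_into S f z $ 3)) has_derivative (\<lambda>v. h' (y $ 3) * (N *v v) $ 3)) (at (f y))"
    by (rule has_derivative_compose)
  then have "((\<lambda>z. cutoff (cinv c z)) has_derivative (\<lambda>v. h' (y $ 3) * (N *v v) $ 3)) (at (f y))"
  proof (rule has_derivative_transform_within_open[OF _ fS imageI[OF yS]])
    fix z assume "z \<in> f ` S"
    then obtain w where w: "w \<in> S" "z = f w" by blast
    have "w \<in> slab" "\<kappa> w \<in> cdom c" using w(1) S_slab S_part collar_part_cdom by blast+
    then show "h (inv_into S f z $ 3) = cutoff (cinv c z)"
      using inv_into_f_f[OF inj w(1)] cinv_cmap[OF c] w(2) by (simp add: f_def cutoff_collar)
  qed
  moreover have "(N *v v) $ 3 = third_row M v" for v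
    using third_row_mult[OF det, of "N *v v"] by (simp add: matrix_vector_mul_assoc inv)
  ultimately show ?thesis by (simp add: f_def M_def)
qed

text \<open>The point avoids \<open>layer lo 1\<close>: the part with r < 1 by assumption, the part
  with r = 1 by \<open>not_boundary\<close>. The complement of the layer is open, and the cutoff is
  0 on it.\<close>

lemma cutoff_derivative_zero:
  assumes c: "c \<in> \<A>" and z: "z \<in> cimg c" "z $ 3 < 0"
    and nc: "\<And>y. 0 < y $ 3 \<Longrightarrow> y $ 3 < 1 \<Longrightarrow> cinv c z \<noteq> \<kappa> y"
  shows "((\<lambda>z. cutoff (cinv c z)) has_derivative (\<lambda>v. 0)) (at z)"
proof -
  have nl: "cinv c z \<notin> layer lo 1"
  proof
    assume "cinv c z \<in> layer lo 1"
    then obtain y where y: "lo \<le> y $ 3" "y $ 3 \<le> 1" "cinv c z = \<kappa> y" unfolding layer_def by blast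
    then have "y $ 3 = 1" using nc[of y] lo_hi by linarith
    then have "cinv c z \<in> manifold_boundary X \<A>" using y(3) collar_boundary by blast
    then show False using not_boundary[OF c z] by blast
  qed
  have "openin X (topspace X - layer lo 1)"
    using closed_layer[of lo 1] lo_hi by (simp add: closedin_def)
  then obtain U where U: "open U" "cmap c ` (cdom c \<inter> (topspace X - layer lo 1)) = halfspace \<inter> U"
    using open_cmap_image[OF c] by (auto simp: openin_open)
  have "cmap c (cinv c z) \<in> cmap c ` (cdom c \<inter> (topspace X - layer lo 1))"
    using cinv_in[OF z(1)] cinv_topspace[OF c z(1)] nl by (intro imageI) simp
  then have zU: "z \<in> U" using U(2) cmap_cinv[OF z(1)] by simp
  have "((\<lambda>z. 0::real) has_derivative (\<lambda>v. 0)) (at z)" by simp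
  then show ?thesis
  proof (rule has_derivative_transform_within_open)
    show "open (U \<inter> {z. z $ 3 < 0})"
      using U(1) by (simp add: open_Int open_halfspace_component_lt_cart)
    show "z \<in> U \<inter> {z. z $ 3 < 0}" using zU z(2) by simp
    fix w assume "w \<in> U \<inter> {z. z $ 3 < 0}"
    then have "w \<in> cmap c ` (cdom c \<inter> (topspace X - layer lo 1))"
      unfolding U(2) by (simp add: halfspace_def less_imp_le)
    then obtain p where p: "p \<in> cdom c" "p \<notin> layer lo 1" "w = cmap c p" by blast
    have "cutoff p = 0"
    proof (rule ccontr)
      assume "cutoff p \<noteq> 0"
      then obtain y where "y \<in> slab" "p = \<kappa> y" "lo < y $ 3" by (rule cutoff_nonzero)
      then have "p \<in> layer lo 1" unfolding layer_def slab_def by (simp add: less_imp_le)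
      then show False using p(2) by blast
    qed
    then show "0 = cutoff (cinv c w)" using p cinv_cmap[OF c] by simp
  qed
qed

lemma boundary_point:
  assumes c: "c \<in> \<A>" and z: "z \<in> cimg c" "z $ 3 = 0"
  obtains y where "y $ 3 = 1" "cinv c z = \<kappa> y"
proof -
  have "cinv c z \<in> manifold_boundary X \<A>"
    using c z cinv_in[OF z(1)] cinv_topspace[OF c z(1)] cmap_cinv[OF z(1)]
    unfolding manifold_boundary_def by force
  then show ?thesis using collar_boundary that by blast
qed

text \<open>\<open>V\<close>, the outer part of the collar with r > \<open>hi\<close>, is open as
  the difference of an open and a closed set, and the cutoff is 1 on it.\<close>

lemma cutoff_near_boundary:
  assumes c: "c \<in> \<A>" and z: "z \<in> cimg c" "z $ 3 = 0"
  obtains U where "open U" "z \<in> U" "\<And>w. w \<in> cimg c \<Longrightarrow> w \<in> U \<Longrightarrow> cutoff (cinv c w) = 1"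
proof -
  define V where "V = \<kappa> ` {z. 0 < z $ 3 \<and> z $ 3 \<le> 1} - layer 0 hi"
  have "openin X V"
    unfolding V_def by (intro openin_diff collar_open closed_layer) (use lo_hi in auto)
  then obtain U where U: "open U" "cmap c ` (cdom c \<inter> V) = halfspace \<inter> U"
    using open_cmap_image[OF c] by (auto simp: openin_open)
  obtain y where y: "y $ 3 = 1" "cinv c z = \<kappa> y" by (rule boundary_point[OF c z])
  have "\<kappa> y \<notin> layer 0 hi"
  proof
    assume "\<kappa> y \<in> layer 0 hi"
    then obtain w where w: "0 \<le> w $ 3" "w $ 3 \<le> hi" "\<kappa> y = \<kappa> w" unfolding layer_def by blast
    then have "y $ 3 = w $ 3"
      using collar_eq_iff[of y w] y(1) lo_hi by (simp add: slab_def)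
    then show False using y(1) w(2) lo_hi by simp
  qed
  then have "cinv c z \<in> V" unfolding V_def y(2) using y(1) by simp
  then have "cmap c (cinv c z) \<in> cmap c ` (cdom c \<inter> V)"
    using cinv_in[OF z(1)] by blast
  then have "z \<in> U" using U(2) cmap_cinv[OF z(1)] by simp
  moreover have "cutoff (cinv c w) = 1" if w: "w \<in> cimg c" "w \<in> U" for w
  proof -
    have "w \<in> cmap c ` (cdom c \<inter> V)" using w U(2) cimg_subset[OF c] by blast
    then obtain p where p: "p \<in> cdom c" "p \<in> V" "w = cmap c p" by blast
    then obtain y where y: "0 < y $ 3" "y $ 3 \<le> 1" "p = \<kappa> y" unfolding V_def by blast
    have "hi < y $ 3"
    proof (rule ccontr)
      assume "\<not> hi < y $ 3"
      then have "p \<in> layer 0 hi" unfolding layer_def using y by force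
      then show False using p(2) V_def by blast
    qed
    moreover have "y \<in> slab" using y by (simp add: slab_def)
    ultimately show ?thesis
      using p y cinv_cmap[OF c] by (simp add: cutoff_collar h_1)
  qed
  ultimately show ?thesis using that U(1) by blast
qed

text \<open>At points with \<open>z $ 3 = 0\<close> the cutoff is locally constant 1 in the chart,
  so 0 is the right value there; at interior points the full derivative \<open>at z\<close> is
  available.\<close>

definition dcut :: "'a chart \<Rightarrow> real^3 \<Rightarrow> real^3 \<Rightarrow> real" where
  "dcut c z = (if z $ 3 < 0 then frechet_derivative (\<lambda>z. cutoff (cinv c z)) (at z) else (\<lambda>v. 0))"

lemma cutoff_cases:
  assumes c: "c \<in> \<A>" and z: "z \<in> cimg c" "z $ 3 < 0"
  obtains (collar) y where "y \<in> collar_part \<kappa> c" "y \<in> unit_cell" "y $ 3 < 1" "z = cmap c (\<kappa> y)"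
    | (outside) "\<And>y. 0 < y $ 3 \<Longrightarrow> y $ 3 < 1 \<Longrightarrow> cinv c z \<noteq> \<kappa> y"
proof (cases "\<exists>y. 0 < y $ 3 \<and> y $ 3 < 1 \<and> cinv c z = \<kappa> y")
  case True
  then obtain y where y: "0 < y $ 3" "y $ 3 < 1" "cinv c z = \<kappa> y" by blast
  then have ys: "y \<in> slab" by (simp add: slab_def)
  have "\<kappa> (reduce y) \<in> cdom c"
    using collar_reduce[OF ys] y(3) cinv_in[OF z(1)] by simp
  moreover have "z = cmap c (\<kappa> (reduce y))"
    using collar_reduce[OF ys] y(3) cmap_cinv[OF z(1)] by simp
  moreover have "reduce y \<in> unit_cell"
    using y by (simp add: unit_cell_def reduce_nth frac_lt_1)
  ultimately show ?thesis
    using collar[of "reduce y"] reduce_slab[OF ys] y by (simp add: collar_part_def reduce_nth)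
next
  case False
  then show ?thesis using outside by blast
qed

lemma dcut_collar:
  assumes c: "c \<in> \<A>" and y: "y \<in> collar_part \<kappa> c" "0 < y $ 3" "y $ 3 < 1"
  shows "dcut c (cmap c (\<kappa> y)) = (\<lambda>v. h' (y $ 3) * third_row (matrix (D_collar \<kappa> c y)) v)"
  using frechet_derivative_at[OF cutoff_derivative[OF assms]] collar_interior[OF c y(1,3)]
  by (simp add: dcut_def)

lemma dcut_outside:
  assumes c: "c \<in> \<A>" and z: "z \<in> cimg c" "z $ 3 < 0"
    and nc: "\<And>y. 0 < y $ 3 \<Longrightarrow> y $ 3 < 1 \<Longrightarrow> cinv c z \<noteq> \<kappa> y"
  shows "dcut c z = (\<lambda>v. 0)"
  using frechet_derivative_at[OF cutoff_derivative_zero[OF assms]] z(2)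
  by (simp add: dcut_def)

lemma dcut_works:
  assumes c: "c \<in> \<A>" and z: "z \<in> cimg c" "z $ 3 < 0"
  shows "((\<lambda>z. cutoff (cinv c z)) has_derivative dcut c z) (at z)"
  using c z
proof (cases rule: cutoff_cases)
  case (collar y)
  then have "0 < y $ 3" by (simp add: unit_cell_def)
  with collar show ?thesis using cutoff_derivative[OF c, of y] dcut_collar[OF c, of y] by simp
next
  case outside
  then show ?thesis using cutoff_derivative_zero[OF c z] dcut_outside[OF c z] by simp
qed

text \<open>The third row of the inverse Jacobian cancels against the Jacobian: in collar
  coordinates the differential of the cutoff is h'(r) dr.\<close>

lemma dcut_collar_D:
  assumes c: "c \<in> \<A>" and y: "y \<in> collar_part \<kappa> c" "0 < y $ 3" "y $ 3 < 1"
  shows "dcut c (cmap c (\<kappa> y)) (D_collar \<kappa> c y v) = h' (y $ 3) * v $ 3"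
proof -
  have "D_collar \<kappa> c y v = matrix (D_collar \<kappa> c y) *v v"
    using matrix_vector_mul(2)[OF linear_D_collar[OF c y(1)]] by (rule fun_cong[OF sym])
  then show ?thesis
    using third_row_mult[of "matrix (D_collar \<kappa> c y)" v] det_collar[OF c y(1)]
    unfolding dcut_collar[OF assms] by simp
qed

lemma continuous_cutoff:
  assumes c: "c \<in> \<A>"
  shows "continuous_on (cimg c) (\<lambda>z. cutoff (cinv c z))"
  unfolding continuous_on_eq_continuous_within
proof
  fix z assume z: "z \<in> cimg c"
  then have "z $ 3 \<le> 0" using cimg_subset[OF c] by (auto simp: halfspace_def)
  then consider "z $ 3 < 0" | "z $ 3 = 0" by linarith
  then show "continuous (at z within cimg c) (\<lambda>z. cutoff (cinv c z))"
  proof cases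
    case 1
    then show ?thesis
      using has_derivative_continuous[OF dcut_works[OF c z]] continuous_at_imp_continuous_at_within by blast
  next
    case 2
    obtain U where U: "open U" "z \<in> U" "\<And>w. w \<in> cimg c \<Longrightarrow> w \<in> U \<Longrightarrow> cutoff (cinv c w) = 1"
      using cutoff_near_boundary[OF c z 2] by blast
    have "continuous_on (cimg c \<inter> U) (\<lambda>z. cutoff (cinv c z))"
      by (rule continuous_on_eq[OF continuous_on_const[of _ 1]]) (simp add: U(3))
    then have "continuous (at z within cimg c \<inter> U) (\<lambda>z. cutoff (cinv c z))"
      using z U(2) unfolding continuous_on_eq_continuous_within by blast
    then show ?thesis unfolding at_within_Int_open[OF U(1,2)] .
  qed
qed

text \<open>\<open>h'\<close> vanishes outside the interval from \<open>lo\<close> to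
  \<open>hi\<close>, and each collar point in that range has a representative in the compact
  \<open>block lo hi\<close>. So all nonzero values on \<open>csupp c\<close> are values of one
  continuous function on the compact set \<open>Z\<close>.\<close>

lemma bounded_dcut:
  assumes c: "c \<in> \<A>"
  obtains B where "\<And>z. z \<in> csupp c \<Longrightarrow> \<bar>dcut c z v\<bar> \<le> B"
proof -
  define q where "q y = h' (y $ 3) * third_row (matrix (D_collar \<kappa> c y)) v" for y
  define Z where "Z = {y \<in> block lo hi. \<kappa> y \<in> supp c}"
  have Z_part: "Z \<subseteq> collar_part \<kappa> c"
    using block_slab[of lo hi] lo_hi supp_subset[OF c] by (auto simp: Z_def collar_part_def)
  have "closedin (top_of_set slab) {y \<in> topspace (top_of_set slab). \<kappa> y \<in> supp c}"
    by (rule closedin_continuous_map_preimage[OF collar_continuous closed_supp])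
  then have "closed {y \<in> slab. \<kappa> y \<in> supp c}"
    using closed_slab closedin_closed_trans by simp
  moreover have "Z = block lo hi \<inter> {y \<in> slab. \<kappa> y \<in> supp c}"
    using block_slab[of lo hi] lo_hi by (auto simp: Z_def)
  ultimately have Z: "compact Z" using compact_Int_closed[OF compact_block] by simp
  have "continuous_on (collar_part \<kappa> c) q"
  proof -
    have D: "continuous_on (collar_part \<kappa> c) (\<lambda>y. D_collar \<kappa> c y (axis j 1) $ i)" for i j
      by (intro continuous_on_component continuous_D_collar c)
    have nz: "det (\<chi> i j. D_collar \<kappa> c y (axis j 1) $ i) \<noteq> 0" if "y \<in> collar_part \<kappa> c" for y
      using det_collar[OF c that] by (simp add: matrix_def)
    have h: "continuous_on (collar_part \<kappa> c) (\<lambda>y. h' (y $ 3))"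
      by (rule continuous_on_compose2[OF h'_cont]) (auto intro: continuous_intros)
    show ?thesis
      unfolding q_def third_row_def matrix_def
      by (intro continuous_on_mult h continuous_on_divide)
         (use nz in \<open>auto simp: det_3 intro!: continuous_intros D\<close>)
  qed
  then have "compact (q ` Z)"
    using Z Z_part compact_continuous_image continuous_on_subset by blast
  then obtain B where B: "\<And>x. x \<in> q ` Z \<Longrightarrow> norm x \<le> B"
    using compact_imp_bounded bounded_iff by metis
  have "\<bar>dcut c z v\<bar> \<le> max B 0" if z: "z \<in> csupp c" for z
  proof (cases "z $ 3 < 0")
    case True
    have zc: "z \<in> cimg c" using z csupp_subset[OF c] by blast
    from c zc True show ?thesis
    proof (cases rule: cutoff_cases)
      case (collar y)
      then have y0: "0 < y $ 3" by (simp add: unit_cell_def)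
      have eq: "dcut c z v = q y"
        using dcut_collar[OF c collar(1) y0 collar(3)] collar(4) by (simp add: q_def)
      show ?thesis
      proof (cases "lo \<le> y $ 3 \<and> y $ 3 \<le> hi")
        case True
        have "cinv c z = \<kappa> y" using collar(4) cinv_cmap[OF c collar_part_cdom[OF collar(1)]] by simp
        then have "\<kappa> y \<in> supp c" using z csupp_iff[OF c zc] by simp
        then have "y \<in> Z" using True collar(2) by (simp add: Z_def block_def unit_cell_def)
        then show ?thesis using B[of "q y"] eq by auto
      next
        case False
        then have "q y = 0" unfolding q_def using h'_0[of "y $ 3"] by auto
        then show ?thesis using eq by simp
      qed
    next
      case outside
      then show ?thesis using dcut_outside[OF c zc True] by simp
    qed
  qed (simp add: dcut_def)
  then show ?thesis using that by blast
qed

end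

section \<open>Stokes' theorem for a pair of flat connections\<close>

text \<open>One third of tr (b^3 - a^3 - (b - a)^3) on the standard basis, hence the coefficient of
  d tr (a \<and> b) when both forms are flat.\<close>

definition cubic_defect :: "'a mform1 \<Rightarrow> 'a mform1 \<Rightarrow> 'a chart \<Rightarrow> real^3 \<Rightarrow> complex" where
  "cubic_defect a b c z = cubic (b c z) - cubic (a c z) - cubic (\<lambda>v. b c z v - a c z v)"

definition dform :: "'a mform1 \<Rightarrow> 'a chart \<Rightarrow> real^3 \<Rightarrow> real^3 \<Rightarrow> real^3 \<Rightarrow> cmat" where
  "dform a c v z = frechet_derivative (\<lambda>x. a c x v) (at z within cimg c)"

text \<open>The derivative of tr (a \<and> b) (u, v) at \<open>z\<close> in direction
  \<open>e\<close>, by the product rule.\<close>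

definition dwtrace ::
  "'a mform1 \<Rightarrow> 'a mform1 \<Rightarrow> 'a chart \<Rightarrow> real^3 \<Rightarrow> real^3 \<Rightarrow> real^3 \<Rightarrow> real^3 \<Rightarrow> complex" where
  "dwtrace a b c u v z e =
     (trace (a c z u ** dform b c v z e) + trace (dform a c u z e ** b c z v)) -
     (trace (a c z v ** dform b c u z e) + trace (dform a c v z e ** b c z u))"

lemma product_bounded:
  fixes f :: "real^3 \<Rightarrow> real" and g :: "real^3 \<Rightarrow> complex"
  assumes "\<exists>B. \<forall>z\<in>K. \<bar>f z\<bar> \<le> B" "\<exists>B. \<forall>z\<in>K. norm (g z) \<le> B"
  shows "\<exists>B. \<forall>z\<in>K. norm (f z *\<^sub>R g z) \<le> B"
proof -
  obtain B1 B2 where B: "\<And>z. z \<in> K \<Longrightarrow> \<bar>f z\<bar> \<le> B1" "\<And>z. z \<in> K \<Longrightarrow> norm (g z) \<le> B2"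
    using assms by blast
  have "norm (f z *\<^sub>R g z) \<le> B1 * B2" if "z \<in> K" for z
    using mult_mono[OF B(1)[OF that] B(2)[OF that]] B(1)[OF that] by (simp add: order_trans[OF abs_ge_zero])
  then show ?thesis by blast
qed

context atlas_partition
begin

lemma continuous_bounded_csupp:
  fixes f :: "real^3 \<Rightarrow> 'b::real_normed_vector"
  assumes "c \<in> \<A>" "continuous_on (cimg c) f"
  shows "\<exists>B. \<forall>z\<in>csupp c. norm (f z) \<le> B"
proof -
  have "compact (f ` csupp c)"
    using compact_continuous_image[OF continuous_on_subset[OF assms(2) csupp_subset[OF assms(1)]]
        compact_csupp[OF assms(1)]] .
  then obtain B where "\<forall>x\<in>f ` csupp c. norm x \<le> B"
    using compact_imp_bounded bounded_iff by blast
  then show ?thesis by blast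
qed

end

context atlas
begin

lemma form_linear: "flat_connection \<A> a \<Longrightarrow> c \<in> \<A> \<Longrightarrow> z \<in> cimg c \<Longrightarrow> linear (a c z)"
  unfolding flat_connection_def u21_form_def by blast

lemma form_smooth: "flat_connection \<A> a \<Longrightarrow> c \<in> \<A> \<Longrightarrow> smooth_on (cimg c) (\<lambda>z. a c z v)"
  unfolding flat_connection_def u21_form_def by blast

lemma form_natural:
  "flat_connection \<A> a \<Longrightarrow> c \<in> \<A> \<Longrightarrow> d \<in> \<A> \<Longrightarrow> z \<in> overlap c d \<Longrightarrow>
    a c z v = a d (transition c d z) (D_transition c d z v)"
  unfolding flat_connection_def u21_form_def by blast

lemma form_continuous: "flat_connection \<A> a \<Longrightarrow> c \<in> \<A> \<Longrightarrow> continuous_on (cimg c) (\<lambda>z. a c z v)"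
  using form_smooth[of a c v] unfolding smooth_on_def by (metis Ck_on.simps(1))

lemma form_Ck1: "flat_connection \<A> a \<Longrightarrow> c \<in> \<A> \<Longrightarrow> Ck_on (Suc 0) (cimg c) (\<lambda>z. a c z v)"
  using form_smooth[of a c v] unfolding smooth_on_def by blast

lemma dform_works:
  "flat_connection \<A> a \<Longrightarrow> c \<in> \<A> \<Longrightarrow> z \<in> cimg c \<Longrightarrow>
    ((\<lambda>z. a c z v) has_derivative dform a c v z) (at z within cimg c)"
  unfolding dform_def by (rule Ck_on_SucD[OF form_Ck1])

lemma continuous_dform:
  "flat_connection \<A> a \<Longrightarrow> c \<in> \<A> \<Longrightarrow> continuous_on (cimg c) (\<lambda>z. dform a c v z e)"
  using form_Ck1[of a c v] unfolding dform_def Ck_on.simps by blast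

lemma form_flat:
  "flat_connection \<A> a \<Longrightarrow> c \<in> \<A> \<Longrightarrow> z \<in> cimg c \<Longrightarrow>
    dform a c w z v - dform a c v z w + (a c z v ** a c z w - a c z w ** a c z v) = 0"
  unfolding flat_connection_def flat_def ext_d_def wedge11_def dform_def by blast

lemma continuous_trace_mult:
  fixes f g :: "real^3 \<Rightarrow> cmat"
  shows "continuous_on S f \<Longrightarrow> continuous_on S g \<Longrightarrow> continuous_on S (\<lambda>z. trace (f z ** g z))"
  by (rule bounded_bilinear.continuous_on[OF bounded_bilinear_trace_mult])

lemma continuous_matrix_mult:
  fixes f g :: "real^3 \<Rightarrow> cmat"
  shows "continuous_on S f \<Longrightarrow> continuous_on S g \<Longrightarrow> continuous_on S (\<lambda>z. f z ** g z)"
  by (rule bounded_bilinear.continuous_on[OF bounded_bilinear_matrix_mult])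

lemma continuous_cubic:
  fixes f :: "real^3 \<Rightarrow> real^3 \<Rightarrow> cmat"
  shows "(\<And>v. continuous_on S (\<lambda>z. f z v)) \<Longrightarrow> continuous_on S (\<lambda>z. cubic (f z))"
  unfolding cubic_def by (intro continuous_on_diff continuous_trace_mult continuous_matrix_mult)

end

locale form_pair = atlas X \<A> for X :: "'a topology" and \<A> +
  fixes a b :: "'a mform1"
  assumes flat_a: "flat_connection \<A> a" and flat_b: "flat_connection \<A> b"
begin

lemma linear_diff: "c \<in> \<A> \<Longrightarrow> z \<in> cimg c \<Longrightarrow> linear (\<lambda>v. b c z v - a c z v)"
  by (intro linear_compose_sub form_linear flat_a flat_b)

lemma cubic_defect_continuous:
  assumes c: "c \<in> \<A>"
  shows "continuous_on (cimg c) (cubic_defect a b c)"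
  unfolding cubic_defect_def
  by (intro continuous_on_diff continuous_cubic form_continuous flat_a flat_b c)

lemma continuous_wtrace:
  "c \<in> \<A> \<Longrightarrow> continuous_on (cimg c) (\<lambda>z. wtrace (a c z) (b c z) u v)"
  unfolding wtrace_def
  by (intro continuous_on_diff continuous_trace_mult form_continuous flat_a flat_b)

lemma dwtrace_works:
  assumes "c \<in> \<A>" "z \<in> cimg c"
  shows "((\<lambda>z. wtrace (a c z) (b c z) u v) has_derivative dwtrace a b c u v z) (at z within cimg c)"
  unfolding wtrace_def dwtrace_def
  by (intro has_derivative_diff bounded_bilinear.FDERIV[OF bounded_bilinear_trace_mult]
      dform_works flat_a flat_b assms)

lemma continuous_dwtrace: "c \<in> \<A> \<Longrightarrow> continuous_on (cimg c) (\<lambda>z. dwtrace a b c u v z e)"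
  unfolding dwtrace_def
  by (intro continuous_on_diff continuous_on_add continuous_trace_mult form_continuous
      continuous_dform flat_a flat_b)

lemma d_wtrace:
  assumes "c \<in> \<A>" "z \<in> cimg c"
  shows "dwtrace a b c (axis 2 1) (axis 3 1) z (axis 1 1) - dwtrace a b c (axis 1 1) (axis 3 1) z (axis 2 1) +
    dwtrace a b c (axis 1 1) (axis 2 1) z (axis 3 1) = cubic_defect a b c z"
  unfolding dwtrace_def cubic_defect_def cubic_def
  by (rule flat_cubic_difference) (rule form_flat[OF flat_a assms] form_flat[OF flat_b assms])+

end

text \<open>The normal forms have no dr component and are valid wherever the cutoff is nonzero.
  These two facts remove every contribution of the boundary region except the one from the
  differential of the cutoff.\<close>

locale collar_forms = collar_cutoff X \<A> \<rho> \<kappa> lo hi h h' + form_pair X \<A> a b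
  for X :: "'a topology" and \<A> \<rho> \<kappa> lo hi h h' a b +
  fixes Na Nb :: "real^3 \<Rightarrow> cmat"
  assumes near_a: "\<And>c y v. c \<in> \<A> \<Longrightarrow> y \<in> collar_part \<kappa> c \<Longrightarrow> lo < y $ 3 \<Longrightarrow>
      a c (cmap c (\<kappa> y)) (D_collar \<kappa> c y v) = Na v"
    and near_b: "\<And>c y v. c \<in> \<A> \<Longrightarrow> y \<in> collar_part \<kappa> c \<Longrightarrow> lo < y $ 3 \<Longrightarrow>
      b c (cmap c (\<kappa> y)) (D_collar \<kappa> c y v) = Nb v"
    and no_dr: "Na (axis 3 1) = 0" "Nb (axis 3 1) = 0"
begin

text \<open>Here both forms are constant in collar coordinates and kill the r direction, while
  \<open>cubic\<close> involves all three basis vectors. The nonzero Jacobian carries the vanishing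
  back to the chart.\<close>

lemma cubic_defect_near_boundary:
  assumes c: "c \<in> \<A>" and z: "z \<in> cimg c" and cut: "cutoff (cinv c z) \<noteq> 0"
  shows "cubic_defect a b c z = 0"
proof -
  obtain y where y: "y \<in> slab" "cinv c z = \<kappa> y" "lo < y $ 3" using cutoff_nonzero[OF cut] by blast
  then have yc: "y \<in> collar_part \<kappa> c" using cinv_in[OF z] by (simp add: collar_part_def)
  have zy: "z = cmap c (\<kappa> y)" using y(2) cmap_cinv[OF z] by simp
  have zero: "cubic f = 0" if f: "linear f" "f (D_collar \<kappa> c y (axis 3 1)) = 0" for f
  proof -
    have "cubic (\<lambda>v. f (D_collar \<kappa> c y v)) = 0"
      using f(2) by (simp add: cubic_def trace_def matrix_matrix_mult_def)
    then show ?thesis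
      using cubic_pullback[OF f(1) linear_D_collar[OF c yc]] det_collar[OF c yc] by simp
  qed
  have "a c z (D_collar \<kappa> c y (axis 3 1)) = 0" "b c z (D_collar \<kappa> c y (axis 3 1)) = 0"
    using near_a[OF c yc y(3), of "axis 3 1"] near_b[OF c yc y(3), of "axis 3 1"] no_dr
    unfolding zy by simp_all
  then show ?thesis
    unfolding cubic_defect_def
    using zero[OF form_linear[OF flat_a c z]] zero[OF form_linear[OF flat_b c z]]
      zero[OF linear_diff[OF c z]] by simp
qed

text \<open>The coefficient of d\<chi> \<and> tr (a \<and> b), with \<chi> the cutoff.\<close>

definition cut_density :: "'a chart \<Rightarrow> real^3 \<Rightarrow> complex" where
  "cut_density c z = (if z $ 3 < 0 then wedge_density (dcut c z) (wtrace (a c z) (b c z)) else 0)"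

definition boundary_term :: complex where
  "boundary_term = wtrace Na Nb (axis 1 1) (axis 2 1)"

text \<open>The 3-form h'(r) dr \<and> tr (a \<and> b) only sees tr (a \<and> b) on the x and y
  directions, which is constant for r > \<open>lo\<close>; for r \<le> \<open>lo\<close> the factor
  \<open>h'\<close> vanishes. No sign arises, since moving dr past a 2-form is an even
  permutation.\<close>

lemma cut_density_collar:
  assumes c: "c \<in> \<A>" and y: "y \<in> collar_part \<kappa> c" "0 < y $ 3" "y $ 3 < 1"
  shows "of_real (det (matrix (D_collar \<kappa> c y))) * cut_density c (cmap c (\<kappa> y)) =
    of_real (h' (y $ 3)) * boundary_term"
proof -
  let ?z = "cmap c (\<kappa> y)"
  have z: "?z \<in> cimg c" "?z $ 3 < 0"
    using collar_part_cdom[OF y(1)] collar_interior[OF c y(1,3)] by simp_all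
  have "of_real (det (matrix (D_collar \<kappa> c y))) * cut_density c ?z =
      wedge_density (\<lambda>v. dcut c ?z (D_collar \<kappa> c y v))
        (\<lambda>v w. wtrace (a c ?z) (b c ?z) (D_collar \<kappa> c y v) (D_collar \<kappa> c y w))"
    using wedge_density_pullback[OF has_derivative_linear[OF dcut_works[OF c z]]
        form_linear[OF flat_a c z(1)] form_linear[OF flat_b c z(1)] linear_D_collar[OF c y(1)]] z(2)
    by (simp add: cut_density_def)
  also have "\<dots> = h' (y $ 3) *\<^sub>R
      wtrace (a c ?z) (b c ?z) (D_collar \<kappa> c y (axis 1 1)) (D_collar \<kappa> c y (axis 2 1))"
    unfolding wedge_density_def dcut_collar_D[OF c y] by (simp add: axis_def)
  also have "\<dots> = of_real (h' (y $ 3)) * boundary_term"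
  proof (cases "lo < y $ 3")
    case True
    then show ?thesis
      unfolding wtrace_def boundary_term_def near_a[OF c y(1) True] near_b[OF c y(1) True]
      by (simp add: scaleR_conv_of_real)
  next
    case False
    then show ?thesis using h'_0[of "y $ 3"] by simp
  qed
  finally show ?thesis .
qed

text \<open>
  The extension by 0 is differentiable because \<open>1 - cutoff\<close> vanishes near the boundary of the half
  space and \<open>\<rho> c\<close> outside a compact set.
\<close>

definition ext_coeff :: "'a chart \<Rightarrow> real^3 \<Rightarrow> real^3 \<Rightarrow> real^3 \<Rightarrow> complex" where
  "ext_coeff c u v z = (if z \<in> cimg c
     then (\<rho> c (cinv c z) * (1 - cutoff (cinv c z))) *\<^sub>R wtrace (a c z) (b c z) u v else 0)"

text \<open>Product rule for \<open>ext_coeff\<close> in direction \<open>e\<close>. At the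
  remaining points \<open>ext_coeff\<close> vanishes in a neighbourhood, which accounts for the
  value 0.\<close>

definition dext_coeff :: "'a chart \<Rightarrow> real^3 \<Rightarrow> real^3 \<Rightarrow> real^3 \<Rightarrow> real^3 \<Rightarrow> complex" where
  "dext_coeff c u v z e = (if z \<in> cimg c \<and> z $ 3 < 0
     then (\<rho> c (cinv c z) * (1 - cutoff (cinv c z))) *\<^sub>R dwtrace a b c u v z e +
       (\<rho> c (cinv c z) * (- dcut c z e) + dpart c c z e * (1 - cutoff (cinv c z))) *\<^sub>R
         wtrace (a c z) (b c z) u v
     else 0)"

lemma dext_coeff_works:
  assumes c: "c \<in> \<A>"
  shows "(ext_coeff c u v has_derivative dext_coeff c u v z) (at z)"
proof -
  have "z $ 3 \<le> 0" if "z \<in> cimg c" using that cimg_subset[OF c] by (auto simp: halfspace_def)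
  then consider (int) "z \<in> cimg c" "z $ 3 < 0" | (bd) "z \<in> cimg c" "z $ 3 = 0" | (out) "z \<notin> cimg c"
    by fastforce
  then show ?thesis
  proof cases
    case int
    let ?U = "cimg c \<inter> {z. z $ 3 < 0}"
    have U: "open ?U" "z \<in> ?U" using interior_open[OF c] int by simp_all
    have at: "(f has_derivative f') (at z)" if "(f has_derivative f') (at z within cimg c)"
      for f :: "real^3 \<Rightarrow> 'x::real_normed_vector" and f'
      using has_derivative_subset[OF that, of ?U] at_within_open[OF U(2,1)] by simp
    have 1: "((\<lambda>z. \<rho> c (cinv c z)) has_derivative dpart c c z) (at z)"
      by (rule at[OF dpart_works[OF c c int(1)]])
    have 2: "((\<lambda>z. 1 - cutoff (cinv c z)) has_derivative (\<lambda>e. - dcut c z e)) (at z)"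
      using has_derivative_diff[OF has_derivative_const[of 1] dcut_works[OF c int]] by simp
    have 3: "((\<lambda>z. wtrace (a c z) (b c z) u v) has_derivative dwtrace a b c u v z) (at z)"
      by (rule at[OF dwtrace_works[OF c int(1)]])
    have "((\<lambda>z. (\<rho> c (cinv c z) * (1 - cutoff (cinv c z))) *\<^sub>R wtrace (a c z) (b c z) u v)
        has_derivative dext_coeff c u v z) (at z)"
      using has_derivative_scaleR[OF has_derivative_mult[OF 1 2] 3] int
      unfolding dext_coeff_def by simp
    then show ?thesis
      by (rule has_derivative_transform_within_open[OF _ U]) (simp add: ext_coeff_def)
  next
    case bd
    obtain U where U: "open U" "z \<in> U" "\<And>w. w \<in> cimg c \<Longrightarrow> w \<in> U \<Longrightarrow> cutoff (cinv c w) = 1"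
      using cutoff_near_boundary[OF c bd] by blast
    have "((\<lambda>z. 0) has_derivative dext_coeff c u v z) (at z)"
      using bd unfolding dext_coeff_def by simp
    then show ?thesis
      by (rule has_derivative_transform_within_open[OF _ U(1,2)]) (simp add: ext_coeff_def U(3))
  next
    case out
    have U: "open (- csupp c)" "z \<in> - csupp c"
      using compact_csupp[OF c] compact_imp_closed csupp_subset[OF c] out by blast+
    have "((\<lambda>z. 0) has_derivative dext_coeff c u v z) (at z)"
      using out unfolding dext_coeff_def by simp
    then show ?thesis
    proof (rule has_derivative_transform_within_open[OF _ U])
      fix w assume w: "w \<in> - csupp c"
      show "0 = ext_coeff c u v w"
        using w csupp_iff[OF c, of w] partition_zero[OF cinv_topspace[OF c, of w], of c]
        by (simp add: ext_coeff_def)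
    qed
  qed
qed

text \<open>Only a bound on the derivative is required. The terms without \<open>dcut\<close> are
  continuous on the chart and so bounded on the compact \<open>csupp c\<close>; the remaining one is
  controlled by \<open>bounded_dcut\<close>.\<close>

lemma integral_dext_coeff:
  assumes c: "c \<in> \<A>"
  shows "(\<lambda>z. dext_coeff c u v z e) absolutely_integrable_on UNIV"
    "integral UNIV (\<lambda>z. dext_coeff c u v z e) = 0"
proof -
  let ?p = "\<lambda>z. \<rho> c (cinv c z)" and ?q = "\<lambda>z. 1 - cutoff (cinv c z)"
  have p: "continuous_on (cimg c) ?p" by (rule continuous_partition[OF c c])
  have q: "continuous_on (cimg c) ?q" by (intro continuous_on_diff continuous_on_const continuous_cutoff c)
  obtain B3 where B3: "\<And>z. z \<in> csupp c \<Longrightarrow> \<bar>dcut c z e\<bar> \<le> B3" using bounded_dcut[OF c, of e] by blast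
  have w: "\<exists>B. \<forall>z\<in>csupp c. norm (wtrace (a c z) (b c z) u v) \<le> B"
    by (rule continuous_bounded_csupp[OF c continuous_wtrace[OF c]])
  have "\<exists>B. \<forall>z\<in>csupp c. norm ((?p z * ?q z) *\<^sub>R dwtrace a b c u v z e) \<le> B"
    by (intro continuous_bounded_csupp[OF c] continuous_on_scaleR continuous_on_mult p q continuous_dwtrace c)
  then obtain C1 where C1: "\<And>z. z \<in> csupp c \<Longrightarrow> norm ((?p z * ?q z) *\<^sub>R dwtrace a b c u v z e) \<le> C1" by blast
  have "\<exists>B. \<forall>z\<in>csupp c. norm ((dpart c c z e * ?q z) *\<^sub>R wtrace (a c z) (b c z) u v) \<le> B"
    by (intro continuous_bounded_csupp[OF c] continuous_on_scaleR continuous_on_mult q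
        continuous_dpart continuous_wtrace c)
  then obtain C2 where C2: "\<And>z. z \<in> csupp c \<Longrightarrow>
      norm ((dpart c c z e * ?q z) *\<^sub>R wtrace (a c z) (b c z) u v) \<le> C2" by blast
  have "\<exists>B. \<forall>z\<in>csupp c. norm (?p z *\<^sub>R wtrace (a c z) (b c z) u v) \<le> B"
    by (intro continuous_bounded_csupp[OF c] continuous_on_scaleR p continuous_wtrace c)
  then have "\<exists>B. \<forall>z\<in>csupp c. norm (- dcut c z e *\<^sub>R (?p z *\<^sub>R wtrace (a c z) (b c z) u v)) \<le> B"
    by (rule product_bounded[rotated]) (use B3 in auto)
  then obtain C3 where C3: "\<And>z. z \<in> csupp c \<Longrightarrow>
      norm (- dcut c z e *\<^sub>R (?p z *\<^sub>R wtrace (a c z) (b c z) u v)) \<le> C3" by blast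
  have bound: "norm (dext_coeff c u v z e) \<le> max 0 (C1 + C3 + C2)" for z
  proof (cases "z \<in> csupp c \<and> z $ 3 < 0")
    case True
    then have z: "z \<in> csupp c" "z \<in> cimg c" "z $ 3 < 0" using csupp_subset[OF c] by blast+
    have "dext_coeff c u v z e = (?p z * ?q z) *\<^sub>R dwtrace a b c u v z e +
        (- dcut c z e *\<^sub>R (?p z *\<^sub>R wtrace (a c z) (b c z) u v)) +
        (dpart c c z e * ?q z) *\<^sub>R wtrace (a c z) (b c z) u v"
      using z(2,3) unfolding dext_coeff_def by (simp add: algebra_simps)
    then have "norm (dext_coeff c u v z e) \<le> C1 + C3 + C2"
      using C1[OF z(1)] C2[OF z(1)] C3[OF z(1)] by (simp only:) (intro norm_triangle_mono)
    then show ?thesis by simp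
  next
    case False
    have "dext_coeff c u v z e = 0"
    proof (cases "z \<in> cimg c \<and> z $ 3 < 0")
      case True
      then have "cinv c z \<notin> supp c" using False csupp_iff[OF c] by blast
      then show ?thesis
        using True dpart_zero[OF c c, of z e] partition_zero[OF cinv_topspace[OF c], of z c]
        unfolding dext_coeff_def by simp
    next
      case False
      then show ?thesis unfolding dext_coeff_def by (rule if_not_P)
    qed
    then show ?thesis by simp
  qed
  have zero: "ext_coeff c u v z = 0" if z: "z \<notin> csupp c" for z
    using z csupp_iff[OF c, of z] partition_zero[OF cinv_topspace[OF c, of z], of c]
    by (simp add: ext_coeff_def)
  note * = dext_coeff_works[OF c] bound compact_imp_bounded[OF compact_csupp[OF c]] zero
  show "(\<lambda>z. dext_coeff c u v z e) absolutely_integrable_on UNIV"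
    by (rule integral_directional_derivative(1)[OF *])
  show "integral UNIV (\<lambda>z. dext_coeff c u v z e) = 0"
    by (rule integral_directional_derivative(2)[OF *])
qed

text \<open>In chart \<open>d\<close>, the coefficient of (1 - \<chi>) d\<rho>_c \<and> tr (a \<and>
  b): what integration by parts in chart \<open>c\<close> leaves over.\<close>

definition part_density :: "'a chart \<Rightarrow> 'a chart \<Rightarrow> real^3 \<Rightarrow> complex" where
  "part_density c d z = (1 - cutoff (cinv d z)) *\<^sub>R wedge_density (dpart c d z) (wtrace (a d z) (b d z))"

lemma div_ext_coeff:
  assumes c: "c \<in> \<A>" and z: "z \<in> cimg c"
  shows "dext_coeff c (axis 2 1) (axis 3 1) z (axis 1 1) - dext_coeff c (axis 1 1) (axis 3 1) z (axis 2 1) +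
      dext_coeff c (axis 1 1) (axis 2 1) z (axis 3 1) =
    \<rho> c (cinv c z) *\<^sub>R cubic_defect a b c z - \<rho> c (cinv c z) *\<^sub>R cut_density c z + part_density c c z"
proof (cases "z $ 3 < 0")
  case True
  have "dext_coeff c (axis 2 1) (axis 3 1) z (axis 1 1) - dext_coeff c (axis 1 1) (axis 3 1) z (axis 2 1) +
      dext_coeff c (axis 1 1) (axis 2 1) z (axis 3 1) =
    (\<rho> c (cinv c z) * (1 - cutoff (cinv c z))) *\<^sub>R
      (dwtrace a b c (axis 2 1) (axis 3 1) z (axis 1 1) - dwtrace a b c (axis 1 1) (axis 3 1) z (axis 2 1) +
       dwtrace a b c (axis 1 1) (axis 2 1) z (axis 3 1)) -
    \<rho> c (cinv c z) *\<^sub>R cut_density c z + part_density c c z"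
    using True z
    by (simp add: dext_coeff_def cut_density_def part_density_def wedge_density_def algebra_simps)
  also have "(\<rho> c (cinv c z) * (1 - cutoff (cinv c z))) *\<^sub>R
      (dwtrace a b c (axis 2 1) (axis 3 1) z (axis 1 1) - dwtrace a b c (axis 1 1) (axis 3 1) z (axis 2 1) +
       dwtrace a b c (axis 1 1) (axis 2 1) z (axis 3 1)) = \<rho> c (cinv c z) *\<^sub>R cubic_defect a b c z"
    unfolding d_wtrace[OF c z] using cubic_defect_near_boundary[OF c z]
    by (cases "cutoff (cinv c z) = 0") simp_all
  finally show ?thesis .
next
  case False
  then have z3: "z $ 3 = 0" using z cimg_subset[OF c] by (auto simp: halfspace_def)
  obtain U where U: "open U" "z \<in> U" "\<And>w. w \<in> cimg c \<Longrightarrow> w \<in> U \<Longrightarrow> cutoff (cinv c w) = 1"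
    using cutoff_near_boundary[OF c z z3] by blast
  have "cutoff (cinv c z) = 1" by (rule U(3)[OF z U(2)])
  then show ?thesis
    using False cubic_defect_near_boundary[OF c z]
    by (simp add: dext_coeff_def cut_density_def part_density_def)
qed

lemma part_density_continuous:
  assumes "c \<in> \<A>" "d \<in> \<A>"
  shows "continuous_on (cimg d) (part_density c d)"
  unfolding part_density_def wedge_density_def
  by (intro continuous_on_scaleR continuous_on_diff continuous_on_add continuous_on_const
      continuous_cutoff continuous_dpart continuous_wtrace assms)

lemma part_density_zero:
  assumes "c \<in> \<A>" "d \<in> \<A>" "z \<in> cimg d" "cinv d z \<notin> supp c"
  shows "part_density c d z = 0"
  unfolding part_density_def wedge_density_def by (simp add: dpart_zero[OF assms])

lemma part_density_natural:
  assumes c: "c \<in> \<A>"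
  shows "natural_density (part_density c)"
  unfolding natural_density_def
proof (intro ballI)
  fix d e z assume de: "d \<in> \<A>" "e \<in> \<A>" and z: "z \<in> overlap d e"
  let ?t = "transition d e z" and ?D = "D_transition d e z"
  have te: "?t \<in> cimg e" using transition_in[OF de z] overlap_subset by blast
  have "wedge_density (dpart c d z) (wtrace (a d z) (b d z)) =
      wedge_density (\<lambda>v. dpart c e ?t (?D v)) (\<lambda>v w. wtrace (a e ?t) (b e ?t) (?D v) (?D w))"
    unfolding wedge_density_def wtrace_def dpart_natural[OF c de z]
      form_natural[OF flat_a de z] form_natural[OF flat_b de z] by (rule refl)
  also have "\<dots> = of_real (det (matrix ?D)) * wedge_density (dpart c e ?t) (wtrace (a e ?t) (b e ?t))"
    by (intro wedge_density_pullback has_derivative_linear[OF dpart_works[OF c de(2) te]]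
        form_linear flat_a flat_b de te linear_D_transition z)
  finally show "part_density c d z = of_real (det (matrix ?D)) * part_density c e ?t"
    unfolding part_density_def cinv_transition[OF de z] by simp
qed

lemma sum_part_density:
  assumes d: "d \<in> \<A>" and z: "z \<in> cimg d"
  shows "(\<Sum>c\<in>active. part_density c d z) = 0"
proof -
  let ?w = "wtrace (a d z) (b d z)"
  have "(\<Sum>c\<in>active. wedge_density (dpart c d z) ?w) = wedge_density (\<lambda>v. \<Sum>c\<in>active. dpart c d z v) ?w"
    by (simp add: wedge_density_def sum.distrib sum_subtractf scaleR_left.sum)
  also have "\<dots> = 0" by (simp add: wedge_density_def sum_dpart[OF d z])
  finally show ?thesis unfolding part_density_def by (simp flip: scaleR_right.sum)
qed

text \<open>\<open>F\<close> is a divergence of compactly supported coefficients on the whole space,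
  so its integral is 0. Solving the Leibniz rule for the cutoff term also yields the integrability
  of that term, without any continuity of \<open>dcut\<close>.\<close>

lemma stokes_chart:
  assumes c: "c \<in> \<A>"
  shows "(\<lambda>z. \<rho> c (cinv c z) *\<^sub>R cut_density c z) absolutely_integrable_on cimg c"
    and "weighted c (cubic_defect a b c) -
      weighted c (cut_density c) +
      integral (cimg c) (part_density c c) = 0"
proof -
  define F where "F z = dext_coeff c (axis 2 1) (axis 3 1) z (axis 1 1) -
    dext_coeff c (axis 1 1) (axis 3 1) z (axis 2 1) + dext_coeff c (axis 1 1) (axis 2 1) z (axis 3 1)" for z
  note int = integral_dext_coeff[OF c]
  have F_int: "F absolutely_integrable_on UNIV"
    unfolding F_def by (intro set_integral_add set_integral_diff int)
  have F_0: "integral UNIV F = 0"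
    unfolding F_def
    by (simp add: integral_add integral_diff integrable_diff set_lebesgue_integral_eq_integral(1)[OF int(1)] int(2))
  have e: "{z \<in> UNIV - cimg c. F z \<noteq> 0} = {}" "{z \<in> cimg c - UNIV. F z \<noteq> 0} = {}"
    by (auto simp: F_def dext_coeff_def)
  have Fc: "F absolutely_integrable_on cimg c"
    using F_int absolutely_integrable_spike_set_eq[of UNIV "cimg c" F] unfolding e by (simp only: negligible_empty)
  have Fc0: "integral (cimg c) F = 0"
    unfolding F_0[symmetric] by (rule integral_spike_set) (simp_all only: e negligible_empty)
  have P: "(\<lambda>z. \<rho> c (cinv c z) *\<^sub>R cubic_defect a b c z) absolutely_integrable_on cimg c"
    by (intro absolutely_integrable_partition c cubic_defect_continuous)
  have Q: "part_density c c absolutely_integrable_on cimg c"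
    using absolutely_integrable_supp[OF c part_density_continuous[OF c c]] part_density_zero[OF c c] by blast
  have eq: "\<rho> c (cinv c z) *\<^sub>R cut_density c z =
      \<rho> c (cinv c z) *\<^sub>R cubic_defect a b c z + part_density c c z - F z" if "z \<in> cimg c" for z
    using div_ext_coeff[OF c that] by (simp add: F_def)
  have G: "(\<lambda>z. \<rho> c (cinv c z) *\<^sub>R cubic_defect a b c z + part_density c c z - F z) absolutely_integrable_on cimg c"
    by (intro set_integral_add set_integral_diff P Q Fc)
  show "(\<lambda>z. \<rho> c (cinv c z) *\<^sub>R cut_density c z) absolutely_integrable_on cimg c"
    by (rule absolutely_integrable_spike[OF G negligible_empty]) (simp add: eq)
  have "weighted c (cut_density c) =
      integral (cimg c) (\<lambda>z. \<rho> c (cinv c z) *\<^sub>R cubic_defect a b c z + part_density c c z - F z)"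
    by (rule integral_cong) (rule eq)
  also have "\<dots> = weighted c (cubic_defect a b c) +
      integral (cimg c) (part_density c c) - integral (cimg c) F"
    by (simp add: integral_add integral_diff integrable_add set_lebesgue_integral_eq_integral(1)[OF P]
        set_lebesgue_integral_eq_integral(1)[OF Q] set_lebesgue_integral_eq_integral(1)[OF Fc])
  finally show "weighted c (cubic_defect a b c) -
      weighted c (cut_density c) +
      integral (cimg c) (part_density c c) = 0"
    using Fc0 by simp
qed

text \<open>The terms with d\<rho>_c are brought to common charts by
  \<open>pou_integral_reorganise\<close>; there they add up to 0, since the sum of the
  \<open>\<rho> c\<close> is constant.\<close>

lemma pou_integral_cubic_defect: "pou_integral (cubic_defect a b) = pou_integral cut_density"
proof -
  have "(\<Sum>c\<in>active. integral (cimg c) (part_density c c)) =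
      pou_integral (\<lambda>d z. \<Sum>c\<in>active. part_density c d z)"
  proof (rule pou_integral_reorganise)
    show "natural_density (part_density c)" if "c \<in> active" for c
      by (rule part_density_natural[OF active_subset[OF that]])
    show "continuous_on (cimg d) (part_density c d)" if "c \<in> active" "d \<in> \<A>" for c d
      by (rule part_density_continuous[OF active_subset[OF that(1)] that(2)])
    show "part_density c d z = 0" if "c \<in> active" "d \<in> \<A>" "z \<in> cimg d" "cinv d z \<notin> supp c" for c d z
      by (rule part_density_zero[OF active_subset[OF that(1)] that(2-4)])
  qed
  also have "\<dots> = 0"
    unfolding pou_integral_def
  proof (rule sum.neutral, rule ballI)
    fix d assume "d \<in> active"
    then have "weighted d (\<lambda>z. (\<Sum>c\<in>active. part_density c d z)) =
        integral (cimg d) (\<lambda>z. 0)"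
      by (intro integral_cong) (simp add: sum_part_density active_subset)
    then show "weighted d (\<lambda>z. (\<Sum>c\<in>active. part_density c d z)) = 0" by simp
  qed
  finally have 0: "(\<Sum>c\<in>active. integral (cimg c) (part_density c c)) = 0" .
  have "(\<Sum>c\<in>active. weighted c (cubic_defect a b c) -
      weighted c (cut_density c) +
      integral (cimg c) (part_density c c)) = 0"
    using stokes_chart(2) active_subset by (intro sum.neutral) blast
  then show ?thesis
    using 0 by (simp add: pou_integral_def sum.distrib sum_subtractf)
qed

lemma collar_part_lebesgue: "c \<in> \<A> \<Longrightarrow> collar_part \<kappa> c \<in> sets lebesgue"
proof -
  assume "c \<in> \<A>"
  then obtain U where "open U" "collar_part \<kappa> c = slab \<inter> U"
    using collar_part_open[of c] by (auto simp: openin_open)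
  then have "collar_part \<kappa> c \<in> sets borel" using closed_slab by auto
  then show ?thesis by (simp add: sets_completionI_sets)
qed

text \<open>The part of the unit cell that \<open>\<kappa>\<close> maps into the chart domain; r = 1
  is removed so that the image lies in the interior of the half space.\<close>

definition cell_part :: "'a chart \<Rightarrow> (real^3) set" where
  "cell_part c = unit_cell \<inter> {y. y $ 3 < 1} \<inter> collar_part \<kappa> c"

text \<open>The map from \<open>cell_part c\<close> to the chart is injective because the unit cell
  is a fundamental domain, and its image contains all points where the cutoff has nonzero
  differential. Passing from \<open>cell_part c\<close> to the whole cell adds only zeros: off the
  chart \<open>\<rho> c\<close> is 0, and at r = 1 \<open>h'\<close> is 0.\<close>

lemma cell_integral:
  assumes c: "c \<in> \<A>"
  shows "(\<lambda>y. \<rho> c (\<kappa> y) *\<^sub>R (of_real (h' (y $ 3)) * boundary_term)) absolutely_integrable_on unit_cell"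
    and "weighted c (cut_density c) =
      integral unit_cell (\<lambda>y. \<rho> c (\<kappa> y) *\<^sub>R (of_real (h' (y $ 3)) * boundary_term))"
proof -
  define g where "g = cmap c \<circ> \<kappa>"
  define f where "f z = \<rho> c (cinv c z) *\<^sub>R cut_density c z" for z
  define k where "k y = \<rho> c (\<kappa> y) *\<^sub>R (of_real (h' (y $ 3)) * boundary_term)" for y
  let ?S = "cell_part c"
  have "{y::real^3. y $ 3 < 1} \<in> sets borel" by measurable
  then have S: "?S \<in> sets lebesgue"
    unfolding cell_part_def
    by (intro sets.Int unit_cell_measurable collar_part_lebesgue c) (simp add: sets_completionI_sets)
  have S_part: "?S \<subseteq> collar_part \<kappa> c" unfolding cell_part_def by blast
  have S_y: "y \<in> collar_part \<kappa> c" "y \<in> unit_cell" "0 < y $ 3" "y $ 3 < 1" if "y \<in> ?S" for y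
    using that by (simp_all add: cell_part_def unit_cell_def)
  have der: "(g has_derivative D_collar \<kappa> c y) (at y within ?S)" if "y \<in> ?S" for y
    unfolding g_def by (rule has_derivative_subset[OF D_collar_works[OF c S_y(1)[OF that]] S_part])
  have inj: "inj_on g ?S"
  proof (rule inj_onI)
    fix v w assume vw: "v \<in> ?S" "w \<in> ?S" "g v = g w"
    have "\<kappa> v = \<kappa> w"
      using vw(3) inj_onD[OF inj_cmap[OF c]] collar_part_cdom[OF S_y(1)[OF vw(1)]]
        collar_part_cdom[OF S_y(1)[OF vw(2)]] unfolding g_def comp_def by blast
    then have vw': "v $ 1 - w $ 1 \<in> \<int>" "v $ 2 - w $ 2 \<in> \<int>" "v $ 3 = w $ 3"
      using collar_eq_iff[OF collar_part_slab[OF S_y(1)[OF vw(1)]] collar_part_slab[OF S_y(1)[OF vw(2)]]]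
      by blast+
    have "\<bar>v $ 1 - w $ 1\<bar> < 1" "\<bar>v $ 2 - w $ 2\<bar> < 1"
      using S_y(2)[OF vw(1)] S_y(2)[OF vw(2)] by (auto simp: unit_cell_def abs_if)
    then have "v $ 1 - w $ 1 = 0" "v $ 2 - w $ 2 = 0"
      using vw'(1,2) Ints_nonzero_abs_less1 by blast+
    then show "v = w" using vw'(3) by (simp add: vec_eq_iff forall_3)
  qed
  have gS: "g ` ?S \<subseteq> cimg c" unfolding g_def using S_part collar_part_cdom by fastforce
  have zero: "f z = 0" if z: "z \<in> cimg c" "z \<notin> g ` ?S" for z
  proof (cases "z $ 3 < 0")
    case True
    from c z(1) True show ?thesis
    proof (cases rule: cutoff_cases)
      case (collar y)
      then have "y \<in> ?S" unfolding cell_part_def by blast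
      then have "z \<in> g ` ?S" using collar(4) unfolding g_def by force
      then show ?thesis using z(2) by blast
    next
      case outside
      then show ?thesis
        using dcut_outside[OF c z(1) True] by (simp add: f_def cut_density_def wedge_density_def)
    qed
  qed (simp add: f_def cut_density_def)
  have e: "{z \<in> cimg c - g ` ?S. f z \<noteq> 0} = {}" "{z \<in> g ` ?S - cimg c. f z \<noteq> 0} = {}"
    using zero gS by blast+
  have "f absolutely_integrable_on cimg c"
    unfolding f_def[abs_def] by (rule stokes_chart(1)[OF c])
  then have f_int: "f absolutely_integrable_on g ` ?S"
    using absolutely_integrable_spike_set_eq[of "cimg c" "g ` ?S" f]
    unfolding e by (simp only: negligible_empty)
  have k: "\<bar>det (matrix (D_collar \<kappa> c y))\<bar> *\<^sub>R f (g y) = k y" if y: "y \<in> ?S" for y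
  proof -
    have "\<bar>det (matrix (D_collar \<kappa> c y))\<bar> *\<^sub>R f (g y) =
        \<rho> c (\<kappa> y) *\<^sub>R (of_real (det (matrix (D_collar \<kappa> c y))) * cut_density c (cmap c (\<kappa> y)))"
      using det_collar[OF c S_y(1)[OF y]] cinv_cmap[OF c collar_part_cdom[OF S_y(1)[OF y]]]
      by (simp add: f_def g_def scaleR_conv_of_real)
    then show ?thesis unfolding cut_density_collar[OF c S_y(1,3,4)[OF y]] k_def .
  qed
  have e': "{y \<in> ?S - unit_cell. k y \<noteq> 0} = {}" "{y \<in> unit_cell - ?S. k y \<noteq> 0} = {}"
  proof -
    show "{y \<in> ?S - unit_cell. k y \<noteq> 0} = {}" unfolding cell_part_def by blast
    have "k y = 0" if y: "y \<in> unit_cell" "y \<notin> ?S" for y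
    proof (cases "y $ 3 < 1")
      case True
      have ys: "y \<in> slab" using y(1) by (simp add: unit_cell_def slab_def)
      have "\<kappa> y \<notin> cdom c"
        using y True ys by (simp add: cell_part_def collar_part_def)
      then have "\<kappa> y \<notin> supp c" using supp_subset[OF c] by blast
      then show ?thesis using partition_zero[OF collar_topspace[OF ys]] by (simp add: k_def)
    next
      case False
      then show ?thesis using h'_0[of "y $ 3"] lo_hi by (simp add: k_def)
    qed
    then show "{y \<in> unit_cell - ?S. k y \<noteq> 0} = {}" by blast
  qed
  have "k absolutely_integrable_on ?S"
  proof (rule absolutely_integrable_spike[OF integral_change_of_variables_complex(1)[OF S der inj f_int] negligible_empty])
    fix y assume "y \<in> ?S - {}"
    then have "y \<in> ?S" by (rule DiffD1)
    then show "k y = \<bar>det (matrix (D_collar \<kappa> c y))\<bar> *\<^sub>R f (g y)" by (rule k[symmetric])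
  qed
  then have "k absolutely_integrable_on unit_cell"
    using absolutely_integrable_spike_set_eq[of ?S unit_cell k] unfolding e' by (simp only: negligible_empty)
  then show "(\<lambda>y. \<rho> c (\<kappa> y) *\<^sub>R (of_real (h' (y $ 3)) * boundary_term)) absolutely_integrable_on unit_cell"
    unfolding k_def[abs_def] .
  have "integral (cimg c) f = integral (g ` ?S) f"
    by (rule integral_spike_set) (simp_all only: e negligible_empty)
  also have "\<dots> = integral ?S (\<lambda>y. \<bar>det (matrix (D_collar \<kappa> c y))\<bar> *\<^sub>R f (g y))"
    by (rule integral_change_of_variables_complex(2)[OF S der inj f_int])
  also have "\<dots> = integral ?S k" by (rule integral_cong) (rule k)
  also have "\<dots> = integral unit_cell k"
    by (rule integral_spike_set) (simp_all only: e' negligible_empty)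
  finally show "weighted c (cut_density c) =
      integral unit_cell (\<lambda>y. \<rho> c (\<kappa> y) *\<^sub>R (of_real (h' (y $ 3)) * boundary_term))"
    unfolding k_def[abs_def] f_def[abs_def] .
qed

text \<open>All charts now contribute integrals over the same unit cell, so the partition sums to 1
  pointwise before the integral of \<open>h'\<close> is evaluated.\<close>

theorem stokes: "pou_integral (cubic_defect a b) = boundary_term"
proof -
  let ?k = "\<lambda>y::real^3. of_real (h' (y $ 3)) * boundary_term"
  have "pou_integral (cubic_defect a b) = pou_integral cut_density"
    by (rule pou_integral_cubic_defect)
  also have "\<dots> = (\<Sum>c\<in>active. integral unit_cell (\<lambda>y. \<rho> c (\<kappa> y) *\<^sub>R ?k y))"
    unfolding pou_integral_def
    by (rule sum.cong[OF refl]) (rule cell_integral(2)[OF active_subset])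
  also have "\<dots> = integral unit_cell (\<lambda>y. \<Sum>c\<in>active. \<rho> c (\<kappa> y) *\<^sub>R ?k y)"
    by (rule integral_sum[OF finite_active, symmetric])
       (rule set_lebesgue_integral_eq_integral(1)[OF cell_integral(1)[OF active_subset]])
  also have "\<dots> = integral unit_cell ?k"
  proof (rule integral_cong)
    fix y assume "y \<in> unit_cell"
    then have "y \<in> slab" by (simp add: unit_cell_def slab_def)
    then show "(\<Sum>c\<in>active. \<rho> c (\<kappa> y) *\<^sub>R ?k y) = ?k y"
      by (simp only: scaleR_left.sum[symmetric] sum_partition[OF collar_topspace] scaleR_one)
  qed
  also have "\<dots> = integral unit_cell (\<lambda>y. of_real (h' (y $ 3))) * boundary_term"
    by (rule integral_mult_left)
  also have "integral unit_cell (\<lambda>y. complex_of_real (h' (y $ 3))) = 1"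
    using lo_hi by (intro integral_unit_cell_cutoff[of lo hi h h'] h_deriv h_0 h_1 h'_pos h'_0) auto
  finally show ?thesis by simp
qed

end

section \<open>The Chern-Simons invariant of flat connections\<close>

text \<open>Flatness turns A \<and> dA + (2/3) A^3 into -(1/3) A^3, and the trace of A^3 on the
  standard basis is three times \<open>cubic\<close>.\<close>

lemma cs_form_flat:
  assumes "flat_connection \<A> a" "c \<in> \<A>" "z \<in> cimg c"
  shows "cs_form a c z (axis 1 1) (axis 2 1) (axis 3 1) = of_real (- 1 / (8 * pi\<^sup>2)) * cubic (a c z)"
proof -
  define x y w where "x = a c z (axis 1 1)" and "y = a c z (axis 2 1)" and "w = a c z (axis 3 1)"
  have d: "ext_d (cimg c) (a c) z u v = - wedge11 (a c z) (a c z) u v" for u v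
  proof -
    have "ext_d (cimg c) (a c) z u v + wedge11 (a c z) (a c z) u v = 0"
      using assms unfolding flat_connection_def flat_def by blast
    then show ?thesis by (simp only: eq_neg_iff_add_eq_0)
  qed
  have W: "wedge12 (a c z) (ext_d (cimg c) (a c) z) (axis 1 1) (axis 2 1) (axis 3 1) +
      (2/3) *\<^sub>R wedge12 (a c z) (wedge11 (a c z) (a c z)) (axis 1 1) (axis 2 1) (axis 3 1) =
      (- (1/3)) *\<^sub>R (x ** (y ** w - w ** y) - y ** (x ** w - w ** x) + w ** (x ** y - y ** x))"
    (is "?L = ?R")
  proof -
    have neg: "u ** (- v) = - (u ** v)" for u v :: cmat
      by (rule bounded_bilinear.minus_right[OF bounded_bilinear_matrix_mult])
    have "wedge12 (a c z) (ext_d (cimg c) (a c) z) (axis 1 1) (axis 2 1) (axis 3 1) =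
        - wedge12 (a c z) (wedge11 (a c z) (a c z)) (axis 1 1) (axis 2 1) (axis 3 1)"
      unfolding wedge12_def d neg by simp
    then have "?L = (- (1/3)) *\<^sub>R wedge12 (a c z) (wedge11 (a c z) (a c z)) (axis 1 1) (axis 2 1) (axis 3 1)"
      by (simp add: algebra_simps flip: scaleR_add_left scaleR_diff_left)
    then show ?thesis by (simp only: wedge12_def wedge11_def x_def y_def w_def)
  qed
  have t: "trace (x ** (y ** w - w ** y) - y ** (x ** w - w ** x) + w ** (x ** y - y ** x)) =
      3 * (trace (x ** y ** w) - trace (x ** w ** y))"
    by (simp add: linear_simps[OF bounded_linear_trace] matrix_mul_assoc
        bounded_bilinear.diff_right[OF bounded_bilinear_matrix_mult]
        trace_cyclic[of _ x] trace_cyclic[of x, symmetric])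
  show ?thesis
    unfolding cs_form_def W linear_scale[OF bounded_linear.linear[OF bounded_linear_trace]] t
    by (simp add: cubic_def scaleR_conv_of_real field_simps flip: x_def y_def w_def)
qed

lemma cubic_bound: "\<exists>K. \<forall>f M. 0 \<le> M \<longrightarrow> (\<forall>i. norm (f (axis i 1)) \<le> M) \<longrightarrow> norm (cubic f) \<le> K * M ^ 3"
proof -
  obtain K1 where K1: "K1 > 0" "\<And>x y :: cmat. norm (trace (x ** y)) \<le> norm x * norm y * K1"
    using bounded_bilinear.pos_bounded[OF bounded_bilinear_trace_mult] by blast
  obtain K2 where K2: "K2 > 0" "\<And>(x :: cmat) (y :: cmat). norm (x ** y) \<le> norm x * norm y * K2"
    using bounded_bilinear.pos_bounded[OF bounded_bilinear_matrix_mult] by blast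
  have t: "norm (trace (x ** y ** w)) \<le> K1 * K2 * M ^ 3"
    if "norm x \<le> M" "norm y \<le> M" "norm w \<le> M" "0 \<le> M" for x y w :: cmat and M
  proof -
    have "norm (x ** y) \<le> M * M * K2"
    proof (rule order_trans[OF K2(2)])
      show "norm x * norm y * K2 \<le> M * M * K2"
        using that K2(1) by (intro mult_right_mono mult_mono) auto
    qed
    then have "norm (x ** y) * norm w \<le> (M * M * K2) * M"
      using that(3,4) K2(1) by (intro mult_mono) auto
    then have "norm (x ** y) * norm w * K1 \<le> (M * M * K2) * M * K1"
      using K1(1) by (intro mult_right_mono) auto
    then show ?thesis using K1(2)[of "x ** y" w] by (simp add: power3_eq_cube mult_ac)
  qed
  have "norm (cubic f) \<le> (2 * K1 * K2) * M ^ 3" if "0 \<le> M" "\<forall>i. norm (f (axis i 1)) \<le> M" for f M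
  proof -
    have "norm (cubic f) \<le> K1 * K2 * M ^ 3 + K1 * K2 * M ^ 3"
      unfolding cubic_def using that
      by (intro order_trans[OF norm_triangle_ineq4] add_mono t) auto
    then show ?thesis by simp
  qed
  then show ?thesis by blast
qed

text \<open>A cubic error is negligible to first order, so \<open>f\<close> and \<open>g s\<close>
  have the same derivative at \<open>s\<close>. The fundamental theorem of calculus then applies to
  \<open>f\<close>.\<close>

lemma fundamental_theorem_cubic_error:
  fixes f :: "real \<Rightarrow> complex" and g :: "real \<Rightarrow> real \<Rightarrow> real"
  assumes bound: "\<And>s t. s \<in> {0..1} \<Longrightarrow> t \<in> {0..1} \<Longrightarrow>
      norm (f t - f s - of_real (g s t)) \<le> C * \<bar>t - s\<bar> ^ 3"
    and g': "\<And>s. s \<in> {0..1} \<Longrightarrow> (g s has_vector_derivative g' s) (at s within {0..1})"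
  shows "f 1 - f 0 = of_real (integral {0..1} g')"
proof -
  have "(f has_vector_derivative of_real (g' s)) (at s within {0..1})" if s: "s \<in> {0..1}" for s
  proof -
    define E where "E t = f t - f s - of_real (g s t)" for t
    \<comment> \<open>Taking \<open>t = s\<close> in the bound forces
      \<open>g s s = 0\<close>.\<close>
    have E_s: "E s = 0" using bound[OF s s] by (simp add: E_def)
    have "(E has_derivative (\<lambda>h. 0)) (at s within {0..1})"
    proof (rule has_derivativeI_sandwich[of 1])
      fix t assume t: "t \<in> {0..1}" "t \<noteq> s"
      have "norm (E t) \<le> C * \<bar>t - s\<bar> ^ 3" using bound[OF s t(1)] by (simp add: E_def)
      then show "norm (E t - E s - 0) / norm (t - s) \<le> C * \<bar>t - s\<bar> ^ 2"
        using t(2) by (simp add: E_s divide_le_eq power3_eq_cube power2_eq_square mult_ac)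
    next
      have "((\<lambda>t. C * \<bar>t - s\<bar> ^ 2) \<longlongrightarrow> C * \<bar>s - s\<bar> ^ 2) (at s within {0..1})"
        by (intro tendsto_intros)
      then show "((\<lambda>t. C * \<bar>t - s\<bar> ^ 2) \<longlongrightarrow> 0) (at s within {0..1})" by simp
    qed auto
    then have "(E has_vector_derivative 0) (at s within {0..1})"
      by (simp add: has_vector_derivative_def)
    moreover have "((\<lambda>t. complex_of_real (g s t)) has_vector_derivative of_real (g' s)) (at s within {0..1})"
      using bounded_linear.has_vector_derivative[OF bounded_linear_of_real g'[OF s]] .
    ultimately have "((\<lambda>t. f s + (of_real (g s t) + E t)) has_vector_derivative 0 + (of_real (g' s) + 0)) (at s within {0..1})"
      by (intro has_vector_derivative_add has_vector_derivative_const)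
    then show ?thesis by (simp add: E_def)
  qed
  then have I: "((\<lambda>s. complex_of_real (g' s)) has_integral f 1 - f 0) {0..1}"
    by (intro fundamental_theorem_of_calculus) auto
  \<comment> \<open>Integrability of the real function \<open>g'\<close> is read off from the
    complex integral by taking real parts; comparing the two integrals shows that the difference is
    real.\<close>
  have "((Re \<circ> (\<lambda>s. complex_of_real (g' s))) has_integral Re (f 1 - f 0)) {0..1}"
    by (rule has_integral_linear[OF I bounded_linear_Re])
  then have g: "(g' has_integral Re (f 1 - f 0)) {0..1}" by (simp add: comp_def)
  have "((of_real \<circ> g') has_integral complex_of_real (Re (f 1 - f 0))) {0..1}"
    by (rule has_integral_linear[OF g bounded_linear_of_real])
  then have "f 1 - f 0 = of_real (Re (f 1 - f 0))"
    using I has_integral_unique by (simp add: comp_def) blast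
  then show ?thesis using integral_unique[OF g] by simp
qed

section \<open>The boundary parameters as functions of t\<close>

definition C1_param :: "(real \<Rightarrow> real) \<Rightarrow> bool" where
  "C1_param f \<longleftrightarrow> (\<exists>f'. (\<forall>t\<in>{0..1}. (f has_vector_derivative f' t) (at t within {0..1})) \<and>
     continuous_on {0..1} f')"

lemma C1_param_dot:
  assumes "C1_param f"
  shows "\<And>t. t \<in> {0..1} \<Longrightarrow> (f has_vector_derivative dot f t) (at t within {0..1})"
    and "continuous_on {0..1} (dot f)" and "continuous_on {0..1} f"
proof -
  obtain f' where f': "\<And>t. t \<in> {0..1} \<Longrightarrow> (f has_vector_derivative f' t) (at t within {0..1})"
    "continuous_on {0..1} f'"
    using assms unfolding C1_param_def by blast
  have dot: "dot f t = f' t" if "t \<in> {0..1}" for t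
    unfolding dot_def using f'(1)[OF that] that
    by (intro vector_derivative_within_closed_interval) auto
  show "(f has_vector_derivative dot f t) (at t within {0..1})" if "t \<in> {0..1}" for t
    unfolding dot[OF that] by (rule f'(1)[OF that])
  show "continuous_on {0..1} (dot f)"
    using f'(2) by (rule continuous_on_eq) (simp add: dot)
  show "continuous_on {0..1} f"
    using f'(1) by (rule continuous_on_vector_derivative)
qed

text \<open>With f and g the coefficients of dx and dy, the boundary term of \<open>A s\<close> and
  \<open>A t\<close> is a combination of expressions f s * g t - g s * f t; \<open>swirl\<close> is
  the t-derivative of such an expression at t = s.\<close>

definition swirl :: "(real \<Rightarrow> real) \<Rightarrow> (real \<Rightarrow> real) \<Rightarrow> real \<Rightarrow> real" where
  "swirl f g t = f t * dot g t - dot f t * g t"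

lemma swirl_integrable: "C1_param f \<Longrightarrow> C1_param g \<Longrightarrow> swirl f g integrable_on {0..1}"
  unfolding swirl_def
  by (intro integrable_continuous_interval continuous_on_diff continuous_on_mult C1_param_dot)

lemma swirl_derivative:
  assumes "C1_param f" "C1_param g" "s \<in> {0..1}"
  shows "((\<lambda>t. k * (f s * g t - g s * f t)) has_vector_derivative k * swirl f g s) (at s within {0..1})"
proof -
  have "((\<lambda>t. k * (f s * g t - g s * f t)) has_vector_derivative k * (f s * dot g s - g s * dot f s)) (at s within {0..1})"
    by (intro has_vector_derivative_mult_right has_vector_derivative_diff C1_param_dot assms)
  then show ?thesis by (simp add: swirl_def mult.commute)
qed

context collar
begin

lemma cs_pou:
  assumes "\<rho> = (SOME \<rho>. partition_of_unity X \<A> \<rho>)" and a: "flat_connection \<A> a"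
  shows "cs X \<A> a = of_real (- 1 / (8 * pi\<^sup>2)) * pou_integral (\<lambda>c z. cubic (a c z))"
proof -
  have "cs X \<A> a = (\<Sum>c\<in>active. weighted c (\<lambda>z. cs_form a c z (axis 1 1) (axis 2 1) (axis 3 1)))"
    unfolding cs_def form_integral_def assms(1)[symmetric] Let_def active_def by (rule refl)
  also have "\<dots> = (\<Sum>c\<in>active. of_real (- 1 / (8 * pi\<^sup>2)) *
      weighted c (\<lambda>z. cubic (a c z)))"
  proof (rule sum.cong[OF refl])
    fix c assume c: "c \<in> active"
    have "weighted c (\<lambda>z. cs_form a c z (axis 1 1) (axis 2 1) (axis 3 1)) =
        integral (cimg c) (\<lambda>z. of_real (- 1 / (8 * pi\<^sup>2)) * (\<rho> c (cinv c z) *\<^sub>R cubic (a c z)))"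
      by (rule integral_cong) (simp only: cs_form_flat[OF a active_subset[OF c]] mult_scaleR_right)
    then show "weighted c (\<lambda>z. cs_form a c z (axis 1 1) (axis 2 1) (axis 3 1)) =
        of_real (- 1 / (8 * pi\<^sup>2)) * weighted c (\<lambda>z. cubic (a c z))"
      by (simp only: integral_mult_right)
  qed
  also have "\<dots> = of_real (- 1 / (8 * pi\<^sup>2)) * pou_integral (\<lambda>c z. cubic (a c z))"
    unfolding pou_integral_def by (rule sum_distrib_left[symmetric])
  finally show ?thesis .
qed

lemma cubic_defect_integral:
  assumes a: "flat_connection \<A> a" "equals_near_boundary \<A> \<kappa> a Na" "Na (axis 3 1) = 0"
    and b: "flat_connection \<A> b" "equals_near_boundary \<A> \<kappa> b Nb" "Nb (axis 3 1) = 0"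
  shows "pou_integral (cubic_defect a b) = wtrace Na Nb (axis 1 1) (axis 2 1)"
proof -
  obtain ea where ea: "ea > 0" "\<forall>c\<in>\<A>. \<forall>z\<in>collar_part \<kappa> c. 1 - ea < z $ 3 \<longrightarrow>
     (\<forall>v. a c (cmap c (\<kappa> z)) (D_collar \<kappa> c z v) = Na v)"
    using a(2) unfolding equals_near_boundary_def by blast
  obtain eb where eb: "eb > 0" "\<forall>c\<in>\<A>. \<forall>z\<in>collar_part \<kappa> c. 1 - eb < z $ 3 \<longrightarrow>
     (\<forall>v. b c (cmap c (\<kappa> z)) (D_collar \<kappa> c z v) = Nb v)"
    using b(2) unfolding equals_near_boundary_def by blast
  \<comment> \<open>Both normal forms hold for r > 1 - e, and the bound 1/2 keeps the cutoff away
    from r = 0. The cutoff will rise between 1 - e and 1 - e/2.\<close>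
  define e where "e = min (min ea eb) (1/2)"
  have e: "0 < e" "e \<le> ea" "e \<le> eb" "e \<le> 1/2" using ea(1) eb(1) by (simp_all add: e_def)
  have lt: "1 - e < 1 - e/2" using e(1) by simp
  obtain h h' where h: "\<And>r. (h has_field_derivative h' r) (at r)" "continuous_on UNIV h'"
    "\<And>r. r \<le> 1 - e \<Longrightarrow> h r = 0" "\<And>r. 1 - e/2 \<le> r \<Longrightarrow> h r = 1"
    "\<And>r. 1 - e < r \<Longrightarrow> r < 1 - e/2 \<Longrightarrow> 0 < h' r" "\<And>r. r \<le> 1 - e \<or> 1 - e/2 \<le> r \<Longrightarrow> h' r = 0"
    using exists_cutoff[OF lt] by blast
  interpret collar_forms X \<A> \<rho> \<kappa> "1 - e" "1 - e/2" h h' a b Na Nb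
  proof unfold_locales
    show "flat_connection \<A> a" "flat_connection \<A> b" "Na (axis 3 1) = 0" "Nb (axis 3 1) = 0"
      by (fact a b)+
    show "0 < 1 - e" "1 - e < 1 - e/2" "1 - e/2 < 1" using e by simp_all
    show "a c (cmap c (\<kappa> y)) (D_collar \<kappa> c y v) = Na v"
      if "c \<in> \<A>" "y \<in> collar_part \<kappa> c" "1 - e < y $ 3" for c y v
    proof -
      have "1 - ea < y $ 3" using that(3) e(2) by linarith
      then show ?thesis using ea(2) that(1,2) by blast
    qed
    show "b c (cmap c (\<kappa> y)) (D_collar \<kappa> c y v) = Nb v"
      if "c \<in> \<A>" "y \<in> collar_part \<kappa> c" "1 - e < y $ 3" for c y v
    proof -
      have "1 - eb < y $ 3" using that(3) e(3) by linarith
      then show ?thesis using eb(2) that(1,2) by blast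
    qed
  qed (fact h)+
  show ?thesis using stokes unfolding boundary_term_def .
qed

lemma pou_integral_cubic_defect_split:
  assumes a: "flat_connection \<A> a" and b: "flat_connection \<A> b"
  shows "pou_integral (cubic_defect a b) = pou_integral (\<lambda>c z. cubic (b c z)) -
    pou_integral (\<lambda>c z. cubic (a c z)) - pou_integral (\<lambda>c z. cubic (\<lambda>v. b c z v - a c z v))"
proof -
  have int: "(\<lambda>z. \<rho> c (cinv c z) *\<^sub>R cubic (f z)) integrable_on cimg c"
    if "c \<in> active" "\<And>v. continuous_on (cimg c) (\<lambda>z. f z v)" for c and f :: "real^3 \<Rightarrow> real^3 \<Rightarrow> cmat"
    by (intro set_lebesgue_integral_eq_integral(1) absolutely_integrable_partition active_subset
        continuous_cubic that)
  have "weighted c (cubic_defect a b c) =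
      weighted c (\<lambda>z. cubic (b c z)) -
      weighted c (\<lambda>z. cubic (a c z)) -
      weighted c (\<lambda>z. cubic (\<lambda>v. b c z v - a c z v))" if c: "c \<in> active" for c
  proof -
    have "continuous_on (cimg c) (\<lambda>z. a c z v)" "continuous_on (cimg c) (\<lambda>z. b c z v)" for v
      by (intro form_continuous a b active_subset c)+
    then show ?thesis
      unfolding cubic_defect_def scaleR_diff_right
      by (simp only: integral_diff integrable_diff int c continuous_on_diff)
  qed
  then show ?thesis by (simp add: pou_integral_def sum_subtractf)
qed

section \<open>Lipschitz dependence on t and the cubic error term\<close>

lemma path_flat: "smooth_path_of_flat_connections \<A> A \<Longrightarrow> t \<in> {0..1} \<Longrightarrow> flat_connection \<A> (A t)"
  unfolding smooth_path_of_flat_connections_def by blast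

definition path_dot :: "(real \<Rightarrow> 'a mform1) \<Rightarrow> 'a chart \<Rightarrow> real^3 \<Rightarrow> real \<times> (real^3) \<Rightarrow> cmat" where
  "path_dot A c v x = frechet_derivative (\<lambda>(t, z). A t c z v) (at x within {0..1} \<times> cimg c) (1, 0)"

lemma path_dot_continuous:
  assumes "smooth_path_of_flat_connections \<A> A" "c \<in> \<A>"
  shows "continuous_on ({0..1} \<times> cimg c) (path_dot A c v)"
proof -
  have "Ck_on (Suc 0) ({0..1} \<times> cimg c) (\<lambda>(t, z). A t c z v)"
    using assms unfolding smooth_path_of_flat_connections_def smooth_on_def by blast
  then show ?thesis unfolding path_dot_def[abs_def] Ck_on.simps by blast
qed

lemma path_dot_works:
  assumes "smooth_path_of_flat_connections \<A> A" "c \<in> \<A>" "z \<in> cimg c" "t \<in> {0..1}"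
  shows "((\<lambda>t. A t c z v) has_vector_derivative path_dot A c v (t, z)) (at t within {0..1})"
proof -
  let ?S = "{0..1} \<times> cimg c" and ?F = "\<lambda>(t, z). A t c z v"
  have "Ck_on (Suc 0) ?S ?F"
    using assms(1,2) unfolding smooth_path_of_flat_connections_def smooth_on_def by blast
  then have F: "(?F has_derivative frechet_derivative ?F (at (t, z) within ?S)) (at (t, z) within ?S)"
    by (rule Ck_on_SucD) (use assms(3,4) in simp)
  have i: "((\<lambda>t. (t, z)) has_derivative (\<lambda>h. (h, 0))) (at t within {0..1})"
    by (auto intro!: derivative_eq_intros)
  have sub: "(\<lambda>t. (t, z)) ` {0..1} \<subseteq> ?S" using assms(3) by blast
  have "((\<lambda>t. ?F (t, z)) has_derivative (\<lambda>h. frechet_derivative ?F (at (t, z) within ?S) (h, 0))) (at t within {0..1})"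
    by (rule has_derivative_in_compose[OF i has_derivative_subset[OF F sub]])
  moreover have "frechet_derivative ?F (at (t, z) within ?S) (h, 0) = h *\<^sub>R path_dot A c v (t, z)" for h
    using linear_scale[OF has_derivative_linear[OF F], of h "(1, 0)"] by (simp add: path_dot_def)
  ultimately show ?thesis by (simp add: has_vector_derivative_def)
qed

text \<open>The t-derivative is jointly continuous in t and z, hence bounded on the compact product
  of the time interval with \<open>csupp c\<close>.\<close>

lemma path_lipschitz:
  assumes A: "smooth_path_of_flat_connections \<A> A" and c: "c \<in> \<A>"
  shows "\<exists>M\<ge>0. \<forall>z\<in>csupp c. \<forall>s\<in>{0..1}. \<forall>t\<in>{0..1}. norm (A t c z v - A s c z v) \<le> M * \<bar>t - s\<bar>"
proof -
  have "compact (path_dot A c v ` ({0..1} \<times> csupp c))"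
    using csupp_subset[OF c]
    by (intro compact_continuous_image continuous_on_subset[OF path_dot_continuous[OF A c]]
        compact_Times compact_csupp c compact_Icc Sigma_mono) auto
  then obtain M where M: "\<And>x. x \<in> path_dot A c v ` ({0..1} \<times> csupp c) \<Longrightarrow> norm x \<le> M"
    using compact_imp_bounded bounded_iff by metis
  have "norm (A t c z v - A s c z v) \<le> max M 0 * \<bar>t - s\<bar>"
    if "z \<in> csupp c" "s \<in> {0..1}" "t \<in> {0..1}" for z s t
  proof (rule vector_derivative_bound[OF path_dot_works[OF A c] _ that(2,3)])
    show "z \<in> cimg c" using that(1) csupp_subset[OF c] by blast
    show "norm (path_dot A c v (u, z)) \<le> max M 0" if "u \<in> {0..1}" for u
    proof -
      have "(u, z) \<in> {0..1} \<times> csupp c" using that \<open>z \<in> csupp c\<close> by blast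
      then show ?thesis using M[OF imageI] by (meson max.coboundedI1)
    qed
  qed auto
  then show ?thesis by (intro exI[of _ "max M 0"]) simp
qed

lemma path_lipschitz_uniform:
  assumes A: "smooth_path_of_flat_connections \<A> A" and c: "c \<in> \<A>"
  shows "\<exists>M\<ge>0. \<forall>z\<in>csupp c. \<forall>s\<in>{0..1}. \<forall>t\<in>{0..1}. \<forall>i.
    norm (A t c z (axis i 1) - A s c z (axis i 1)) \<le> M * \<bar>t - s\<bar>"
proof -
  have "\<forall>i::3. \<exists>M\<ge>0. \<forall>z\<in>csupp c. \<forall>s\<in>{0..1}. \<forall>t\<in>{0..1}.
      norm (A t c z (axis i 1) - A s c z (axis i 1)) \<le> M * \<bar>t - s\<bar>"
    using path_lipschitz[OF A c] by blast
  then obtain M where M: "\<And>i::3. 0 \<le> M i" "\<And>i z s t. z \<in> csupp c \<Longrightarrow> s \<in> {0..1} \<Longrightarrow> t \<in> {0..1} \<Longrightarrow>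
      norm (A t c z (axis i 1) - A s c z (axis i 1)) \<le> M i * \<bar>t - s\<bar>"
    by metis
  have "M i * \<bar>t - s\<bar> \<le> (\<Sum>i\<in>UNIV. M i) * \<bar>t - s\<bar>" for i and s t :: real
    using M(1) by (intro mult_right_mono member_le_sum) auto
  then have "norm (A t c z (axis i 1) - A s c z (axis i 1)) \<le> (\<Sum>i\<in>UNIV. M i) * \<bar>t - s\<bar>"
    if "z \<in> csupp c" "s \<in> {0..1}" "t \<in> {0..1}" for z s t i
    using M(2)[OF that] order_trans by blast
  moreover have "0 \<le> (\<Sum>i\<in>UNIV. M i)" using M(1) by (simp add: sum_nonneg)
  ultimately show ?thesis by blast
qed

text \<open>Three factors of order |t - s| each, integrated over the compact sets
  \<open>csupp c\<close>.\<close>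

lemma pou_integral_cubic_diff_bound:
  assumes A: "smooth_path_of_flat_connections \<A> A"
  shows "\<exists>C. \<forall>s\<in>{0..1}. \<forall>t\<in>{0..1}.
    norm (pou_integral (\<lambda>c z. cubic (\<lambda>v. A t c z v - A s c z v))) \<le> C * \<bar>t - s\<bar> ^ 3"
proof -
  obtain K where K: "\<And>f M. 0 \<le> M \<Longrightarrow> (\<forall>i. norm (f (axis i 1)) \<le> M) \<Longrightarrow> norm (cubic f) \<le> K * M ^ 3"
    using cubic_bound by blast
  have "\<exists>C. \<forall>s\<in>{0..1}. \<forall>t\<in>{0..1}.
      norm (weighted c (\<lambda>z. cubic (\<lambda>v. A t c z v - A s c z v))) \<le> C * \<bar>t - s\<bar> ^ 3"
    if ca: "c \<in> active" for c
  proof -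
    note c = active_subset[OF ca]
    obtain M where M: "0 \<le> M" "\<And>z s t i. z \<in> csupp c \<Longrightarrow> s \<in> {0..1} \<Longrightarrow> t \<in> {0..1} \<Longrightarrow>
        norm (A t c z (axis i 1) - A s c z (axis i 1)) \<le> M * \<bar>t - s\<bar>"
      using path_lipschitz_uniform[OF A c] by blast
    obtain R where R: "\<And>z. z \<in> csupp c \<Longrightarrow> norm (\<rho> c (cinv c z)) \<le> R"
      using continuous_bounded_csupp[OF c continuous_partition[OF c c]] by blast
    define V where "V = integral (csupp c) (\<lambda>z. 1::real)"
    have one: "(\<lambda>z. 1::real) integrable_on csupp c"
      by (rule set_lebesgue_integral_eq_integral(1),
          rule absolutely_integrable_compact_support[OF compact_csupp[OF c]]) auto
    have "norm (weighted c (\<lambda>z. cubic (\<lambda>v. A t c z v - A s c z v)))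
        \<le> (R * (K * M ^ 3) * V) * \<bar>t - s\<bar> ^ 3" if st: "s \<in> {0..1}" "t \<in> {0..1}" for s t
    proof -
      define G where "G z = \<rho> c (cinv c z) *\<^sub>R cubic (\<lambda>v. A t c z v - A s c z v)" for z
      define B where "B = R * (K * (M * \<bar>t - s\<bar>) ^ 3)"
      have G0: "G z = 0" if "z \<in> cimg c" "z \<notin> csupp c" for z
        using that csupp_iff[OF c that(1)] partition_zero[OF cinv_topspace[OF c that(1)]] by (simp add: G_def)
      have e: "{z \<in> cimg c - csupp c. G z \<noteq> 0} = {}" "{z \<in> csupp c - cimg c. G z \<noteq> 0} = {}"
        using G0 csupp_subset[OF c] by blast+
      have "G absolutely_integrable_on cimg c"
        unfolding G_def[abs_def]
        by (intro absolutely_integrable_partition c continuous_cubic continuous_on_diff form_continuous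
            path_flat[OF A] st)
      then have G_int: "G absolutely_integrable_on csupp c"
        using absolutely_integrable_spike_set_eq[of "cimg c" "csupp c" G] unfolding e by (simp only: negligible_empty)
      have "integral (cimg c) G = integral (csupp c) G"
        by (rule integral_spike_set) (simp_all only: e negligible_empty)
      also have "norm \<dots> \<le> integral (csupp c) (\<lambda>z. B * 1)"
      proof (rule integral_norm_bound_integral)
        show "G integrable_on csupp c" by (rule set_lebesgue_integral_eq_integral(1)[OF G_int])
        show "(\<lambda>z. B * 1) integrable_on csupp c" by (rule integrable_on_mult_right[OF one])
        fix z assume z: "z \<in> csupp c"
        have "norm (cubic (\<lambda>v. A t c z v - A s c z v)) \<le> K * (M * \<bar>t - s\<bar>) ^ 3"
          using M(1) M(2)[OF z st] by (intro K) auto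
        moreover have "0 \<le> R" using R[OF z] norm_ge_zero order_trans by blast
        ultimately have "norm (\<rho> c (cinv c z)) * norm (cubic (\<lambda>v. A t c z v - A s c z v)) \<le> B"
          unfolding B_def using R[OF z] by (intro mult_mono) auto
        then show "norm (G z) \<le> B * 1" by (simp add: G_def)
      qed
      also have "\<dots> = B * V" unfolding V_def by (rule integral_mult_right)
      also have "\<dots> = (R * (K * M ^ 3) * V) * \<bar>t - s\<bar> ^ 3"
        by (simp add: B_def power_mult_distrib)
      finally show ?thesis by (simp only: G_def[abs_def])
    qed
    then show ?thesis by blast
  qed
  then have "\<forall>c\<in>active. \<exists>C. \<forall>s\<in>{0..1}. \<forall>t\<in>{0..1}.
      norm (weighted c (\<lambda>z. cubic (\<lambda>v. A t c z v - A s c z v))) \<le> C * \<bar>t - s\<bar> ^ 3"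
    by (rule ballI)
  from bchoice[OF this] obtain C where "\<forall>c\<in>active. \<forall>s\<in>{0..1}. \<forall>t\<in>{0..1}.
      norm (weighted c (\<lambda>z. cubic (\<lambda>v. A t c z v - A s c z v))) \<le> C c * \<bar>t - s\<bar> ^ 3"
    ..
  note C = this[rule_format]
  have "norm (pou_integral (\<lambda>c z. cubic (\<lambda>v. A t c z v - A s c z v))) \<le> (\<Sum>c\<in>active. C c) * \<bar>t - s\<bar> ^ 3"
    if "s \<in> {0..1}" "t \<in> {0..1}" for s t
    unfolding pou_integral_def sum_distrib_right by (rule sum_norm_le) (rule C[OF _ that])
  then show ?thesis by blast
qed

text \<open>A single boundary point determines the parameters: each is a linear function of the
  matrix that \<open>A t\<close> assigns to a fixed tangent vector there, so it inherits its
  regularity in t from the path.\<close>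

lemma C1_boundary_value:
  assumes A: "smooth_path_of_flat_connections \<A> A"
    and near: "\<And>t. t \<in> {0..1} \<Longrightarrow> equals_near_boundary \<A> \<kappa> (A t) (N t)"
    and L: "bounded_linear (L :: cmat \<Rightarrow> real)" and f: "\<And>t. L (N t v) = f t"
  shows "C1_param f"
proof -
  define y :: "real^3" where "y = vector [0, 0, 1]"
  have y: "y \<in> slab" "y $ 3 = 1" by (simp_all add: y_def slab_def)
  obtain c where c: "c \<in> \<A>" "\<kappa> y \<in> cdom c"
    using collar_topspace[OF y(1)] cdom_cover by blast
  have yc: "y \<in> collar_part \<kappa> c" using y(1) c(2) by (simp add: collar_part_def)
  let ?z = "cmap c (\<kappa> y)" and ?v = "D_collar \<kappa> c y v"
  have z: "?z \<in> cimg c" using c(2) by (rule imageI)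
  have eq: "L (A t c ?z ?v) = f t" if t: "t \<in> {0..1}" for t
  proof -
    obtain e where e: "e > 0" "\<forall>c\<in>\<A>. \<forall>z\<in>collar_part \<kappa> c. 1 - e < z $ 3 \<longrightarrow>
       (\<forall>v. A t c (cmap c (\<kappa> z)) (D_collar \<kappa> c z v) = N t v)"
      using near[OF t] unfolding equals_near_boundary_def by blast
    have "1 - e < y $ 3" using e(1) y(2) by simp
    then have "A t c ?z ?v = N t v" using e(2) c(1) yc by blast
    then show ?thesis using f by simp
  qed
  have 1: "(f has_vector_derivative L (path_dot A c ?v (t, ?z))) (at t within {0..1})" if t: "t \<in> {0..1}" for t
  proof (rule has_vector_derivative_transform[OF t])
    show "((\<lambda>t. L (A t c ?z ?v)) has_vector_derivative L (path_dot A c ?v (t, ?z))) (at t within {0..1})"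
      by (rule bounded_linear.has_vector_derivative[OF L path_dot_works[OF A c(1) z t]])
  qed (simp add: eq)
  have 2: "continuous_on {0..1} (\<lambda>t. L (path_dot A c ?v (t, ?z)))"
  proof (rule bounded_linear.continuous_on[OF L])
    show "continuous_on {0..1} (\<lambda>t. path_dot A c ?v (t, ?z))"
      by (rule continuous_on_compose2[OF path_dot_continuous[OF A c(1)]])
         (use z in \<open>auto intro!: continuous_intros\<close>)
  qed
  show ?thesis
    unfolding C1_param_def by (intro exI[of _ "\<lambda>t. L (path_dot A c ?v (t, ?z))"] conjI ballI 1 2)
qed

text \<open>The factor -8 \<pi>^2 in the hypothesis on \<open>wtrace\<close> cancels the constant in
  \<open>cs_pou\<close>. Besides \<open>g s t\<close>, only the integral of \<open>cubic\<close> of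
  A t - A s remains, which is of third order in t - s.\<close>

theorem cs_difference:
  assumes \<rho>: "\<rho> = (SOME \<rho>. partition_of_unity X \<A> \<rho>)"
    and A: "smooth_path_of_flat_connections \<A> A"
    and near: "\<And>t. t \<in> {0..1} \<Longrightarrow> equals_near_boundary \<A> \<kappa> (A t) (N t)"
    and no_dr: "\<And>t. N t (axis 3 1) = 0"
    and g: "\<And>s t. wtrace (N s) (N t) (axis 1 1) (axis 2 1) = of_real (- 8 * pi\<^sup>2 * g s t)"
    and g': "\<And>s. s \<in> {0..1} \<Longrightarrow> (g s has_vector_derivative g' s) (at s within {0..1})"
  shows "cs X \<A> (A 1) - cs X \<A> (A 0) = of_real (integral {0..1} g')"
proof -
  obtain C where C: "\<And>s t. s \<in> {0..1} \<Longrightarrow> t \<in> {0..1} \<Longrightarrow>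
      norm (pou_integral (\<lambda>c z. cubic (\<lambda>v. A t c z v - A s c z v))) \<le> C * \<bar>t - s\<bar> ^ 3"
    using pou_integral_cubic_diff_bound[OF A] by blast
  define k where "k = 1 / (8 * pi\<^sup>2)"
  have k: "k * (8 * pi\<^sup>2) = 1" "0 < k" by (simp_all add: k_def)
  show ?thesis
  proof (rule fundamental_theorem_cubic_error[where C = "k * C" and g = g])
    fix s t :: real assume st: "s \<in> {0..1}" "t \<in> {0..1}"
    let ?P = "pou_integral (\<lambda>c z. cubic (\<lambda>v. A t c z v - A s c z v))"
    have cs: "cs X \<A> (A u) = - of_real k * pou_integral (\<lambda>c z. cubic (A u c z))" if "u \<in> {0..1}" for u
      using cs_pou[OF \<rho> path_flat[OF A that]] by (simp add: k_def)
    have "of_real (- 8 * pi\<^sup>2 * g s t) = pou_integral (\<lambda>c z. cubic (A t c z)) -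
        pou_integral (\<lambda>c z. cubic (A s c z)) - ?P"
      unfolding g[symmetric] pou_integral_cubic_defect_split[OF path_flat[OF A st(1)] path_flat[OF A st(2)], symmetric]
      by (rule cubic_defect_integral[symmetric]) (intro path_flat[OF A] near no_dr st)+
    then have e: "pou_integral (\<lambda>c z. cubic (A t c z)) =
        pou_integral (\<lambda>c z. cubic (A s c z)) + ?P + of_real (- 8 * pi\<^sup>2 * g s t)"
      by (simp add: algebra_simps)
    have "cs X \<A> (A t) - cs X \<A> (A s) = of_real (k * (8 * pi\<^sup>2) * g s t) - of_real k * ?P"
      unfolding cs[OF st(1)] cs[OF st(2)] e by (simp add: algebra_simps)
    then have "cs X \<A> (A t) - cs X \<A> (A s) - of_real (g s t) = - (of_real k * ?P)"
      unfolding k(1) by simp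
    then have "norm (cs X \<A> (A t) - cs X \<A> (A s) - of_real (g s t)) = k * norm ?P"
      using k(2) by (simp add: norm_mult)
    then show "norm (cs X \<A> (A t) - cs X \<A> (A s) - of_real (g s t)) \<le> k * C * \<bar>t - s\<bar> ^ 3"
      using mult_left_mono[OF C[OF st], of k] k(2) by (simp add: mult.assoc)
  qed (rule g')
qed

end

section \<open>The four normal forms\<close>

lemma lin_axis:
  "lin p q (axis 1 1) = of_real p" "lin p q (axis 2 1) = of_real q" "lin p q (axis 3 1) = 0"
  by (simp_all add: lin_def dx_def dy_def axis_def)

lemma tlin_axis:
  "tlin p q (axis 1 1) = 2 * of_real pi * \<i> * of_real p"
  "tlin p q (axis 2 1) = 2 * of_real pi * \<i> * of_real q" "tlin p q (axis 3 1) = 0"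
  by (simp_all add: tlin_def lin_axis)

lemma bounded_linear_entry:
  "bounded_linear (\<lambda>M::cmat. Im (M $ i $ j) / c)" "bounded_linear (\<lambda>M::cmat. Re (M $ i $ j))"
  "bounded_linear (\<lambda>M::cmat. (Im (M $ i $ j) + Im (M $ k $ l)) / c)"
  by (auto intro!: linear_conv_bounded_linear[THEN iffD1] linearI simp: add_divide_distrib algebra_simps)

lemma wtrace_expand:
  "wtrace f g u v = (\<Sum>i\<in>UNIV. \<Sum>j\<in>UNIV. f u $ i $ j * g v $ j $ i - f v $ i $ j * g u $ j $ i)"
  by (simp add: wtrace_def trace_def matrix_matrix_mult_def sum_subtractf)

text \<open>Two entries with factor 2 \<pi> i multiply to -4 \<pi>^2, half of -8 \<pi>^2; hence the
  factors 1/2. Here and below the right side is a sum of multiples in the shape of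
  \<open>swirl_derivative\<close>, with a factor 1 where necessary.\<close>

lemma wtrace_nf_elliptic:
  "wtrace (nf_elliptic a1 b1 a2 b2 a3 b3) (nf_elliptic a1' b1' a2' b2' a3' b3') (axis 1 1) (axis 2 1) =
    of_real (- 8 * pi\<^sup>2 * (1/2 * (a1 * b1' - b1 * a1') + 1/2 * (a2 * b2' - b2 * a2') + 1/2 * (a3 * b3' - b3 * a3')))"
  by (simp add: wtrace_expand sum_3 nf_elliptic_def tlin_axis algebra_simps power2_eq_square)

text \<open>The off-diagonal entries are real, without the factor 2 \<pi> i. Together they give 2 (u
  v' - v u'), and 2 divided by -8 \<pi>^2 is the last constant. The last two diagonal entries are
  equal, which doubles 1/2 to 1.\<close>

lemma wtrace_nf_loxodromic:
  "wtrace (nf_loxodromic p1 q1 p2 q2 u v) (nf_loxodromic p1' q1' p2' q2' u' v') (axis 1 1) (axis 2 1) =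
    of_real (- 8 * pi\<^sup>2 * (1/2 * (p1 * q1' - q1 * p1') + 1 * (p2 * q2' - q2 * p2') +
      (- 1 / (4 * pi\<^sup>2)) * (u * v' - v * u')))"
  by (simp add: wtrace_expand sum_3 nf_loxodromic_def tlin_axis lin_axis field_simps power2_eq_square)

text \<open>The part built from \<omega> and \<eta> has trace 0, and so has the product of two such
  parts. Only the three equal diagonal entries \<xi> contribute.\<close>

lemma wtrace_nf_parabolic1:
  "wtrace (nf_parabolic1 p q a b x y) (nf_parabolic1 p' q' a' b' x' y') (axis 1 1) (axis 2 1) =
    of_real (- 8 * pi\<^sup>2 * (3/2 * (x * y' - y * x')))"
  by (simp add: wtrace_expand sum_3 nf_parabolic1_def Let_def tlin_axis lin_axis algebra_simps power2_eq_square)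

text \<open>Again the part with \<omega> drops out by tracelessness; \<xi>1 occurs twice on the
  diagonal and \<xi>2 once.\<close>

lemma wtrace_nf_parabolic2:
  "wtrace (nf_parabolic2 p q x1 y1 x2 y2) (nf_parabolic2 p' q' x1' y1' x2' y2') (axis 1 1) (axis 2 1) =
    of_real (- 8 * pi\<^sup>2 * (1 * (x1 * y1' - y1 * x1') + 1/2 * (x2 * y2' - y2 * x2')))"
  by (simp add: wtrace_expand sum_3 nf_parabolic2_def Let_def tlin_axis lin_axis algebra_simps power2_eq_square)

lemma nf_axis_3:
  "nf_elliptic a1 b1 a2 b2 a3 b3 (axis 3 1) = 0" "nf_loxodromic p1 q1 p2 q2 u v (axis 3 1) = 0"
  "nf_parabolic1 p q a b x y (axis 3 1) = 0" "nf_parabolic2 p q x1 y1 x2 y2 (axis 3 1) = 0"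
  by (simp_all add: vec_eq_iff forall_3 nf_elliptic_def nf_loxodromic_def nf_parabolic1_def
      nf_parabolic2_def Let_def tlin_axis lin_axis)

theorem theorem5p1:
  fixes X :: "'a topology" and \<A> :: "'a chart set" and \<kappa> :: "real^3 \<Rightarrow> 'a"
    and A :: "real \<Rightarrow> 'a mform1"
    and \<rho> :: "real \<Rightarrow> (real \<Rightarrow> 'a) set \<Rightarrow> cover_elt"
    and \<mu> \<l> :: "(real \<Rightarrow> 'a) set"
  assumes "oriented_compact_3manifold X \<A>"
    and "torus_collar X \<A> \<kappa>"
    and "\<mu> = loop_class X (meridian \<kappa>)" and "\<l> = loop_class X (longitude \<kappa>)"
    and "smooth_path_of_flat_connections \<A> A"
    and "\<And>t. t \<in> {0..1} \<Longrightarrow> normal_form \<A> \<kappa> (A t)"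
    and "\<And>t. t \<in> {0..1} \<Longrightarrow> \<rho> t = holonomy_rep \<A> (A t)"
  shows
    "(\<forall>\<alpha>1 \<beta>1 \<alpha>2 \<beta>2 \<alpha>3 \<beta>3.
       (\<forall>t\<in>{0..1}. has_type elliptic (\<rho> t \<mu>) \<and> has_type elliptic (\<rho> t \<l>) \<and>
          equals_near_boundary \<A> \<kappa> (A t)
            (nf_elliptic (\<alpha>1 t) (\<beta>1 t) (\<alpha>2 t) (\<beta>2 t) (\<alpha>3 t) (\<beta>3 t)))
       \<longrightarrow> cong_mod_Z (cs X \<A> (A 1) - cs X \<A> (A 0))
             (1/2 * integral {0..1} (\<lambda>t.
                (\<alpha>1 t * dot \<beta>1 t - dot \<alpha>1 t * \<beta>1 t) +
                (\<alpha>2 t * dot \<beta>2 t - dot \<alpha>2 t * \<beta>2 t) +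
                (\<alpha>3 t * dot \<beta>3 t - dot \<alpha>3 t * \<beta>3 t)))) \<and>
     (\<forall>\<theta>1 \<tau>1 \<theta>2 \<tau>2 u v.
       (\<forall>t\<in>{0..1}. has_type loxodromic (\<rho> t \<mu>) \<and> has_type loxodromic (\<rho> t \<l>) \<and>
          equals_near_boundary \<A> \<kappa> (A t)
            (nf_loxodromic (\<theta>1 t) (\<tau>1 t) (\<theta>2 t) (\<tau>2 t) (u t) (v t)))
       \<longrightarrow> cong_mod_Z (cs X \<A> (A 1) - cs X \<A> (A 0))
             (1/2 * integral {0..1} (\<lambda>t. \<theta>1 t * dot \<tau>1 t - dot \<theta>1 t * \<tau>1 t) +
              integral {0..1} (\<lambda>t. \<theta>2 t * dot \<tau>2 t - dot \<theta>2 t * \<tau>2 t) +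
              1 / (4 * pi\<^sup>2) * integral {0..1} (\<lambda>t. dot u t * v t - u t * dot v t))) \<and>
     (\<forall>p q a b \<alpha> \<beta>.
       (\<forall>t\<in>{0..1}. has_type (parabolic_with ([:-1, 1:] ^ 3)) (\<rho> t \<mu>) \<and>
          has_type (parabolic_with ([:-1, 1:] ^ 3)) (\<rho> t \<l>) \<and>
          equals_near_boundary \<A> \<kappa> (A t)
            (nf_parabolic1 (p t) (q t) (a t) (b t) (\<alpha> t) (\<beta> t)))
       \<longrightarrow> cong_mod_Z (cs X \<A> (A 1) - cs X \<A> (A 0))
             (3/2 * integral {0..1} (\<lambda>t. \<alpha> t * dot \<beta> t - dot \<alpha> t * \<beta> t))) \<and>
     (\<forall>p q \<theta>1 \<tau>1 \<theta>2 \<tau>2.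
       (\<forall>t\<in>{0..1}. has_type (parabolic_with ([:-1, 1:] ^ 2)) (\<rho> t \<mu>) \<and>
          has_type (parabolic_with ([:-1, 1:] ^ 2)) (\<rho> t \<l>) \<and>
          equals_near_boundary \<A> \<kappa> (A t)
            (nf_parabolic2 (p t) (q t) (\<theta>1 t) (\<tau>1 t) (\<theta>2 t) (\<tau>2 t)))
       \<longrightarrow> cong_mod_Z (cs X \<A> (A 1) - cs X \<A> (A 0))
             (integral {0..1} (\<lambda>t. \<theta>1 t * dot \<tau>1 t - dot \<theta>1 t * \<tau>1 t) +
              1/2 * integral {0..1} (\<lambda>t. \<theta>2 t * dot \<tau>2 t - dot \<theta>2 t * \<tau>2 t)))"
proof -
  interpret atlas X \<A> by unfold_locales (rule assms(1))
  \<comment> \<open>The very partition that \<open>form_integral\<close> chooses; with it as locale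
    parameter, \<open>cs_pou\<close> can unfold \<open>cs\<close>.\<close>
  define \<sigma> where "\<sigma> = (SOME \<rho>. partition_of_unity X \<A> \<rho>)"
  have "partition_of_unity X \<A> \<sigma>"
    unfolding \<sigma>_def by (rule someI_ex[OF exists_partition_of_unity])
  then interpret collar X \<A> \<sigma> \<kappa> using assms(2) by unfold_locales
  note C1 = C1_boundary_value[OF assms(5)] and diff = cs_difference[OF \<sigma>_def assms(5)]
  note derivs = has_vector_derivative_add swirl_derivative
  have cong: "cong_mod_Z x r" if "x = of_real r" for x r
    using that by (simp add: cong_mod_Z_def)
  have ell: "cong_mod_Z (cs X \<A> (A 1) - cs X \<A> (A 0))
      (1/2 * integral {0..1} (\<lambda>t. (\<alpha>1 t * dot \<beta>1 t - dot \<alpha>1 t * \<beta>1 t) +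
        (\<alpha>2 t * dot \<beta>2 t - dot \<alpha>2 t * \<beta>2 t) + (\<alpha>3 t * dot \<beta>3 t - dot \<alpha>3 t * \<beta>3 t)))"
    (is "cong_mod_Z _ ?r")
    if near: "\<And>t. t \<in> {0..1} \<Longrightarrow> equals_near_boundary \<A> \<kappa> (A t)
      (nf_elliptic (\<alpha>1 t) (\<beta>1 t) (\<alpha>2 t) (\<beta>2 t) (\<alpha>3 t) (\<beta>3 t))" for \<alpha>1 \<beta>1 \<alpha>2 \<beta>2 \<alpha>3 \<beta>3
  proof (rule cong)
    let ?N = "\<lambda>t. nf_elliptic (\<alpha>1 t) (\<beta>1 t) (\<alpha>2 t) (\<beta>2 t) (\<alpha>3 t) (\<beta>3 t)"
    have entry: "Im (?N t (axis 1 1) $ 1 $ 1) / (2 * pi) = \<alpha>1 t"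
      "Im (?N t (axis 2 1) $ 1 $ 1) / (2 * pi) = \<beta>1 t"
      "Im (?N t (axis 1 1) $ 2 $ 2) / (2 * pi) = \<alpha>2 t"
      "Im (?N t (axis 2 1) $ 2 $ 2) / (2 * pi) = \<beta>2 t"
      "Im (?N t (axis 1 1) $ 3 $ 3) / (2 * pi) = \<alpha>3 t"
      "Im (?N t (axis 2 1) $ 3 $ 3) / (2 * pi) = \<beta>3 t" for t
      by (simp_all add: nf_elliptic_def tlin_axis)
    note c = C1[OF near bounded_linear_entry(1) entry(1)] C1[OF near bounded_linear_entry(1) entry(2)]
      C1[OF near bounded_linear_entry(1) entry(3)] C1[OF near bounded_linear_entry(1) entry(4)]
      C1[OF near bounded_linear_entry(1) entry(5)] C1[OF near bounded_linear_entry(1) entry(6)]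
    have "cs X \<A> (A 1) - cs X \<A> (A 0) = of_real (integral {0..1}
        (\<lambda>s. 1/2 * swirl \<alpha>1 \<beta>1 s + 1/2 * swirl \<alpha>2 \<beta>2 s + 1/2 * swirl \<alpha>3 \<beta>3 s))"
      by (rule diff[OF near nf_axis_3(1) wtrace_nf_elliptic]) (assumption | intro derivs c)+
    then show "cs X \<A> (A 1) - cs X \<A> (A 0) = of_real ?r"
      unfolding integral_mult_right[symmetric] by (simp only: swirl_def distrib_left)
  qed
  have lox: "cong_mod_Z (cs X \<A> (A 1) - cs X \<A> (A 0))
      (1/2 * integral {0..1} (\<lambda>t. \<theta>1 t * dot \<tau>1 t - dot \<theta>1 t * \<tau>1 t) +
       integral {0..1} (\<lambda>t. \<theta>2 t * dot \<tau>2 t - dot \<theta>2 t * \<tau>2 t) +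
       1 / (4 * pi\<^sup>2) * integral {0..1} (\<lambda>t. dot u t * v t - u t * dot v t))"
    (is "cong_mod_Z _ ?r")
    if near: "\<And>t. t \<in> {0..1} \<Longrightarrow> equals_near_boundary \<A> \<kappa> (A t)
      (nf_loxodromic (\<theta>1 t) (\<tau>1 t) (\<theta>2 t) (\<tau>2 t) (u t) (v t))" for \<theta>1 \<tau>1 \<theta>2 \<tau>2 u v
  proof (rule cong)
    let ?N = "\<lambda>t. nf_loxodromic (\<theta>1 t) (\<tau>1 t) (\<theta>2 t) (\<tau>2 t) (u t) (v t)"
    have entry: "Im (?N t (axis 1 1) $ 1 $ 1) / (2 * pi) = \<theta>1 t"
      "Im (?N t (axis 2 1) $ 1 $ 1) / (2 * pi) = \<tau>1 t"
      "Im (?N t (axis 1 1) $ 2 $ 2) / (2 * pi) = \<theta>2 t"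
      "Im (?N t (axis 2 1) $ 2 $ 2) / (2 * pi) = \<tau>2 t"
      "Re (?N t (axis 1 1) $ 2 $ 3) = u t"
      "Re (?N t (axis 2 1) $ 2 $ 3) = v t" for t
      by (simp_all add: nf_loxodromic_def tlin_axis lin_axis)
    note c = C1[OF near bounded_linear_entry(1) entry(1)] C1[OF near bounded_linear_entry(1) entry(2)]
      C1[OF near bounded_linear_entry(1) entry(3)] C1[OF near bounded_linear_entry(1) entry(4)]
      C1[OF near bounded_linear_entry(2) entry(5)] C1[OF near bounded_linear_entry(2) entry(6)]
    note int = swirl_integrable[OF c(1,2)] swirl_integrable[OF c(3,4)] swirl_integrable[OF c(5,6)]
    have "cs X \<A> (A 1) - cs X \<A> (A 0) = of_real (integral {0..1}
        (\<lambda>s. 1/2 * swirl \<theta>1 \<tau>1 s + 1 * swirl \<theta>2 \<tau>2 s + (- 1 / (4 * pi\<^sup>2)) * swirl u v s))"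
      by (rule diff[OF near nf_axis_3(2) wtrace_nf_loxodromic]) (assumption | intro derivs c)+
    also have "integral {0..1} (\<lambda>s. 1/2 * swirl \<theta>1 \<tau>1 s + 1 * swirl \<theta>2 \<tau>2 s + (- 1 / (4 * pi\<^sup>2)) * swirl u v s) =
        1/2 * integral {0..1} (swirl \<theta>1 \<tau>1) + 1 * integral {0..1} (swirl \<theta>2 \<tau>2) +
        (- 1 / (4 * pi\<^sup>2)) * integral {0..1} (swirl u v)"
      by (simp only: integral_add integrable_add integrable_on_mult_right int integral_mult_right)
    \<comment> \<open>The theorem states the last integrand as the negative of
      \<open>swirl u v\<close>, with a positive coefficient.\<close>
    also have "(- 1 / (4 * pi\<^sup>2)) * integral {0..1} (swirl u v) =
        1 / (4 * pi\<^sup>2) * integral {0..1} (\<lambda>t. dot u t * v t - u t * dot v t)"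
    proof -
      have "integral {0..1} (\<lambda>t. dot u t * v t - u t * dot v t) = integral {0..1} (\<lambda>t. - swirl u v t)"
        by (simp only: swirl_def minus_diff_eq)
      then show ?thesis by simp
    qed
    finally show "cs X \<A> (A 1) - cs X \<A> (A 0) = of_real ?r"
      by (simp only: swirl_def[abs_def] mult_1)
  qed
  have par1: "cong_mod_Z (cs X \<A> (A 1) - cs X \<A> (A 0))
      (3/2 * integral {0..1} (\<lambda>t. \<alpha> t * dot \<beta> t - dot \<alpha> t * \<beta> t))"
    (is "cong_mod_Z _ ?r")
    if near: "\<And>t. t \<in> {0..1} \<Longrightarrow> equals_near_boundary \<A> \<kappa> (A t)
      (nf_parabolic1 (p t) (q t) (a t) (b t) (\<alpha> t) (\<beta> t))" for p q a b \<alpha> \<beta>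
  proof (rule cong)
    let ?N = "\<lambda>t. nf_parabolic1 (p t) (q t) (a t) (b t) (\<alpha> t) (\<beta> t)"
    \<comment> \<open>The middle diagonal entry is the only one free of \<omega>.\<close>
    have entry: "Im (?N t (axis 1 1) $ 2 $ 2) / (2 * pi) = \<alpha> t"
      "Im (?N t (axis 2 1) $ 2 $ 2) / (2 * pi) = \<beta> t" for t
      by (simp_all add: nf_parabolic1_def Let_def tlin_axis)
    note c = C1[OF near bounded_linear_entry(1) entry(1)] C1[OF near bounded_linear_entry(1) entry(2)]
    have "cs X \<A> (A 1) - cs X \<A> (A 0) = of_real (integral {0..1} (\<lambda>s. 3/2 * swirl \<alpha> \<beta> s))"
      by (rule diff[OF near nf_axis_3(3) wtrace_nf_parabolic1]) (assumption | intro derivs c)+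
    then show "cs X \<A> (A 1) - cs X \<A> (A 0) = of_real ?r"
      unfolding integral_mult_right[symmetric] by (simp only: swirl_def)
  qed
  have par2: "cong_mod_Z (cs X \<A> (A 1) - cs X \<A> (A 0))
      (integral {0..1} (\<lambda>t. \<theta>1 t * dot \<tau>1 t - dot \<theta>1 t * \<tau>1 t) +
       1/2 * integral {0..1} (\<lambda>t. \<theta>2 t * dot \<tau>2 t - dot \<theta>2 t * \<tau>2 t))"
    (is "cong_mod_Z _ ?r")
    if near: "\<And>t. t \<in> {0..1} \<Longrightarrow> equals_near_boundary \<A> \<kappa> (A t)
      (nf_parabolic2 (p t) (q t) (\<theta>1 t) (\<tau>1 t) (\<theta>2 t) (\<tau>2 t))" for p q \<theta>1 \<tau>1 \<theta>2 \<tau>2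
  proof (rule cong)
    let ?N = "\<lambda>t. nf_parabolic2 (p t) (q t) (\<theta>1 t) (\<tau>1 t) (\<theta>2 t) (\<tau>2 t)"
    \<comment> \<open>The first and the last diagonal entry carry -i \<omega> and i \<omega>, which
      cancel in the sum; \<xi>1 is then counted twice, hence the divisor 4 \<pi>.\<close>
    have entry: "(Im (?N t (axis 1 1) $ 1 $ 1) + Im (?N t (axis 1 1) $ 3 $ 3)) / (4 * pi) = \<theta>1 t"
      "(Im (?N t (axis 2 1) $ 1 $ 1) + Im (?N t (axis 2 1) $ 3 $ 3)) / (4 * pi) = \<tau>1 t"
      "Im (?N t (axis 1 1) $ 2 $ 2) / (2 * pi) = \<theta>2 t"
      "Im (?N t (axis 2 1) $ 2 $ 2) / (2 * pi) = \<tau>2 t" for t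
      by (simp_all add: nf_parabolic2_def Let_def tlin_axis lin_axis)
    note c = C1[OF near bounded_linear_entry(3) entry(1)] C1[OF near bounded_linear_entry(3) entry(2)]
      C1[OF near bounded_linear_entry(1) entry(3)] C1[OF near bounded_linear_entry(1) entry(4)]
    note int = swirl_integrable[OF c(1,2)] swirl_integrable[OF c(3,4)]
    have "cs X \<A> (A 1) - cs X \<A> (A 0) = of_real (integral {0..1}
        (\<lambda>s. 1 * swirl \<theta>1 \<tau>1 s + 1/2 * swirl \<theta>2 \<tau>2 s))"
      by (rule diff[OF near nf_axis_3(4) wtrace_nf_parabolic2]) (assumption | intro derivs c)+
    also have "integral {0..1} (\<lambda>s. 1 * swirl \<theta>1 \<tau>1 s + 1/2 * swirl \<theta>2 \<tau>2 s) =
        1 * integral {0..1} (swirl \<theta>1 \<tau>1) + 1/2 * integral {0..1} (swirl \<theta>2 \<tau>2)"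
      by (simp only: integral_add integrable_on_mult_right int integral_mult_right)
    finally show "cs X \<A> (A 1) - cs X \<A> (A 0) = of_real ?r"
      by (simp only: swirl_def[abs_def] mult_1)
  qed
  show ?thesis
  proof (intro conjI allI impI)
  qed (rule ell lox par1 par2, blast)+
qed

end
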